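(* Let $M$ and $N$ be differentiable manifolds of dimensions $m$ and $n$. If the map $u\colon M\to N$ is colocally weakly differentiable, then $u$ has a unique (up to equality almost everywhere on $M$) colocal weak derivative $Du\colon TM\to TN$. Moreover, the bundle morphism $Du$ is bilocally integrable on $M$, and for every $f\in C^1(N,\mathbb{R})$ for which $f\circ u\colon M\to\mathbb{R}$ is weakly differentiable, one has $D(f\circ u)=Df\circ Du$ almost everywhere in $M$.
   Context: Manifolds are Hausdorff and have a countable basis. A local chart $\psi\colon V\to\mathbb{R}^m$ is a diffeomorphism from an open set $V\subseteq M$ onto an open set $\psi(V)\subseteq\mathbb{R}^m$. Negligible sets, measurable maps and locally integrable functions on $M$ are defined through local charts and Lebesgue measure. A locally integrable function $g\colon M\to\mathbb{R}$ is weakly differentiable if every $x\in M$ lies in the domain $V$ of a local chart $\psi$ for which $g\circ\psi^{-1}$ is weakly differentiable on $\psi(V)$ (i.e. has a locally integrable distributional derivative); its weak derivative is then a measurable, almost everywhere defined bundle morphism $Dg\colon TM\to\mathbb{R}$ (linear on each $T_xM$) with $D(g\circ\psi^{-1})=Dg\circ D\psi^{-1}$ almost everywhere in every chart. A map $u\colon M\to N$ is colocally weakly differentiable if $u$ is measurable and $f\circ u$ is weakly differentiable for every $f\in C^1_c(N,\mathbb{R})$. A bundle morphism $\upsilon\colon TM\to TN$ covers $u\colon M\to N$ if $\pi_N\circ\upsilon=u\circ\pi_M$ ($\pi_M,\pi_N$ the bundle projections) and $\upsilon(x)\colon T_xM\to T_{u(x)}N$ is linear for every $x$. A colocal weak derivative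 of a colocally weakly differentiable map $u$ is a measurable bundle morphism $Du\colon TM\to TN$ covering $u$ such that for every $f\in C^1_c(N,\mathbb{R})$, $D(f\circ u)=Df\circ Du$ almost everywhere in $M$. A bundle morphism $\upsilon\colon TM\to TN$ covering $u\colon M\to N$ is bilocally integrable on $A\subseteq M$ if for every $x\in M$ and $y\in N$ there exist local charts $\psi\colon V\subseteq M\to\mathbb{R}^m$ and $\varphi\colon U\subseteq N\to\mathbb{R}^n$ with $x\in V$, $y\in U$, such that for all compact sets $L\subset V$ and $K\subset U$ the function $D\varphi\circ\upsilon\circ D(\psi^{-1})$ is integrable on $\psi(A\cap L\cap u^{-1}(K))$. *)

theory Defs
  imports "HOL-Analysis.Analysis"
begin

section \<open>Functions of class \<open>C\<^sup>k\<close> and weak derivatives on open subsets of a Euclidean space\<close>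

text \<open>Only used for open \<open>S\<close>, where \<open>frechet_derivative f (at x)\<close> is determined by \<open>f\<close>
  on \<open>S\<close>. In finite dimension, continuity of all directional derivatives is continuity of the
  derivative in the operator norm.\<close>

primrec Ck_on :: "nat \<Rightarrow> ('e::euclidean_space \<Rightarrow> 'f::real_normed_vector) \<Rightarrow> 'e set \<Rightarrow> bool" where
  "Ck_on 0 f S \<longleftrightarrow> continuous_on S f"
| "Ck_on (Suc k) f S \<longleftrightarrow>
     (\<forall>x\<in>S. f differentiable (at x)) \<and>
     (\<forall>\<xi>. Ck_on k (\<lambda>x. frechet_derivative f (at x) \<xi>) S)"

definition test_functions :: "'e::euclidean_space set \<Rightarrow> ('e \<Rightarrow> real) set" where
  "test_functions \<Omega> =
     {\<eta>. (\<forall>k. Ck_on k \<eta> UNIV) \<and> compact (closure {y. \<eta> y \<noteq> 0}) \<and> closure {y. \<eta> y \<noteq> 0} \<subseteq> \<Omega>}"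

definition locally_integrable_on :: "('e::euclidean_space \<Rightarrow> real) \<Rightarrow> 'e set \<Rightarrow> bool" where
  "locally_integrable_on h \<Omega> \<longleftrightarrow> (\<forall>K. compact K \<and> K \<subseteq> \<Omega> \<longrightarrow> h absolutely_integrable_on K)"

text \<open>The weak derivative is represented as a field \<open>h'\<close> of linear forms on \<open>\<Omega>\<close>:
  \<open>h' y \<xi>\<close> is the distributional derivative of \<open>h\<close> in the direction \<open>\<xi>\<close>.\<close>

definition has_weak_derivative_on ::
    "('e::euclidean_space \<Rightarrow> real) \<Rightarrow> ('e \<Rightarrow> 'e \<Rightarrow> real) \<Rightarrow> 'e set \<Rightarrow> bool" where
  "has_weak_derivative_on h h' \<Omega> \<longleftrightarrow>
     locally_integrable_on h \<Omega> \<and>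
     (\<forall>y\<in>\<Omega>. linear (h' y)) \<and>
     (\<forall>\<xi>. locally_integrable_on (\<lambda>y. h' y \<xi>) \<Omega>) \<and>
     (\<forall>\<eta>\<in>test_functions \<Omega>. \<forall>\<xi>.
        (LINT y:\<Omega>|lebesgue. h y * frechet_derivative \<eta> (at y) \<xi>)
          = - (LINT y:\<Omega>|lebesgue. h' y \<xi> * \<eta> y))"


section \<open>Differentiable manifolds\<close>

text \<open>A manifold is the whole of a Hausdorff, second countable type \<open>'a\<close>, together with a maximal
  \<open>C\<^sup>1\<close> atlas; its local charts are the members of this atlas. A chart is a pair of its domain
  and its map, the latter being irrelevant outside the domain.\<close>

type_synonym ('a, 'e) chart = "'a set \<times> ('a \<Rightarrow> 'e)"

abbreviation chart_dom :: "('a, 'e) chart \<Rightarrow> 'a set" where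
  "chart_dom c \<equiv> fst c"

abbreviation chart_map :: "('a, 'e) chart \<Rightarrow> 'a \<Rightarrow> 'e" where
  "chart_map c \<equiv> snd c"

abbreviation chart_ran :: "('a, 'e) chart \<Rightarrow> 'e set" where
  "chart_ran c \<equiv> snd c ` fst c"

abbreviation chart_inv :: "('a, 'e) chart \<Rightarrow> 'e \<Rightarrow> 'a" where
  "chart_inv c \<equiv> inv_into (fst c) (snd c)"

definition topological_chart :: "('a::topological_space, 'e::euclidean_space) chart \<Rightarrow> bool" where
  "topological_chart c \<longleftrightarrow>
     open (chart_dom c) \<and> open (chart_ran c) \<and>
     homeomorphism (chart_dom c) (chart_ran c) (chart_map c) (chart_inv c)"

definition C1_compatible :: "('a, 'e::euclidean_space) chart \<Rightarrow> ('a, 'e) chart \<Rightarrow> bool" where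
  "C1_compatible c d \<longleftrightarrow>
     Ck_on 1 (chart_map d \<circ> chart_inv c) (chart_map c ` (chart_dom c \<inter> chart_dom d)) \<and>
     Ck_on 1 (chart_map c \<circ> chart_inv d) (chart_map d ` (chart_dom c \<inter> chart_dom d))"

definition differentiable_manifold ::
    "('a::{t2_space, second_countable_topology}, 'e::euclidean_space) chart set \<Rightarrow> bool" where
  "differentiable_manifold M \<longleftrightarrow>
     (\<forall>c\<in>M. topological_chart c) \<and>
     (\<Union>c\<in>M. chart_dom c) = UNIV \<and>
     (\<forall>c\<in>M. \<forall>d\<in>M. C1_compatible c d) \<and>
     (\<forall>c. topological_chart c \<and> (\<forall>d\<in>M. C1_compatible c d) \<longrightarrow> c \<in> M)"

definition C1 :: "('a, 'e::euclidean_space) chart set \<Rightarrow> ('a \<Rightarrow> real) \<Rightarrow> bool" where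
  "C1 M f \<longleftrightarrow> (\<forall>c\<in>M. Ck_on 1 (f \<circ> chart_inv c) (chart_ran c))"

definition C1_compact_support ::
    "('a::topological_space, 'e::euclidean_space) chart set \<Rightarrow> ('a \<Rightarrow> real) \<Rightarrow> bool" where
  "C1_compact_support M f \<longleftrightarrow> C1 M f \<and> compact (closure {x. f x \<noteq> 0})"


section \<open>Tangent bundle\<close>

text \<open>A tangent vector at \<open>p\<close> is given by its components in all the charts around \<open>p\<close>, related by
  the derivatives of the changes of charts; it is \<open>0\<close> on the charts that do not contain \<open>p\<close>.
  The vector space operations on a tangent space are the pointwise ones.\<close>

type_synonym ('a, 'e) tangent_vector = "'a \<times> (('a, 'e) chart \<Rightarrow> 'e)"

definition tangent_space ::
    "('a, 'e::euclidean_space) chart set \<Rightarrow> 'a \<Rightarrow> (('a, 'e) chart \<Rightarrow> 'e) set" where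
  "tangent_space M p =
     {v. (\<forall>c\<in>M. \<forall>d\<in>M. p \<in> chart_dom c \<and> p \<in> chart_dom d \<longrightarrow>
            v d = frechet_derivative (chart_map d \<circ> chart_inv c) (at (chart_map c p)) (v c)) \<and>
         (\<forall>c. \<not> (c \<in> M \<and> p \<in> chart_dom c) \<longrightarrow> v c = 0)}"

definition tangent_bundle ::
    "('a, 'e::euclidean_space) chart set \<Rightarrow> ('a, 'e) tangent_vector set" where
  "tangent_bundle M = (SIGMA p:UNIV. tangent_space M p)"

definition linear_on_fibre ::
    "('c \<Rightarrow> 'e::real_vector) set \<Rightarrow> (('c \<Rightarrow> 'e) \<Rightarrow> 'f::real_vector) \<Rightarrow> bool" where
  "linear_on_fibre T l \<longleftrightarrow>
     (\<forall>v\<in>T. \<forall>w\<in>T. \<forall>a b. l (\<lambda>c. a *\<^sub>R v c + b *\<^sub>R w c) = a *\<^sub>R l v + b *\<^sub>R l w)"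

text \<open>\<open>D\<psi>\<close> for a chart \<open>\<psi>\<close>, and \<open>D(\<psi>\<^sup>-\<^sup>1)(y)[\<xi>]\<close>.\<close>

definition chart_deriv :: "('a, 'e) chart \<Rightarrow> ('a, 'e) tangent_vector \<Rightarrow> 'e" where
  "chart_deriv c X = snd X c"

definition chart_inv_deriv ::
    "('a, 'e::euclidean_space) chart set \<Rightarrow> ('a, 'e) chart \<Rightarrow> 'e \<Rightarrow> 'e \<Rightarrow> ('a, 'e) tangent_vector" where
  "chart_inv_deriv M c y \<xi> =
     (chart_inv c y,
      \<lambda>d. if d \<in> M \<and> chart_inv c y \<in> chart_dom d
          then frechet_derivative (chart_map d \<circ> chart_inv c) (at y) \<xi> else 0)"

text \<open>The differential \<open>Df : TM \<rightarrow> \<real>\<close> of a \<open>C\<^sup>1\<close> function. By the chain rule it does not depend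
  on the chart that is chosen.\<close>

definition differential ::
    "('a, 'e::euclidean_space) chart set \<Rightarrow> ('a \<Rightarrow> real) \<Rightarrow> ('a, 'e) tangent_vector \<Rightarrow> real" where
  "differential M f X =
     (let c = (SOME c. c \<in> M \<and> fst X \<in> chart_dom c)
      in frechet_derivative (f \<circ> chart_inv c) (at (chart_map c (fst X))) (chart_deriv c X))"

definition bundle_morphism_covering ::
    "('a, 'e::euclidean_space) chart set \<Rightarrow> ('b, 'f::euclidean_space) chart set \<Rightarrow> ('a \<Rightarrow> 'b) \<Rightarrow>
     (('a, 'e) tangent_vector \<Rightarrow> ('b, 'f) tangent_vector) \<Rightarrow> bool" where
  "bundle_morphism_covering M N u \<upsilon> \<longleftrightarrow>
     (\<forall>X\<in>tangent_bundle M. \<upsilon> X \<in> tangent_bundle N) \<and>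
     (\<forall>X\<in>tangent_bundle M. fst (\<upsilon> X) = u (fst X)) \<and>
     (\<forall>x. \<forall>d. linear_on_fibre (tangent_space M x) (\<lambda>v. snd (\<upsilon> (x, v)) d))"

definition local_representative ::
    "('a, real^'m) chart set \<Rightarrow> ('a, real^'m) chart \<Rightarrow> ('b, real^'n) chart \<Rightarrow>
     (('a, real^'m) tangent_vector \<Rightarrow> ('b, real^'n) tangent_vector) \<Rightarrow>
     real^'m \<Rightarrow> real^'m^'n" where
  "local_representative M c d \<upsilon> y = matrix (\<lambda>\<xi>. chart_deriv d (\<upsilon> (chart_inv_deriv M c y \<xi>)))"


section \<open>Measure-theoretic notions\<close>

definition almost_everywhere ::
    "('a, 'e::euclidean_space) chart set \<Rightarrow> ('a \<Rightarrow> bool) \<Rightarrow> bool" where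
  "almost_everywhere M P \<longleftrightarrow> (\<forall>c\<in>M. negligible (chart_map c ` {x \<in> chart_dom c. \<not> P x}))"

definition measurable_map ::
    "('a, 'e::euclidean_space) chart set \<Rightarrow> ('a \<Rightarrow> 'b::topological_space) \<Rightarrow> bool" where
  "measurable_map M u \<longleftrightarrow> (\<forall>c\<in>M. u \<circ> chart_inv c \<in> borel_measurable (lebesgue_on (chart_ran c)))"

definition measurable_bundle_morphism ::
    "('a, real^'m) chart set \<Rightarrow> ('b, real^'n) chart set \<Rightarrow> ('a \<Rightarrow> 'b) \<Rightarrow>
     (('a, real^'m) tangent_vector \<Rightarrow> ('b, real^'n) tangent_vector) \<Rightarrow> bool" where
  "measurable_bundle_morphism M N u \<upsilon> \<longleftrightarrow>
     (\<forall>c\<in>M. \<forall>d\<in>N. local_representative M c d \<upsilon>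
        \<in> borel_measurable (lebesgue_on (chart_map c ` (chart_dom c \<inter> u -` chart_dom d))))"


section \<open>Weak differentiability on manifolds\<close>

definition locally_integrable ::
    "('a, 'e::euclidean_space) chart set \<Rightarrow> ('a \<Rightarrow> real) \<Rightarrow> bool" where
  "locally_integrable M g \<longleftrightarrow> (\<forall>c\<in>M. locally_integrable_on (g \<circ> chart_inv c) (chart_ran c))"

definition weakly_differentiable ::
    "('a, 'e::euclidean_space) chart set \<Rightarrow> ('a \<Rightarrow> real) \<Rightarrow> bool" where
  "weakly_differentiable M g \<longleftrightarrow>
     locally_integrable M g \<and>
     (\<forall>x. \<exists>c\<in>M. x \<in> chart_dom c \<and> (\<exists>h'. has_weak_derivative_on (g \<circ> chart_inv c) h' (chart_ran c)))"

text \<open>Measurability of \<open>\<omega>\<close> in the charts is part of the local integrability of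
  \<open>\<omega> \<circ> D\<psi>\<^sup>-\<^sup>1\<close> in \<^const>\<open>has_weak_derivative_on\<close>. An almost everywhere defined morphism is
  represented by one that is defined everywhere.\<close>

definition is_weak_derivative ::
    "('a, 'e::euclidean_space) chart set \<Rightarrow> ('a \<Rightarrow> real) \<Rightarrow> (('a, 'e) tangent_vector \<Rightarrow> real) \<Rightarrow> bool" where
  "is_weak_derivative M g \<omega> \<longleftrightarrow>
     (\<forall>x. linear_on_fibre (tangent_space M x) (\<lambda>v. \<omega> (x, v))) \<and>
     (\<forall>c\<in>M. has_weak_derivative_on
        (g \<circ> chart_inv c) (\<lambda>y \<xi>. \<omega> (chart_inv_deriv M c y \<xi>)) (chart_ran c))"

text \<open>For weakly differentiable \<open>g\<close> it is determined up to equality almost everywhere.\<close>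

definition weak_derivative ::
    "('a, 'e::euclidean_space) chart set \<Rightarrow> ('a \<Rightarrow> real) \<Rightarrow> ('a, 'e) tangent_vector \<Rightarrow> real" where
  "weak_derivative M g = (SOME \<omega>. is_weak_derivative M g \<omega>)"

definition colocally_weakly_differentiable ::
    "('a, 'e::euclidean_space) chart set \<Rightarrow> ('b::topological_space, 'f::euclidean_space) chart set \<Rightarrow>
     ('a \<Rightarrow> 'b) \<Rightarrow> bool" where
  "colocally_weakly_differentiable M N u \<longleftrightarrow>
     measurable_map M u \<and> (\<forall>f. C1_compact_support N f \<longrightarrow> weakly_differentiable M (f \<circ> u))"

definition ae_equal_on_fibres ::
    "('a, 'e::euclidean_space) chart set \<Rightarrow> (('a, 'e) tangent_vector \<Rightarrow> 'z) \<Rightarrow>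
     (('a, 'e) tangent_vector \<Rightarrow> 'z) \<Rightarrow> bool" where
  "ae_equal_on_fibres M \<alpha> \<beta> \<longleftrightarrow>
     almost_everywhere M (\<lambda>x. \<forall>v\<in>tangent_space M x. \<alpha> (x, v) = \<beta> (x, v))"

definition is_colocal_weak_derivative ::
    "('a, real^'m) chart set \<Rightarrow> ('b::topological_space, real^'n) chart set \<Rightarrow> ('a \<Rightarrow> 'b) \<Rightarrow>
     (('a, real^'m) tangent_vector \<Rightarrow> ('b, real^'n) tangent_vector) \<Rightarrow> bool" where
  "is_colocal_weak_derivative M N u Du \<longleftrightarrow>
     bundle_morphism_covering M N u Du \<and>
     measurable_bundle_morphism M N u Du \<and>
     (\<forall>f. C1_compact_support N f \<longrightarrow>
        ae_equal_on_fibres M (weak_derivative M (f \<circ> u)) (differential N f \<circ> Du))"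

definition bilocally_integrable_on ::
    "('a::topological_space, real^'m) chart set \<Rightarrow> ('b::topological_space, real^'n) chart set \<Rightarrow>
     ('a \<Rightarrow> 'b) \<Rightarrow> (('a, real^'m) tangent_vector \<Rightarrow> ('b, real^'n) tangent_vector) \<Rightarrow> 'a set \<Rightarrow> bool" where
  "bilocally_integrable_on M N u \<upsilon> A \<longleftrightarrow>
     (\<forall>x y. \<exists>c\<in>M. \<exists>d\<in>N. x \<in> chart_dom c \<and> y \<in> chart_dom d \<and>
        (\<forall>L K. compact L \<and> L \<subseteq> chart_dom c \<and> compact K \<and> K \<subseteq> chart_dom d \<longrightarrow>
           local_representative M c d \<upsilon> absolutely_integrable_on chart_map c ` (A \<inter> L \<inter> u -` K)))"

end

theory Submission
  imports Defs
begin

text \<open>A weak derivative on an open set of a Euclidean space is the same thing as a local \<open>L\<^sup>1\<close> limit of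
  \<open>C\<^sup>1\<close> functions together with their derivatives: mollification gives one direction, integration
  by parts and a \<open>C\<^sup>1\<close> partition of the test function the other. In this form the invariance under \<open>C\<^sup>1\<close>
  diffeomorphisms, the chain rule for \<open>h \<circ> v\<close> with \<open>h\<close> of class \<open>C\<^sup>1\<close> and Lipschitz, and the equality almost
  everywhere of \<open>Dv1\<close> and \<open>Dv2\<close> on the set \<open>{v1 = v2}\<close> are direct.

  On the manifold \<open>N\<close>, multiplying the coordinates of a chart by a cutoff gives \<open>\<phi> : N \<rightarrow> \<real>\<^sup>n\<close> with components in
  \<open>C\<^sup>1\<^sub>c\<close> that coincides with the chart on an open set \<open>W\<close>. On \<open>u\<^sup>-\<^sup>1(W)\<close> the derivative \<open>Du\<close> has to be, in this chart,
  \<open>D(\<phi> \<circ> u)\<close>, which proves uniqueness and bilocal integrability and defines \<open>Du\<close> on countably many such sets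
  that cover \<open>N\<close>. There \<open>f \<circ> u\<close> is also equal to \<open>h \<circ> (\<phi> \<circ> u)\<close> with \<open>h\<close> of class \<open>C\<^sup>1\<close> and compactly supported,
  whence \<open>D(f \<circ> u) = Df \<circ> Du\<close>.\<close>

section \<open>Calculus of class \<open>C\<^sup>1\<close>\<close>

text \<open>Charts are only of class C1, whereas weak derivatives are tested against smooth
  functions: a test function composed with a change of charts need not be a test function. The
  definition therefore cannot be moved between charts directly, and the L1 approximation, which is
  stable under C1 composition, takes its place. Only convergence to 0 has to be transported, so an
  upper bound for the measure of Lipschitz images does the work of a change of variables formula.
  The second obstacle is that \<open>u\<close> need not be continuous. The set where
  \<open>u\<close> lies in \<open>W\<close> is merely measurable and may have empty interior, so the
  identity of \<open>f \<circ> u\<close> with \<open>h \<circ> \<phi> \<circ> u\<close> on it cannot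
  be differentiated on open sets. Both functions are instead weakly differentiable on the whole
  range of a chart of \<open>M\<close>, and their derivatives are compared almost everywhere on the
  coincidence set. Since only values in \<open>W\<close> matter there, \<open>f\<close> can be any
  C1 function, which is how the last claim reaches functions without compact support.\<close>

definition has_C1_derivative_on ::
    "('e::euclidean_space \<Rightarrow> 'f::real_normed_vector) \<Rightarrow> ('e \<Rightarrow> 'e \<Rightarrow> 'f) \<Rightarrow> 'e set \<Rightarrow> bool" where
  "has_C1_derivative_on f f' S \<longleftrightarrow>
     (\<forall>x\<in>S. (f has_derivative f' x) (at x)) \<and> (\<forall>\<xi>. continuous_on S (\<lambda>x. f' x \<xi>))"

lemma has_C1_derivative_onI:
  "(\<And>x. x \<in> S \<Longrightarrow> (f has_derivative f' x) (at x)) \<Longrightarrow> (\<And>\<xi>. continuous_on S (\<lambda>x. f' x \<xi>)) \<Longrightarrow>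
   has_C1_derivative_on f f' S"
  by (simp add: has_C1_derivative_on_def)

lemma has_C1_derivative_onD:
  assumes "has_C1_derivative_on f f' S"
  shows "x \<in> S \<Longrightarrow> (f has_derivative f' x) (at x)" "continuous_on S (\<lambda>x. f' x \<xi>)"
    "x \<in> S \<Longrightarrow> linear (f' x)"
    "continuous_on S f"
proof -
  show 1: "x \<in> S \<Longrightarrow> (f has_derivative f' x) (at x)" for x
    using assms by (simp add: has_C1_derivative_on_def)
  show "continuous_on S (\<lambda>x. f' x \<xi>)"
    using assms by (simp add: has_C1_derivative_on_def)
  show "x \<in> S \<Longrightarrow> linear (f' x)"
    using 1 has_derivative_linear by metis
  show "continuous_on S f"
    using 1 has_derivative_continuous by (metis continuous_at_imp_continuous_on)
qed

lemma has_C1_derivative_on_imp_frechet: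
  "has_C1_derivative_on f f' S \<Longrightarrow> x \<in> S \<Longrightarrow> frechet_derivative f (at x) = f' x"
  by (metis frechet_derivative_at has_C1_derivative_onD(1))

lemma has_C1_derivative_on_subset:
  "has_C1_derivative_on f f' S \<Longrightarrow> T \<subseteq> S \<Longrightarrow> has_C1_derivative_on f f' T"
  by (meson continuous_on_subset has_C1_derivative_on_def subset_iff)

lemma has_C1_derivative_on_Un:
  "has_C1_derivative_on f f' S \<Longrightarrow> has_C1_derivative_on f f' T \<Longrightarrow> open S \<Longrightarrow> open T \<Longrightarrow>
   has_C1_derivative_on f f' (S \<union> T)"
  by (simp add: has_C1_derivative_on_def continuous_on_open_Un ball_Un)

lemma has_C1_derivative_on_cong:
  assumes "has_C1_derivative_on f f' S" "open S" "\<And>x. x \<in> S \<Longrightarrow> f x = g x"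
    "\<And>x \<xi>. x \<in> S \<Longrightarrow> f' x \<xi> = g' x \<xi>"
  shows "has_C1_derivative_on g g' S"
proof (rule has_C1_derivative_onI)
  show "(g has_derivative g' x) (at x)" if "x \<in> S" for x
  proof -
    have "(f has_derivative g' x) (at x)"
      using has_C1_derivative_onD(1)[OF assms(1) that] assms(4)[OF that] by (metis ext)
    then show ?thesis
      using has_derivative_transform_within_open[OF _ assms(2) that] assms(3) by blast
  qed
  show "continuous_on S (\<lambda>x. g' x \<xi>)" for \<xi>
    by (rule continuous_on_eq[OF has_C1_derivative_onD(2)[OF assms(1), of \<xi>]]) (use assms(4) in auto)
qed

text \<open>Bridge to the class \<open>Ck_on 1\<close> of the statement. With the derivative as an
  explicit field, the product, chain and cutoff rules return formulas instead of
  \<open>frechet_derivative\<close> terms.\<close>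

lemma Ck_on_1_iff:
  "Ck_on 1 f S \<longleftrightarrow> has_C1_derivative_on f (\<lambda>x. frechet_derivative f (at x)) S"
  unfolding has_C1_derivative_on_def by (auto simp: frechet_derivative_works)

lemma has_C1_derivative_on_imp_Ck_on_1:
  assumes "has_C1_derivative_on f f' S"
  shows "Ck_on 1 f S"
proof -
  have "continuous_on S (\<lambda>x. frechet_derivative f (at x) \<xi>)" for \<xi>
    by (rule continuous_on_eq[OF has_C1_derivative_onD(2)[OF assms, of \<xi>]])
      (simp add: has_C1_derivative_on_imp_frechet[OF assms])
  then show ?thesis
    using has_C1_derivative_onD(1)[OF assms] by (auto simp: differentiable_def)
qed

text \<open>Continuity, measurability and L1 convergence are available for fixed directions only;
  the expansion reduces a direction that varies with the point to the finitely many basis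
  vectors.\<close>

lemma linear_euclidean_expansion:
  fixes f :: "'e::euclidean_space \<Rightarrow> 'f::real_vector"
  assumes "linear f"
  shows "f \<xi> = (\<Sum>b\<in>Basis. (\<xi> \<bullet> b) *\<^sub>R f b)"
proof -
  have "f \<xi> = f (\<Sum>b\<in>Basis. (\<xi> \<bullet> b) *\<^sub>R b)" by (simp add: euclidean_representation)
  also have "\<dots> = (\<Sum>b\<in>Basis. (\<xi> \<bullet> b) *\<^sub>R f b)"
    using assms by (simp add: linear_sum linear_scale)
  finally show ?thesis .
qed

lemma has_C1_derivative_on_compose:
  fixes f :: "'e::euclidean_space \<Rightarrow> 'f::euclidean_space"
  assumes f: "has_C1_derivative_on f f' S" and g: "has_C1_derivative_on g g' T" and fS: "f ` S \<subseteq> T"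
  shows "has_C1_derivative_on (\<lambda>x. g (f x)) (\<lambda>x \<xi>. g' (f x) (f' x \<xi>)) S"
proof (rule has_C1_derivative_onI)
  show "((\<lambda>x. g (f x)) has_derivative (\<lambda>\<xi>. g' (f x) (f' x \<xi>))) (at x)" if "x \<in> S" for x
    using has_derivative_compose[OF has_C1_derivative_onD(1)[OF f that] has_C1_derivative_onD(1)[OF g]]
      fS that by blast
  fix \<xi>
  \<comment> \<open>Both the linear map \<open>g' (f x)\<close> and the vector
    \<open>f' x \<xi>\<close> move with \<open>x\<close>, while continuity is known for fixed
    directions, hence the detour through the basis.\<close>
  have "continuous_on S (\<lambda>x. \<Sum>b\<in>Basis. (f' x \<xi> \<bullet> b) *\<^sub>R g' (f x) b)"
    by (intro continuous_intros continuous_on_compose2[OF has_C1_derivative_onD(2)[OF g]]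
      has_C1_derivative_onD(2,4)[OF f] fS)
  then show "continuous_on S (\<lambda>x. g' (f x) (f' x \<xi>))"
  proof (rule continuous_on_eq)
    fix x assume "x \<in> S"
    then have "linear (g' (f x))" using fS by (intro has_C1_derivative_onD(3)[OF g]) auto
    then show "(\<Sum>b\<in>Basis. (f' x \<xi> \<bullet> b) *\<^sub>R g' (f x) b) = g' (f x) (f' x \<xi>)"
      by (rule linear_euclidean_expansion[symmetric])
  qed
qed

lemma has_C1_derivative_on_mult:
  fixes f g :: "'e::euclidean_space \<Rightarrow> real"
  assumes f: "has_C1_derivative_on f f' S" and g: "has_C1_derivative_on g g' S"
  shows "has_C1_derivative_on (\<lambda>x. f x * g x) (\<lambda>x \<xi>. f x * g' x \<xi> + f' x \<xi> * g x) S"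
proof (rule has_C1_derivative_onI)
  show "((\<lambda>x. f x * g x) has_derivative (\<lambda>\<xi>. f x * g' x \<xi> + f' x \<xi> * g x)) (at x)"
    if "x \<in> S" for x
    by (intro has_derivative_mult has_C1_derivative_onD(1)[OF f] has_C1_derivative_onD(1)[OF g] that)
  show "continuous_on S (\<lambda>x. f x * g' x \<xi> + f' x \<xi> * g x)" for \<xi>
    by (intro continuous_intros has_C1_derivative_onD(2)[OF f] has_C1_derivative_onD(2)[OF g]
      has_C1_derivative_onD(4)[OF f] has_C1_derivative_onD(4)[OF g])
qed

lemma has_C1_derivative_on_sum:
  assumes "\<And>i. i \<in> I \<Longrightarrow> has_C1_derivative_on (f i) (f' i) S"
  shows "has_C1_derivative_on (\<lambda>x. \<Sum>i\<in>I. f i x) (\<lambda>x \<xi>. \<Sum>i\<in>I. f' i x \<xi>) S"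
  by (rule has_C1_derivative_onI; intro has_derivative_sum continuous_on_sum)
    (rule has_C1_derivative_onD(1,2)[OF assms]; assumption)+

lemma has_C1_derivative_on_scaleR_left:
  assumes f: "has_C1_derivative_on f f' S"
  shows "has_C1_derivative_on (\<lambda>x. f x *\<^sub>R b) (\<lambda>x \<xi>. f' x \<xi> *\<^sub>R b) S"
  by (rule has_C1_derivative_onI)
    (intro has_derivative_scaleR_left continuous_intros has_C1_derivative_onD(1,2)[OF f], assumption?)+

lemma has_C1_derivative_on_diff:
  assumes f: "has_C1_derivative_on f f' S" and g: "has_C1_derivative_on g g' S"
  shows "has_C1_derivative_on (\<lambda>x. f x - g x) (\<lambda>x \<xi>. f' x \<xi> - g' x \<xi>) S"
  by (rule has_C1_derivative_onI)
    (intro has_derivative_diff continuous_on_diff has_C1_derivative_onD(1)[OF f]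
      has_C1_derivative_onD(1)[OF g] has_C1_derivative_onD(2)[OF f] has_C1_derivative_onD(2)[OF g];
      assumption)+

section \<open>Extension by zero and cutoffs\<close>

lemma has_C1_derivative_on_const: "has_C1_derivative_on (\<lambda>x. c) (\<lambda>x \<xi>. 0) S"
  by (auto simp: has_C1_derivative_on_def)

lemma has_C1_derivative_on_vanishing:
  assumes "open S" "\<And>x. x \<in> S \<Longrightarrow> f x = 0" "\<And>x \<xi>. x \<in> S \<Longrightarrow> f' x \<xi> = 0"
  shows "has_C1_derivative_on f f' S"
  by (rule has_C1_derivative_on_cong[OF has_C1_derivative_on_const[of 0]]) (use assms in auto)

lemma has_C1_derivative_on_vanishes_outside:
  assumes f: "has_C1_derivative_on f f' UNIV" and K: "closed K" "\<And>x. x \<notin> K \<Longrightarrow> f x = 0" and x: "x \<notin> K"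
  shows "f' x \<xi> = 0"
proof -
  have "has_C1_derivative_on f (\<lambda>_ _. 0) (- K)"
    by (rule has_C1_derivative_on_vanishing) (use K in auto)
  then show ?thesis
    using f x by (metis ComplI UNIV_I has_C1_derivative_on_imp_frechet)
qed

text \<open>The open sets \<open>S\<close> and \<open>- K\<close> cover the space: the product rule
  holds on the first and everything vanishes on the second.\<close>

lemma has_C1_derivative_on_cutoff:
  fixes f \<eta> :: "'e::euclidean_space \<Rightarrow> real"
  assumes f: "has_C1_derivative_on f f' S" and S: "open S"
    and \<eta>: "has_C1_derivative_on \<eta> \<eta>' UNIV" and K: "closed K" "K \<subseteq> S" "\<And>x. x \<notin> K \<Longrightarrow> \<eta> x = 0"
  shows "has_C1_derivative_on (\<lambda>x. if x \<in> S then f x * \<eta> x else 0)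
    (\<lambda>x \<xi>. if x \<in> S then f x * \<eta>' x \<xi> + f' x \<xi> * \<eta> x else 0) UNIV" (is "has_C1_derivative_on ?g ?g' UNIV")
proof -
  have "has_C1_derivative_on ?g ?g' S"
    by (rule has_C1_derivative_on_cong[OF has_C1_derivative_on_mult[OF f
          has_C1_derivative_on_subset[OF \<eta>]]]) (use S in auto)
  moreover have "has_C1_derivative_on ?g ?g' (- K)"
    by (rule has_C1_derivative_on_vanishing)
      (use K has_C1_derivative_on_vanishes_outside[OF \<eta> K(1,3)] in auto)
  ultimately have "has_C1_derivative_on ?g ?g' (S \<union> - K)"
    using has_C1_derivative_on_Un S K(1) by blast
  moreover have "S \<union> - K = UNIV" using K(2) by auto
  ultimately show ?thesis by simp
qed

section \<open>Bounds and Lipschitz constants on compact sets\<close>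

lemma has_C1_derivative_on_bounded:
  assumes f: "has_C1_derivative_on f f' S" and K: "compact K" "K \<subseteq> S"
  obtains C where "C > 0" "\<And>x \<xi>. x \<in> K \<Longrightarrow> norm (f' x \<xi>) \<le> C * norm \<xi>"
proof -
  have "\<exists>C. \<forall>x\<in>K. norm (f' x b) \<le> C" for b
    using compact_imp_bounded[OF compact_continuous_image[OF continuous_on_subset[OF
          has_C1_derivative_onD(2)[OF f, of b] K(2)] K(1)]]
    by (auto simp: bounded_iff)
  then obtain C where C: "\<And>b x. x \<in> K \<Longrightarrow> norm (f' x b) \<le> C b" by metis
  show ?thesis
  proof
    \<comment> \<open>The summand 1 keeps the constant positive even if all the derivatives
      vanish.\<close>
    show "0 < 1 + (\<Sum>b\<in>Basis. \<bar>C b\<bar>)" by (simp add: add_pos_nonneg sum_nonneg)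
    fix x \<xi> assume x: "x \<in> K"
    have "f' x \<xi> = (\<Sum>b\<in>Basis. (\<xi> \<bullet> b) *\<^sub>R f' x b)"
      using linear_euclidean_expansion has_C1_derivative_onD(3)[OF f] x K(2) by blast
    also have "norm \<dots> \<le> (\<Sum>b\<in>Basis. norm \<xi> * \<bar>C b\<bar>)"
    proof (rule sum_norm_le)
      fix b :: 'a assume "b \<in> Basis"
      then show "norm ((\<xi> \<bullet> b) *\<^sub>R f' x b) \<le> norm \<xi> * \<bar>C b\<bar>"
        using C[OF x, of b] Basis_le_norm[of b \<xi>] by (auto intro!: mult_mono)
    qed
    also have "\<dots> \<le> (1 + (\<Sum>b\<in>Basis. \<bar>C b\<bar>)) * norm \<xi>"
      by (simp add: sum_distrib_left[symmetric] algebra_simps)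
    finally show "norm (f' x \<xi>) \<le> (1 + (\<Sum>b\<in>Basis. \<bar>C b\<bar>)) * norm \<xi>" .
  qed
qed

lemma has_C1_derivative_on_Lipschitz:
  assumes f: "has_C1_derivative_on f f' S" and K: "compact K" "K \<subseteq> S" "convex K"
  obtains L where "L > 0" "\<And>x y. x \<in> K \<Longrightarrow> y \<in> K \<Longrightarrow> norm (f x - f y) \<le> L * norm (x - y)"
proof -
  obtain C where C: "C > 0" "\<And>x \<xi>. x \<in> K \<Longrightarrow> norm (f' x \<xi>) \<le> C * norm \<xi>"
    using has_C1_derivative_on_bounded[OF f K(1,2)] by blast
  have "norm (f x - f y) \<le> C * norm (x - y)" if "x \<in> K" "y \<in> K" for x y
  proof (rule differentiable_bound[OF K(3) _ _ that(1,2)])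
    show "(f has_derivative f' x) (at x within K)" if "x \<in> K" for x
      using has_C1_derivative_onD(1)[OF f] K(2) that has_derivative_at_withinI by blast
    show "onorm (f' x) \<le> C" if "x \<in> K" for x
      using C that by (intro onorm_le) auto
  qed
  then show ?thesis using C(1) that by blast
qed

lemma has_C1_derivative_on_compact_support_bounded:
  fixes f :: "'e::euclidean_space \<Rightarrow> 'f::real_normed_vector"
  assumes f: "has_C1_derivative_on f f' UNIV" and K: "compact K" "\<And>x. x \<notin> K \<Longrightarrow> f x = 0"
  obtains C where "C > 0" "\<And>x. norm (f x) \<le> C" "\<And>x \<xi>. norm (f' x \<xi>) \<le> C * norm \<xi>"
    "\<And>x y. norm (f x - f y) \<le> C * norm (x - y)"
proof -
  obtain C where C: "C > 0" "\<And>x \<xi>. x \<in> K \<Longrightarrow> norm (f' x \<xi>) \<le> C * norm \<xi>"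
    using has_C1_derivative_on_bounded[OF f K(1)] by blast
  then have 1: "norm (f' x \<xi>) \<le> C * norm \<xi>" for x \<xi>
    using has_C1_derivative_on_vanishes_outside[OF f compact_imp_closed[OF K(1)] K(2)]
    by (cases "x \<in> K") auto
  have 2: "norm (f x - f y) \<le> C * norm (x - y)" for x y
    by (rule differentiable_bound[of UNIV f f'])
      (use 1 has_C1_derivative_onD(1)[OF f] in \<open>auto intro: onorm_le\<close>)
  have "bounded (f ` K)"
    by (intro compact_imp_bounded compact_continuous_image K(1)
      continuous_on_subset[OF has_C1_derivative_onD(4)[OF f]]) auto
  then obtain B where "\<And>x. x \<in> K \<Longrightarrow> norm (f x) \<le> B" by (auto simp: bounded_iff)
  then have 3: "norm (f x) \<le> max C B" for x
    using K(2)[of x] C(1) by (cases "x \<in> K") (auto simp: le_max_iff_disj)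
  show ?thesis
  proof (rule that[of "max C B"])
    have "C * norm z \<le> max C B * norm z" for z :: 'e
      by (simp add: mult_right_mono)
    then show "norm (f' x \<xi>) \<le> max C B * norm \<xi>" "norm (f x - f y) \<le> max C B * norm (x - y)" for x \<xi> y
      using 1 2 order_trans by blast+
  qed (use 3 C(1) in auto)
qed

text \<open>The squared positive part is a C1 function that vanishes on a half line; at 0 its
  difference quotient is at most \<open>\<bar>h\<bar>\<close>. It is the building block of the C1
  bump.\<close>

lemma DERIV_power2_max_0: "((\<lambda>t. (max 0 t)\<^sup>2) has_real_derivative 2 * max 0 t) (at (t::real))"
proof -
  consider "t < 0" | "t = 0" | "t > 0" by linarith
  then show ?thesis
  proof cases
    case 1
    then have "((\<lambda>t. 0) has_real_derivative 2 * max 0 t) (at t)" by auto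
    moreover have "eventually (\<lambda>t. 0 = (max 0 t)\<^sup>2) (nhds t)"
      using eventually_nhds_in_open[of "{..<0}" t] 1 by (auto elim!: eventually_mono)
    ultimately show ?thesis by (rule iffD1[OF DERIV_cong_ev[OF refl _ refl], rotated])
  next
    case 2
    have "(\<lambda>h. ((max 0 (0 + h))\<^sup>2 - (max 0 0)\<^sup>2) / h) \<midarrow>(0::real)\<rightarrow> 0"
    proof (rule Lim_null_comparison)
      show "eventually (\<lambda>h. norm (((max 0 (0 + h))\<^sup>2 - (max 0 0)\<^sup>2) / h) \<le> \<bar>h::real\<bar>) (at 0)"
        by (rule always_eventually) (auto simp: max_def power2_eq_square)
      show "(\<lambda>h::real. \<bar>h\<bar>) \<midarrow>0\<rightarrow> 0" by (rule tendsto_rabs_zero[OF tendsto_ident_at])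
    qed
    then show ?thesis using 2 by (simp add: DERIV_def)
  next
    case 3
    then have "((\<lambda>t. t\<^sup>2) has_real_derivative 2 * max 0 t) (at t)"
      by (auto intro!: derivative_eq_intros)
    moreover have "eventually (\<lambda>t. t\<^sup>2 = (max 0 t)\<^sup>2) (nhds t)"
      using eventually_nhds_in_open[of "{0<..}" t] 3 by (auto elim!: eventually_mono)
    ultimately show ?thesis by (rule iffD1[OF DERIV_cong_ev[OF refl _ refl], rotated])
  qed
qed

text \<open>For cutting off chart coordinates class C1 is the right level, and a truncated
  polynomial provides it. Here \<open>q\<close> is nonpositive exactly on the closed ball of radius
  \<open>r / 2\<close>, while \<open>s\<close> is 1 on the nonpositive reals and 0 from 1
  onwards.\<close>

lemma C1_bump_exists:
  fixes a :: "'e::euclidean_space"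
  assumes "r > 0"
  obtains \<beta> \<beta>' where "has_C1_derivative_on \<beta> \<beta>' UNIV"
    "\<And>x. x \<in> ball a (r / 2) \<Longrightarrow> \<beta> x = 1" "\<And>x. x \<notin> cball a (3 / 4 * r) \<Longrightarrow> \<beta> x = (0::real)"
proof -
  define q where "q x = 4 * ((x - a) \<bullet> (x - a)) / r\<^sup>2 - 1" for x
  define s where "s t = (max 0 (1 - (max 0 t)\<^sup>2))\<^sup>2" for t :: real
  have s: "(s has_real_derivative - 4 * max 0 (1 - (max 0 t)\<^sup>2) * max 0 t) (at t)" for t
    unfolding s_def
    using DERIV_chain2[OF DERIV_power2_max_0[of "1 - (max 0 t)\<^sup>2"]
        DERIV_diff[OF DERIV_const[of 1] DERIV_power2_max_0[of t]]]
    by (simp add: algebra_simps)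
  have q: "(q has_derivative (\<lambda>\<xi>. 8 * ((x - a) \<bullet> \<xi>) / r\<^sup>2)) (at x)" for x
    unfolding q_def using assms
    by (auto intro!: derivative_eq_intros simp: inner_commute field_simps power2_eq_square)
  have q_cont: "continuous_on UNIV q"
    using q by (auto simp: continuous_on_eq_continuous_at dest: has_derivative_continuous)
  show ?thesis
  proof
    show "has_C1_derivative_on (\<lambda>x. s (q x))
      (\<lambda>x \<xi>. - 4 * max 0 (1 - (max 0 (q x))\<^sup>2) * max 0 (q x) * (8 * ((x - a) \<bullet> \<xi>) / r\<^sup>2)) UNIV"
    proof (rule has_C1_derivative_onI)
      show "((\<lambda>x. s (q x)) has_derivative
        (\<lambda>\<xi>. - 4 * max 0 (1 - (max 0 (q x))\<^sup>2) * max 0 (q x) * (8 * ((x - a) \<bullet> \<xi>) / r\<^sup>2))) (at x)" for x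
        using has_derivative_compose[OF q s[THEN has_field_derivative_imp_has_derivative]] by simp
      show "continuous_on UNIV
        (\<lambda>x. - 4 * max 0 (1 - (max 0 (q x))\<^sup>2) * max 0 (q x) * (8 * ((x - a) \<bullet> \<xi>) / r\<^sup>2))" for \<xi>
        using assms by (intro continuous_intros q_cont) auto
    qed
    have sq: "(x - a) \<bullet> (x - a) = (dist a x)\<^sup>2" for x
      by (metis dist_norm dist_commute power2_norm_eq_inner)
    show "s (q x) = 1" if "x \<in> ball a (r / 2)" for x
    proof -
      have "(dist a x)\<^sup>2 < (r / 2)\<^sup>2" using that by (intro power_strict_mono) auto
      then have "q x \<le> 0" using assms by (simp add: q_def sq field_simps)
      then show ?thesis by (simp add: s_def max_def)
    qed
    show "s (q x) = 0" if "x \<notin> cball a (3 / 4 * r)" for x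
    proof -
      have "(3 / 4 * r)\<^sup>2 \<le> (dist a x)\<^sup>2" using that assms by (intro power_mono) auto
      \<comment> \<open>At radius \<open>3 / 4 * r\<close> the quadratic term is 4 times 9 / 16,
        that is 9 / 4, so \<open>q x\<close> is beyond the threshold 1 of \<open>s\<close>.\<close>
      then have "9 / 4 \<le> 4 * (dist a x)\<^sup>2 / r\<^sup>2"
        using assms by (simp add: field_simps power2_eq_square)
      then have "1 \<le> q x" by (simp add: q_def sq)
      then have "1 \<le> (max 0 (q x))\<^sup>2" by (simp add: max_def)
      then show ?thesis by (simp add: s_def max_def)
    qed
  qed
qed

section \<open>Smooth bump functions\<close>

lemma Ck_on_Suc_imp_Ck_on: "Ck_on (Suc k) f S \<Longrightarrow> Ck_on k f S"
proof (induction k arbitrary: f)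
  case 0
  then show ?case
    by (auto intro!: continuous_at_imp_continuous_on differentiable_imp_continuous_within)
next
  case (Suc k)
  have "Ck_on k (\<lambda>x. frechet_derivative f (at x) \<xi>) S" for \<xi>
    using Suc.prems by (intro Suc.IH) simp
  then show ?case using Suc.prems by simp
qed

lemma Ck_on_const: "Ck_on k (\<lambda>x. c) S"
  by (induction k arbitrary: c) (auto simp: frechet_derivative_const)

lemma Ck_on_add:
  "Ck_on k f UNIV \<Longrightarrow> Ck_on k g UNIV \<Longrightarrow> Ck_on k (\<lambda>x. f x + g x) UNIV"
proof (induction k arbitrary: f g)
  case 0
  then show ?case by (auto intro: continuous_intros)
next
  case (Suc k)
  have D: "((\<lambda>x. f x + g x) has_derivative
      (\<lambda>\<xi>. frechet_derivative f (at x) \<xi> + frechet_derivative g (at x) \<xi>)) (at x)" for x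
    using Suc.prems by (intro has_derivative_add) (auto simp: frechet_derivative_works)
  show ?case
    using Suc.IH Suc.prems D by (auto simp: differentiable_def frechet_derivative_at[OF D, symmetric])
qed

lemma Ck_on_mult:
  fixes f g :: "'e::euclidean_space \<Rightarrow> real"
  shows "Ck_on k f UNIV \<Longrightarrow> Ck_on k g UNIV \<Longrightarrow> Ck_on k (\<lambda>x. f x * g x) UNIV"
proof (induction k arbitrary: f g)
  case 0
  then show ?case by (auto intro: continuous_intros)
next
  case (Suc k)
  have D: "((\<lambda>x. f x * g x) has_derivative
      (\<lambda>\<xi>. f x * frechet_derivative g (at x) \<xi> + frechet_derivative f (at x) \<xi> * g x)) (at x)" for x
    using Suc.prems by (intro has_derivative_mult) (auto simp: frechet_derivative_works)
  have "Ck_on k (\<lambda>x. f x * frechet_derivative g (at x) \<xi> + frechet_derivative f (at x) \<xi> * g x) UNIV" for \<xi>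
    using Suc.prems Ck_on_Suc_imp_Ck_on by (intro Ck_on_add Suc.IH) auto
  then show ?case
    using D by (auto simp: differentiable_def frechet_derivative_at[OF D, symmetric])
qed

lemma Ck_on_inner_diff: "Ck_on k (\<lambda>x. (x - a) \<bullet> \<xi>) UNIV"
proof (cases k)
  case 0
  then show ?thesis by (auto intro!: continuous_intros)
next
  case (Suc j)
  have D: "((\<lambda>x. (x - a) \<bullet> \<xi>) has_derivative (\<lambda>\<zeta>. \<zeta> \<bullet> \<xi>)) (at x)" for x
    by (auto intro!: derivative_eq_intros)
  show ?thesis
    using Suc D Ck_on_const by (auto simp: differentiable_def frechet_derivative_at[OF D, symmetric])
qed

text \<open>The flat function \<open>exp (- 1 / t)\<close> together with its quotients by powers of
  \<open>t\<close>: the derivative of a member is a linear combination of members, so smoothness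
  follows by a single induction.\<close>

definition exp_recip :: "nat \<Rightarrow> real \<Rightarrow> real" where
  "exp_recip j t = (if t > 0 then exp (- 1 / t) / t ^ j else 0)"

text \<open>The exponential series at \<open>1 / t\<close> dominates its single term of index
  \<open>j + 2\<close>. The resulting quadratic bound makes the derivative at 0 exist and
  vanish.\<close>

lemma exp_recip_le_square: "exp_recip j t \<le> fact (j + 2) * t\<^sup>2"
proof (cases "t > 0")
  case True
  define F :: real where "F = fact (j + 2)"
  have F: "F > 0" by (simp add: F_def)
  have "(\<lambda>n. (1 / t) ^ n /\<^sub>R fact n) sums exp (1 / t)"
    by (rule exp_converges)
  then have "(1 / t) ^ (j + 2) /\<^sub>R F \<le> exp (1 / t)"
    using True sum_le_suminf[of "\<lambda>n. (1 / t) ^ n /\<^sub>R fact n" "{j + 2}"]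
    by (simp add: sums_iff F_def del: fact_Suc)
  then have "1 \<le> F * t ^ (j + 2) * exp (1 / t)"
    using True F by (simp add: field_simps)
  then have "exp (- (1 / t)) / t ^ j \<le> F * t\<^sup>2"
    using True by (simp add: exp_minus field_simps power_add power2_eq_square)
  then show ?thesis using True by (simp add: exp_recip_def F_def)
qed (simp add: exp_recip_def)

lemma DERIV_exp_recip:
  "(exp_recip j has_real_derivative exp_recip (j + 2) t - j * exp_recip (j + 1) t) (at t)"
proof -
  consider "t < 0" | "t = 0" | "t > 0" by linarith
  then show ?thesis
  proof cases
    case 1
    then have "((\<lambda>t. 0) has_real_derivative exp_recip (j + 2) t - j * exp_recip (j + 1) t) (at t)"
      by (auto simp: exp_recip_def)
    moreover have "eventually (\<lambda>t. 0 = exp_recip j t) (nhds t)"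
      using eventually_nhds_in_open[of "{..<0}" t] 1 by (auto elim!: eventually_mono simp: exp_recip_def)
    ultimately show ?thesis by (rule iffD1[OF DERIV_cong_ev[OF refl _ refl], rotated])
  next
    case 2
    have "(\<lambda>h. (exp_recip j (0 + h) - exp_recip j 0) / h) \<midarrow>(0::real)\<rightarrow> 0"
    proof (rule Lim_null_comparison)
      have "norm ((exp_recip j (0 + h) - exp_recip j 0) / h) \<le> fact (j + 2) * \<bar>h\<bar>" for h :: real
      proof (cases "h > 0")
        case True
        have "0 \<le> exp_recip j h" by (simp add: exp_recip_def)
        then show ?thesis using exp_recip_le_square[of j h] True
          by (simp add: exp_recip_def[of j 0] divide_le_eq power2_eq_square mult.assoc del: fact_Suc)
      qed (simp add: exp_recip_def mult_nonneg_nonpos del: fact_Suc)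
      then show "eventually (\<lambda>h. norm ((exp_recip j (0 + h) - exp_recip j 0) / h) \<le> fact (j + 2) * \<bar>h\<bar>) (at 0)"
        by (rule always_eventually[OF allI])
      show "(\<lambda>h::real. fact (j + 2) * \<bar>h\<bar>) \<midarrow>0\<rightarrow> 0"
        by (auto intro!: tendsto_eq_intros)
    qed
    then show ?thesis using 2 by (simp add: DERIV_def exp_recip_def)
  next
    case 3
    have "((\<lambda>t. exp (- 1 / t) / t ^ j) has_real_derivative
      exp_recip (j + 2) t - j * exp_recip (j + 1) t) (at t)"
    proof -
      have "((\<lambda>t. exp (- 1 / t)) has_real_derivative exp (- 1 / t) / t\<^sup>2) (at t)"
        using 3 by (auto intro!: derivative_eq_intros simp: power2_eq_square)
      from DERIV_divide[OF this DERIV_pow[of j]] 3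
      have "((\<lambda>t. exp (- 1 / t) / t ^ j) has_real_derivative (exp (- 1 / t) / t\<^sup>2 * t ^ j
          - exp (- 1 / t) * (j * t ^ (j - Suc 0))) / (t ^ j * t ^ j)) (at t)" by simp
      \<comment> \<open>For \<open>j = 0\<close> the exponent \<open>j - Suc 0\<close> is a
        truncated subtraction, harmless because of the factor \<open>j\<close>; hence the split on
        \<open>j\<close>.\<close>
      moreover have "(exp (- 1 / t) / t\<^sup>2 * t ^ j - exp (- 1 / t) * (j * t ^ (j - Suc 0))) / (t ^ j * t ^ j)
          = exp_recip (j + 2) t - j * exp_recip (j + 1) t"
        using 3 by (cases j) (simp_all add: exp_recip_def field_simps power2_eq_square)
      ultimately show ?thesis by simp
    qed
    moreover have "eventually (\<lambda>t. exp (- 1 / t) / t ^ j = exp_recip j t) (nhds t)"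
      using eventually_nhds_in_open[of "{0<..}" t] 3
      by (auto elim!: eventually_mono simp: exp_recip_def)
    ultimately show ?thesis by (rule iffD1[OF DERIV_cong_ev[OF refl _ refl], rotated])
  qed
qed

text \<open>Differentiation shifts \<open>j\<close> to \<open>j + 1\<close> and
  \<open>j + 2\<close>, so \<open>j\<close> is generalised in the induction; the inner derivative is
  affine in \<open>x\<close> and thus of every class.\<close>

lemma Ck_on_exp_recip:
  fixes a :: "'e::euclidean_space"
  shows "Ck_on k (\<lambda>x. exp_recip j (s - (x - a) \<bullet> (x - a))) UNIV"
proof (induction k arbitrary: j)
  case 0
  have "isCont (exp_recip j) t" for t using DERIV_exp_recip DERIV_isCont by blast
  then have "continuous_on UNIV (exp_recip j)" by (simp add: continuous_at_imp_continuous_on)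
  then show ?case
    by (auto intro!: continuous_intros intro: continuous_on_compose2)
next
  case (Suc k)
  define q where "q x = s - (x - a) \<bullet> (x - a)" for x :: 'e
  have q: "(q has_derivative (\<lambda>\<xi>. (-2) * ((x - a) \<bullet> \<xi>))) (at x)" for x
    unfolding q_def by (auto intro!: derivative_eq_intros simp: inner_commute)
  have D: "((\<lambda>x. exp_recip j (q x)) has_derivative
     (\<lambda>\<xi>. (exp_recip (j + 2) (q x) + (- real j) * exp_recip (j + 1) (q x)) * ((-2) * ((x - a) \<bullet> \<xi>)))) (at x)" for x
    using has_derivative_compose[OF q DERIV_exp_recip[THEN has_field_derivative_imp_has_derivative]]
    by simp
  have "Ck_on k (\<lambda>x. (exp_recip (j + 2) (q x) + (- real j) * exp_recip (j + 1) (q x)) * ((-2) * ((x - a) \<bullet> \<xi>))) UNIV" for \<xi>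
    by (intro Ck_on_mult Ck_on_add Ck_on_const Ck_on_inner_diff)
      (use Suc.IH in \<open>simp_all add: q_def\<close>)
  then have "Ck_on (Suc k) (\<lambda>x. exp_recip j (q x)) UNIV"
    using D by (auto simp: differentiable_def frechet_derivative_at[OF D, symmetric])
  then show ?case by (simp add: q_def)
qed

text \<open>In contrast to the C1 bump it is of every class, since its translates have to belong to
  \<open>test_functions\<close>. For \<open>e > 0\<close> the argument
  \<open>e\<^sup>2 - x \<bullet> x\<close> is positive exactly on the open ball of radius
  \<open>e\<close>.\<close>

definition mollifier :: "real \<Rightarrow> 'e::euclidean_space \<Rightarrow> real" where
  "mollifier e x = exp_recip 0 (e\<^sup>2 - x \<bullet> x) / (LINT y|lborel. exp_recip 0 (e\<^sup>2 - y \<bullet> (y::'e)))"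

lemma mollifier_eq_0: "e > 0 \<Longrightarrow> x \<notin> cball 0 e \<Longrightarrow> mollifier e x = 0"
proof -
  assume "e > 0" "x \<notin> cball 0 e"
  then have "e\<^sup>2 \<le> (norm x)\<^sup>2" by (intro power_mono) auto
  then show ?thesis by (simp add: mollifier_def exp_recip_def power2_norm_eq_inner)
qed

lemma mollifier_translate_test_function:
  fixes y :: "'e::euclidean_space"
  assumes "e > 0" "cball y e \<subseteq> \<Omega>"
  shows "(\<lambda>z. mollifier e (y - z)) \<in> test_functions \<Omega>"
proof -
  \<comment> \<open>As a function of \<open>z\<close> the translate is again of the form covered by
    \<open>Ck_on_exp_recip\<close>, now centred at \<open>y\<close>.\<close>
  have "(y - z) \<bullet> (y - z) = (z - y) \<bullet> (z - y)" for z
    by (simp add: algebra_simps inner_commute)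
  then have "(\<lambda>z. mollifier e (y - z)) = (\<lambda>z. exp_recip 0 (e\<^sup>2 - (z - y) \<bullet> (z - y)) *
      (1 / (LINT y|lborel. exp_recip 0 (e\<^sup>2 - y \<bullet> (y::'e)))))"
    by (simp add: mollifier_def)
  then have "Ck_on k (\<lambda>z. mollifier e (y - z)) UNIV" for k
    by (simp only:) (rule Ck_on_mult[OF Ck_on_exp_recip Ck_on_const])
  moreover have "closure {z. mollifier e (y - z) \<noteq> 0} \<subseteq> cball y e"
    using mollifier_eq_0[OF assms(1)]
    by (intro closure_minimal closed_cball) (force simp: dist_norm)
  ultimately show ?thesis
    using assms(2) unfolding test_functions_def
    by (simp add: bounded_subset[OF bounded_cball] closure_subset subset_trans[OF closure_subset])
    (meson bounded_cball bounded_subset closure_subset subset_trans)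
qed

lemma mollifier_C1:
  "has_C1_derivative_on (mollifier e) (\<lambda>x. frechet_derivative (mollifier e) (at x)) UNIV"
proof -
  have "Ck_on 1 (mollifier e :: 'a \<Rightarrow> real) UNIV"
    using Ck_on_mult[OF Ck_on_exp_recip[of 1 0 "e\<^sup>2" "0::'a"] Ck_on_const[of 1 "1 / (LINT y|lborel. exp_recip 0 (e\<^sup>2 - y \<bullet> (y::'a)))"]]
    by (simp add: mollifier_def[abs_def])
  then show ?thesis by (simp only: Ck_on_1_iff)
qed

lemma mollifier_nonneg: "0 \<le> mollifier e x"
  by (auto simp: mollifier_def exp_recip_def intro!: divide_nonneg_nonneg integral_nonneg_AE)

lemma mollifier_integral:
  assumes "e > 0"
  shows "integrable lborel (mollifier e :: 'e::euclidean_space \<Rightarrow> real)"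
    "(LINT x|lborel. mollifier e (x::'e)) = 1"
proof -
  define \<phi> where "\<phi> = (\<lambda>x::'e. exp_recip 0 (e\<^sup>2 - x \<bullet> x))"
  have cont: "continuous_on UNIV \<phi>"
    using Ck_on_exp_recip[of 0 0 "e\<^sup>2" "0::'e"] by (simp add: \<phi>_def)
  have out: "\<phi> x = 0" if "x \<notin> cball 0 e" for x
  proof -
    have "e\<^sup>2 \<le> (norm x)\<^sup>2" using that assms by (intro power_mono) auto
    then show ?thesis by (simp add: \<phi>_def exp_recip_def power2_norm_eq_inner)
  qed
  have "integrable lborel (\<lambda>x. indicator (cball 0 e) x *\<^sub>R \<phi> x)"
    by (rule borel_integrable_compact) (use cont continuous_on_subset in auto)
  moreover have "(\<lambda>x. indicator (cball 0 e) x *\<^sub>R \<phi> x) = \<phi>"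
    using out by (auto simp: indicator_def fun_eq_iff)
  ultimately have int: "integrable lborel \<phi>" by simp
  \<comment> \<open>Division by 0 returns 0, so the unit mass depends on the normalising integral
    being nonzero: \<open>\<phi>\<close> is nonnegative, and positive on an open ball, which is not
    negligible.\<close>
  have nonneg: "\<phi> x \<ge> 0" for x by (simp add: \<phi>_def exp_recip_def)
  have "integral\<^sup>L lborel \<phi> \<noteq> 0"
  proof
    assume "integral\<^sup>L lborel \<phi> = 0"
    then have "AE x in lborel. \<phi> x = 0"
      using integral_nonneg_eq_0_iff_AE[OF int] nonneg by simp
    moreover have "ball 0 e \<subseteq> {x. \<phi> x \<noteq> 0}"
    proof
      fix x assume "x \<in> ball (0::'e) e"
      then have "(norm x)\<^sup>2 < e\<^sup>2" by (intro power_strict_mono) auto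
      then show "x \<in> {x. \<phi> x \<noteq> 0}" by (simp add: \<phi>_def exp_recip_def power2_norm_eq_inner)
    qed
    ultimately have "AE x in lborel. x \<notin> ball (0::'e) e" by (auto elim!: eventually_mono)
    then have "negligible (ball (0::'e) e)"
      unfolding negligible_iff_null_sets
      by (intro null_sets_completionI) (simp add: AE_iff_null_sets del: mem_ball)
    then show False using open_not_negligible[of "ball (0::'e) e"] assms by auto
  qed
  moreover have "mollifier e = (\<lambda>x. \<phi> x / integral\<^sup>L lborel \<phi>)"
    by (simp add: mollifier_def[abs_def] \<phi>_def)
  ultimately show "integrable lborel (mollifier e :: 'e \<Rightarrow> real)"
    "(LINT x|lborel. mollifier e (x::'e)) = 1"
    using int by simp_all
qed

section \<open>Density of continuous functions\<close>

text \<open>Induction over integrable functions: an indicator is treated by regularity of the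
  measure and a Urysohn function, and the property passes to sums and to dominated limits.\<close>

lemma integrable_lborel_approx_continuous:
  fixes f :: "'e::euclidean_space \<Rightarrow> real"
  assumes "integrable lborel f"
  shows "\<forall>\<delta>>0. \<exists>\<phi>. continuous_on UNIV \<phi> \<and> integrable lborel \<phi> \<and> (LINT x|lborel. \<bar>f x - \<phi> x\<bar>) < \<delta>"
  using assms
proof (induction rule: integrable_induct)
  case (base A c)
  show ?case
  proof (intro allI impI)
    fix \<delta> :: real assume "\<delta> > 0"
    \<comment> \<open>An open \<open>U\<close> and a closed \<open>T\<close> enclose
      \<open>A\<close> up to measure \<open>2 * d\<close>, and the error there is at most
      \<open>\<bar>c\<bar>\<close>; the added 1 covers \<open>c = 0\<close>.\<close>
    define d where "d = \<delta> / (2 * (\<bar>c\<bar> + 1))"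
    have d: "d > 0" "\<bar>c\<bar> * (2 * d) < \<delta>"
      using \<open>\<delta> > 0\<close> by (auto simp: d_def field_simps add_pos_nonneg)
    have A: "A \<in> sets borel" "A \<in> sets lebesgue" using base(1) by auto
    obtain U where U: "open U" "A \<subseteq> U" "U - A \<in> lmeasurable" "emeasure lebesgue (U - A) < ennreal d"
      using sets_lebesgue_outer_open[OF A(2) d(1)] by blast
    obtain T where T: "closed T" "T \<subseteq> A" "A - T \<in> lmeasurable" "emeasure lebesgue (A - T) < ennreal d"
      using sets_lebesgue_inner_closed[OF A(2) d(1)] by blast
    have UT: "U - T \<in> sets borel" "emeasure lborel (U - T) < ennreal (2 * d)"
    proof -
      show "U - T \<in> sets borel" using U(1) T(1) by (intro sets.Diff) auto
      have "emeasure lborel (U - T) = emeasure lborel ((U - A) \<union> (A - T))"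
        using U(2) T(2) by (intro arg_cong[where f="emeasure lborel"]) auto
      also have "\<dots> \<le> emeasure lborel (U - A) + emeasure lborel (A - T)"
        using U(1) T(1) A(1) by (intro emeasure_subadditive) (auto intro!: sets.Diff)
      also have "\<dots> < ennreal d + ennreal d"
        using U(4) T(4) U(1) T(1) A(1)
        by (intro add_strict_mono) (simp_all add: emeasure_completion sets.Diff)
      finally show "emeasure lborel (U - T) < ennreal (2 * d)"
        using d by (simp add: ennreal_plus[symmetric] del: ennreal_plus)
    qed
    have "emeasure lborel U \<le> emeasure lborel A + emeasure lborel (U - A)"
      using emeasure_subadditive[of A lborel "U - A"] U(1,2) A(1) by (simp add: Un_absorb1 sets.Diff)
    also have "\<dots> < \<infinity>"
      using base(2) U(1,4) A(1) order_less_trans[OF U(4) ennreal_less_top[of d]]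
      by (simp add: emeasure_completion sets.Diff ennreal_add_less_top)
    finally have emU: "emeasure lborel U < \<infinity>" .
    \<comment> \<open>Its values lie between 0 and \<open>c\<close>, so it differs from
      \<open>indicator A x *\<^sub>R c\<close> only on \<open>U - T\<close>, and by no more than
      \<open>\<bar>c\<bar>\<close>.\<close>
    obtain g :: "'e \<Rightarrow> real" where g: "continuous_on UNIV g" "\<And>x. g x \<in> closed_segment c 0"
      "\<And>x. x \<in> T \<Longrightarrow> g x = c" "\<And>x. x \<in> - U \<Longrightarrow> g x = 0"
      by (rule Urysohn[of T "- U"]) (use U T in auto)
    have gb: "\<bar>g x\<bar> \<le> \<bar>c\<bar>" "\<bar>c - g x\<bar> \<le> \<bar>c\<bar>" for x
      using g(2)[of x] by (auto simp: closed_segment_eq_real_ivl split: if_splits)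
    have gm[measurable]: "g \<in> borel_measurable lborel"
      using g(1) by (simp add: borel_measurable_continuous_onI)
    have iU: "integrable lborel (\<lambda>x. \<bar>c\<bar> * indicator U x)"
      using emU U(1) by simp
    have "integrable lborel g"
      by (rule Bochner_Integration.integrable_bound[OF iU]) (use gb g(4) in \<open>auto simp: indicator_def\<close>)
    moreover have "(LINT x|lborel. \<bar>indicator A x *\<^sub>R c - g x\<bar>) \<le> (LINT x|lborel. \<bar>c\<bar> * indicator (U - T) x)"
    proof (rule integral_mono')
      show "integrable lborel (\<lambda>x. \<bar>c\<bar> * indicator (U - T) x)"
        using UT by (simp add: order_less_trans[OF UT(2)])
      show "\<bar>indicator A x *\<^sub>R c - g x\<bar> \<le> \<bar>c\<bar> * indicator (U - T) x" if "x \<in> space lborel" for x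
        using gb[of x] g(3,4)[of x] U(2) T(2) by (auto simp: indicator_def)
    qed auto
    moreover have "(LINT x|lborel. \<bar>c\<bar> * indicator (U - T) x) \<le> \<bar>c\<bar> * (2 * d)"
    proof -
      have "measure lborel (U - T) \<le> 2 * d"
        using UT d by (metis (no_types) enn2real_leI ennreal_leI less_eq_real_def measure_def
          mult_pos_pos order_less_imp_le zero_less_numeral)
      then show ?thesis using UT by (simp add: mult_left_mono)
    qed
    ultimately show "\<exists>\<phi>. continuous_on UNIV \<phi> \<and> integrable lborel \<phi> \<and>
        (LINT x|lborel. \<bar>indicator A x *\<^sub>R c - \<phi> x\<bar>) < \<delta>"
      using g(1) d(2) by (intro exI[of _ g]) linarith
  qed
next
  case (add f g)
  show ?case
  proof (intro allI impI)
    fix \<delta> :: real assume "\<delta> > 0"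
    obtain \<phi> where \<phi>: "continuous_on UNIV \<phi>" "integrable lborel \<phi>" "(LINT x|lborel. \<bar>f x - \<phi> x\<bar>) < \<delta> / 2"
      using add \<open>\<delta> > 0\<close> by (meson half_gt_zero)
    obtain \<psi> where \<psi>: "continuous_on UNIV \<psi>" "integrable lborel \<psi>" "(LINT x|lborel. \<bar>g x - \<psi> x\<bar>) < \<delta> / 2"
      using add \<open>\<delta> > 0\<close> by (meson half_gt_zero)
    have "(LINT x|lborel. \<bar>(f x + g x) - (\<phi> x + \<psi> x)\<bar>) \<le> (LINT x|lborel. \<bar>f x - \<phi> x\<bar> + \<bar>g x - \<psi> x\<bar>)"
      using add \<phi> \<psi> by (intro integral_mono) auto
    also have "\<dots> < \<delta>" using add \<phi> \<psi> by (subst Bochner_Integration.integral_add) auto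
    finally show "\<exists>\<phi>. continuous_on UNIV \<phi> \<and> integrable lborel \<phi> \<and> (LINT x|lborel. \<bar>(f x + g x) - \<phi> x\<bar>) < \<delta>"
      using \<phi> \<psi> by (intro exI[of _ "\<lambda>x. \<phi> x + \<psi> x"]) (auto intro: continuous_intros)
  qed
next
  case (lim f s)
  show ?case
  proof (intro allI impI)
    fix \<delta> :: real assume "\<delta> > 0"
    have [measurable]: "f \<in> borel_measurable lborel" "\<And>i. s i \<in> borel_measurable lborel"
      using lim.hyps by auto
    have "(\<lambda>i. LINT x|lborel. \<bar>f x - s i x\<bar>) \<longlonglongrightarrow> (LINT x::'e|lborel. (0::real))"
    proof (rule integral_dominated_convergence)
      \<comment> \<open>The induction rule bounds \<open>s i\<close> by twice \<open>f\<close>,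
        hence the factor 3 for the difference.\<close>
      show "integrable lborel (\<lambda>x. 3 * \<bar>f x\<bar>)" using lim.hyps by simp
      show "AE x in lborel. (\<lambda>i. \<bar>f x - s i x\<bar>) \<longlonglongrightarrow> 0"
        using lim.hyps(2) by (intro AE_I2) (auto intro!: tendsto_eq_intros)
      show "AE x in lborel. norm \<bar>f x - s i x\<bar> \<le> 3 * \<bar>f x\<bar>" for i
      proof (intro AE_I2)
        fix x show "norm \<bar>f x - s i x\<bar> \<le> 3 * \<bar>f x\<bar>" using lim.hyps(3)[of x i] by simp
      qed
    qed auto
    then have "eventually (\<lambda>i. (LINT x|lborel. \<bar>f x - s i x\<bar>) < \<delta> / 2) sequentially"
      using \<open>\<delta> > 0\<close> by (intro order_tendstoD) auto
    then obtain i where i: "(LINT x|lborel. \<bar>f x - s i x\<bar>) < \<delta> / 2"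
      using eventually_happens by force
    obtain \<phi> where \<phi>: "continuous_on UNIV \<phi>" "integrable lborel \<phi>" "(LINT x|lborel. \<bar>s i x - \<phi> x\<bar>) < \<delta> / 2"
      using lim.IH[of i] \<open>\<delta> > 0\<close> by (meson half_gt_zero)
    have "(LINT x|lborel. \<bar>f x - \<phi> x\<bar>) \<le> (LINT x|lborel. \<bar>f x - s i x\<bar> + \<bar>s i x - \<phi> x\<bar>)"
      using lim.hyps(1,4) \<phi> by (intro integral_mono) auto
    also have "\<dots> < \<delta>" using lim.hyps(1,4) \<phi> i by (subst Bochner_Integration.integral_add) auto
    finally show "\<exists>\<phi>. continuous_on UNIV \<phi> \<and> integrable lborel \<phi> \<and> (LINT x|lborel. \<bar>f x - \<phi> x\<bar>) < \<delta>"
      using \<phi> by blast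
  qed
qed

section \<open>Mollification\<close>

definition mollify :: "real \<Rightarrow> ('e::euclidean_space \<Rightarrow> real) \<Rightarrow> 'e \<Rightarrow> real" where
  "mollify e H y = (LINT z|lborel. H z * mollifier e (y - z))"

lemma mollifier_measurable [measurable]: "mollifier e \<in> borel_measurable borel"
  using has_C1_derivative_onD(4)[OF mollifier_C1] by (rule borel_measurable_continuous_onI)

lemma mollifier_frechet_measurable:
  "(\<lambda>x. frechet_derivative (mollifier e) (at x) \<xi>) \<in> borel_measurable borel"
  using has_C1_derivative_onD(2)[OF mollifier_C1] by (rule borel_measurable_continuous_onI)

lemma mollifier_bounds:
  assumes "e > 0"
  obtains C where "C > 0" "\<And>x. \<bar>mollifier e (x::'e::euclidean_space)\<bar> \<le> C"
    "\<And>x \<xi>. \<bar>frechet_derivative (mollifier e) (at x) \<xi>\<bar> \<le> C * norm (\<xi>::'e)"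
    "\<And>x y. \<bar>mollifier e x - mollifier e y\<bar> \<le> C * norm (x - y::'e)"
proof -
  obtain C where C: "C > 0" "\<And>x. norm (mollifier e (x::'e)) \<le> C"
    "\<And>x \<xi>. norm (frechet_derivative (mollifier e) (at x) \<xi>) \<le> C * norm (\<xi>::'e)"
    "\<And>x y. norm (mollifier e x - mollifier e (y::'e)) \<le> C * norm (x - y)"
    by (rule has_C1_derivative_on_compact_support_bounded[OF mollifier_C1 compact_cball[of 0 e]])
      (use mollifier_eq_0[OF assms] in auto)
  then show ?thesis by (intro that) auto
qed

lemma integrable_bounded_mult:
  fixes H g :: "_ \<Rightarrow> real"
  assumes "integrable M H" "g \<in> borel_measurable M" "\<And>x. x \<in> space M \<Longrightarrow> \<bar>g x\<bar> \<le> C"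
  shows "integrable M (\<lambda>x. H x * g x)"
proof (rule Bochner_Integration.integrable_bound)
  show "integrable M (\<lambda>x. C * H x)" using assms(1) by simp
  show "AE x in M. norm (H x * g x) \<le> norm (C * H x)"
  proof (intro AE_I2)
    fix x assume "x \<in> space M"
    from assms(3)[OF this] have "\<bar>H x\<bar> * \<bar>g x\<bar> \<le> \<bar>H x\<bar> * \<bar>C\<bar>"
      by (intro mult_left_mono) auto
    then show "norm (H x * g x) \<le> norm (C * H x)" by (simp add: abs_mult mult.commute)
  qed
qed (use assms in auto)

text \<open>Differentiation under the integral: the difference quotients of the mollifier are
  bounded uniformly by its Lipschitz constant, so dominated convergence applies with a multiple of
  \<open>H\<close>.\<close>

lemma mollify_C1:
  fixes H :: "'e::euclidean_space \<Rightarrow> real"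
  assumes e: "e > 0" and H: "integrable lborel H"
  shows "has_C1_derivative_on (mollify e H)
    (\<lambda>y \<xi>. LINT z|lborel. H z * frechet_derivative (mollifier e) (at (y - z)) \<xi>) UNIV"
    (is "has_C1_derivative_on _ ?D UNIV")
proof -
  define \<rho>' where "\<rho>' = (\<lambda>x. frechet_derivative (mollifier e) (at (x::'e)))"
  obtain C where C: "C > 0" "\<And>x. \<bar>mollifier e (x::'e)\<bar> \<le> C" "\<And>x \<xi>. \<bar>\<rho>' x \<xi>\<bar> \<le> C * norm \<xi>"
    "\<And>x y. \<bar>mollifier e x - mollifier e (y::'e)\<bar> \<le> C * norm (x - y)"
    using mollifier_bounds[OF e, where 'e='e] unfolding \<rho>'_def by blast
  have \<rho>': "(mollifier e has_derivative \<rho>' x) (at x)" "continuous_on UNIV (\<lambda>x. \<rho>' x \<xi>)"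
    "linear (\<rho>' x)" for x \<xi>
    unfolding \<rho>'_def using has_C1_derivative_onD(1,2,3)[OF mollifier_C1] by auto
  have Hm[measurable]: "H \<in> borel_measurable borel" using H by auto
  have \<rho>'m: "(\<lambda>z. \<rho>' z \<xi>) \<in> borel_measurable borel" for \<xi>
    unfolding \<rho>'_def by (rule mollifier_frechet_measurable)
  have \<rho>'m2[measurable]: "(\<lambda>z. \<rho>' (y - z) \<xi>) \<in> borel_measurable borel" for y \<xi>
    by (rule measurable_compose[OF _ \<rho>'m]) simp
  have i1: "integrable lborel (\<lambda>z. H z * mollifier e (y - z))" for y
    by (rule integrable_bounded_mult[OF H, of _ C]) (use C in auto)
  have i2: "integrable lborel (\<lambda>z. H z * \<rho>' (y - z) \<xi>)" for y \<xi>
    by (rule integrable_bounded_mult[OF H, of _ "C * norm \<xi>"]) (use C in auto)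
  have "has_C1_derivative_on (mollify e H) (\<lambda>y \<xi>. LINT z|lborel. H z * \<rho>' (y - z) \<xi>) UNIV"
  proof (rule has_C1_derivative_onI)
    fix y :: 'e
    define D where "D \<xi> = (LINT z|lborel. H z * \<rho>' (y - z) \<xi>)" for \<xi>
    have "linear D"
      unfolding D_def using i2 \<rho>'(3)
      by (intro linearI) (simp_all add: linear_add linear_scale algebra_simps)
    moreover have "(\<lambda>h. norm (mollify e H (y + h) - mollify e H y - D h) / norm h) \<midarrow>0\<rightarrow> 0"
      \<comment> \<open>Dominated convergence speaks of sequences, so the limit defining the
        derivative is tested along an arbitrary null sequence \<open>X\<close>.\<close>
      unfolding tendsto_at_iff_sequentially
    proof (intro allI impI)
      fix X :: "nat \<Rightarrow> 'e" assume X0: "\<forall>i. X i \<in> UNIV - {0}" and X: "X \<longlonglongrightarrow> 0"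
      define q where "q i z = (mollifier e (y + X i - z) - mollifier e (y - z) - \<rho>' (y - z) (X i)) / norm (X i)" for i z
      have qm[measurable]: "q i \<in> borel_measurable borel" for i unfolding q_def by measurable
      have "(\<lambda>i. LINT z|lborel. H z * q i z) \<longlonglongrightarrow> (LINT z::'e|lborel. (0::real))"
      proof (rule integral_dominated_convergence)
        \<comment> \<open>One \<open>C\<close> comes from the Lipschitz bound of the mollifier, the
          other from the bound of its derivative.\<close>
        show "integrable lborel (\<lambda>z. 2 * C * \<bar>H z\<bar>)" using H by simp
        show "AE z in lborel. (\<lambda>i. H z * q i z) \<longlonglongrightarrow> 0"
        proof (intro AE_I2)
          fix z
          have "(\<lambda>h. norm (mollifier e (y - z + h) - mollifier e (y - z) - \<rho>' (y - z) h) / norm h) \<midarrow>0\<rightarrow> 0"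
            using \<rho>'(1)[of "y - z"] by (simp add: has_derivative_at)
          then have "(\<lambda>i. norm (q i z)) \<longlonglongrightarrow> 0"
            unfolding tendsto_at_iff_sequentially using X0 X by (auto simp: q_def o_def algebra_simps)
          then have "(\<lambda>i. q i z) \<longlonglongrightarrow> 0" by (rule tendsto_norm_zero_cancel)
          then show "(\<lambda>i. H z * q i z) \<longlonglongrightarrow> 0" by (auto intro: tendsto_eq_intros)
        qed
        show "AE z in lborel. norm (H z * q i z) \<le> 2 * C * \<bar>H z\<bar>" for i
        proof (intro AE_I2)
          fix z
          have "\<bar>mollifier e (y + X i - z) - mollifier e (y - z) - \<rho>' (y - z) (X i)\<bar> \<le> 2 * C * norm (X i)"
            using C(3)[of "y - z" "X i"] C(4)[of "y + X i - z" "y - z"] by simp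
          then have "\<bar>q i z\<bar> \<le> 2 * C" using X0 by (simp add: q_def divide_le_eq)
          then have "\<bar>H z\<bar> * \<bar>q i z\<bar> \<le> \<bar>H z\<bar> * (2 * C)" by (intro mult_left_mono) auto
          then show "norm (H z * q i z) \<le> 2 * C * \<bar>H z\<bar>" by (simp add: abs_mult mult.commute)
        qed
      qed auto
      then have lim: "(\<lambda>i. norm (LINT z|lborel. H z * q i z)) \<longlonglongrightarrow> 0" by (simp add: tendsto_rabs_zero)
      have "norm (mollify e H (y + X i) - mollify e H y - D (X i)) / norm (X i)
          = norm (LINT z|lborel. H z * q i z)" for i
      proof -
        have "mollify e H (y + X i) - mollify e H y - D (X i)
          = (LINT z|lborel. H z * mollifier e (y + X i - z) - H z * mollifier e (y - z) - H z * \<rho>' (y - z) (X i))"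
          unfolding mollify_def D_def using i1 i2 by simp
        also have "\<dots> = (LINT z|lborel. norm (X i) * (H z * q i z))"
          using X0 by (intro Bochner_Integration.integral_cong) (auto simp: q_def right_diff_distrib[symmetric])
        finally show ?thesis using X0 by (simp add: abs_mult)
      qed
      then show "((\<lambda>h. norm (mollify e H (y + h) - mollify e H y - D h) / norm h) \<circ> X) \<longlonglongrightarrow> 0"
        using lim by (simp add: o_def)
    qed
    ultimately show "(mollify e H has_derivative (\<lambda>\<xi>. LINT z|lborel. H z * \<rho>' (y - z) \<xi>)) (at y)"
      unfolding has_derivative_at D_def[symmetric] by (simp add: linear_conv_bounded_linear)
  next
    fix \<xi>
    show "continuous_on UNIV (\<lambda>y. LINT z|lborel. H z * \<rho>' (y - z) \<xi>)"
    proof (intro continuous_at_imp_continuous_on ballI continuous_at_sequentiallyI)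
      fix y and Y :: "nat \<Rightarrow> 'e" assume Y: "Y \<longlonglongrightarrow> y"
      show "(\<lambda>n. LINT z|lborel. H z * \<rho>' (Y n - z) \<xi>) \<longlonglongrightarrow> (LINT z|lborel. H z * \<rho>' (y - z) \<xi>)"
      proof (rule integral_dominated_convergence)
        show "integrable lborel (\<lambda>z. C * norm \<xi> * \<bar>H z\<bar>)" using H by simp
        show "AE z in lborel. (\<lambda>n. H z * \<rho>' (Y n - z) \<xi>) \<longlonglongrightarrow> H z * \<rho>' (y - z) \<xi>"
          by (intro AE_I2 tendsto_mult_left continuous_on_tendsto_compose[OF \<rho>'(2)[of \<xi>]]
            tendsto_diff Y tendsto_const) auto
        show "AE z in lborel. norm (H z * \<rho>' (Y n - z) \<xi>) \<le> C * norm \<xi> * \<bar>H z\<bar>" for n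
          using C(3) by (intro AE_I2) (simp add: abs_mult mult.commute mult_left_mono)
      qed (use Hm in measurable)
    qed
  qed
  then show ?thesis by (simp add: \<rho>'_def)
qed

lemma nn_integral_mollifier_translate:
  fixes z :: "'a::euclidean_space"
  assumes "e > 0"
  shows "(\<integral>\<^sup>+y. ennreal (mollifier e (y - z)) \<partial>lborel) = 1"
    "(\<integral>\<^sup>+y. ennreal (mollifier e (z - y)) \<partial>lborel) = 1"
proof -
  have "(\<integral>\<^sup>+y. ennreal (mollifier e (y - z)) \<partial>lborel)
      = (\<integral>\<^sup>+y. ennreal (mollifier e (y - z)) \<partial>(distr lborel borel ((+) z)))"
    by (simp add: lborel_distr_plus)
  also have "\<dots> = (\<integral>\<^sup>+y. ennreal (mollifier e (y::'a)) \<partial>lborel)"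
    by (subst nn_integral_distr) auto
  also have "\<dots> = 1"
    using mollifier_integral[OF assms, where 'e='a] mollifier_nonneg
    by (subst nn_integral_eq_integral) auto
  finally show 1: "(\<integral>\<^sup>+y. ennreal (mollifier e (y - z)) \<partial>lborel) = 1" .
  have "mollifier e (z - y) = mollifier e (y - z)" for y
    by (simp add: mollifier_def inner_diff_left inner_diff_right inner_commute algebra_simps)
  then show "(\<integral>\<^sup>+y. ennreal (mollifier e (z - y)) \<partial>lborel) = 1" using 1 by simp
qed

text \<open>Fubini and the unit mass of the translated mollifier: mollification does not increase
  the L1 norm.\<close>

lemma mollify_Young:
  fixes G :: "'e::euclidean_space \<Rightarrow> real"
  assumes e: "e > 0" and [measurable]: "G \<in> borel_measurable borel"
  shows "(\<integral>\<^sup>+y. ennreal \<bar>mollify e G y\<bar> \<partial>lborel) \<le> (\<integral>\<^sup>+z. ennreal \<bar>G z\<bar> \<partial>lborel)"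
proof -
  have "(\<integral>\<^sup>+y. ennreal \<bar>mollify e G y\<bar> \<partial>lborel)
      \<le> (\<integral>\<^sup>+y. (\<integral>\<^sup>+z. ennreal \<bar>G z\<bar> * ennreal (mollifier e (y - z)) \<partial>lborel) \<partial>lborel)"
  proof (rule nn_integral_mono)
    fix y :: 'e
    \<comment> \<open>If the integrand is not integrable, the Bochner integral is 0 by convention
      and the bound is trivial.\<close>
    have "ennreal \<bar>mollify e G y\<bar> \<le> (\<integral>\<^sup>+z. ennreal (norm (G z * mollifier e (y - z))) \<partial>lborel)"
      unfolding mollify_def by (metis integral_norm_bound_ennreal not_integrable_integral_eq
          abs_zero ennreal_0 real_norm_def zero_le)
    also have "\<dots> = (\<integral>\<^sup>+z. ennreal \<bar>G z\<bar> * ennreal (mollifier e (y - z)) \<partial>lborel)"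
      by (intro nn_integral_cong) (simp add: abs_mult ennreal_mult' mollifier_nonneg)
    finally show "ennreal \<bar>mollify e G y\<bar> \<le> (\<integral>\<^sup>+z. ennreal \<bar>G z\<bar> * ennreal (mollifier e (y - z)) \<partial>lborel)" .
  qed
  also have "\<dots> = (\<integral>\<^sup>+z. (\<integral>\<^sup>+y. ennreal \<bar>G z\<bar> * ennreal (mollifier e (y - z)) \<partial>lborel) \<partial>lborel)"
  proof (rule lborel_pair.Fubini')
    show "(\<lambda>(z, y). ennreal \<bar>G z\<bar> * ennreal (mollifier e (y - z))) \<in> borel_measurable (lborel \<Otimes>\<^sub>M lborel)"
      by measurable
  qed
  also have "\<dots> = (\<integral>\<^sup>+z. ennreal \<bar>G z\<bar> \<partial>lborel)"
    using nn_integral_mollifier_translate(1)[OF e, where 'a='e]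
    by (intro nn_integral_cong) (simp add: nn_integral_cmult)
  finally show ?thesis .
qed

lemma integrable_mult_mollifier:
  assumes "e > 0" "integrable lborel H"
  shows "integrable lborel (\<lambda>z. H z * mollifier e (y - z))"
proof -
  obtain C where "C > 0" "\<And>x. \<bar>mollifier e (x::'a)\<bar> \<le> C" using mollifier_bounds[OF assms(1)] by metis
  then show ?thesis by (intro integrable_bounded_mult[OF assms(2), of _ C]) auto
qed

text \<open>\<open>mollify e \<phi> y\<close> is an average of \<open>\<phi>\<close> over the ball
  of radius \<open>e\<close> around \<open>y\<close>, so the error is at most the oscillation of
  \<open>\<phi>\<close> there.\<close>

lemma mollify_near_continuous:
  fixes \<phi> :: "'e::euclidean_space \<Rightarrow> real"
  assumes e: "e > 0" and \<phi>: "integrable lborel \<phi>"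
    and d: "\<And>z. z \<in> cball y e \<Longrightarrow> \<bar>\<phi> z - \<phi> y\<bar> \<le> \<delta>"
  shows "\<bar>mollify e \<phi> y - \<phi> y\<bar> \<le> \<delta>"
proof -
  have mi: "integrable lborel (\<lambda>z. mollifier e (y - z))" "(LINT z|lborel. mollifier e (y - z)) = 1"
  proof -
    show "integrable lborel (\<lambda>z. mollifier e (y - z))"
      using nn_integral_mollifier_translate(2)[OF e, of y] mollifier_nonneg
      by (intro integrableI_nonneg) auto
    show "(LINT z|lborel. mollifier e (y - z)) = 1"
      using nn_integral_mollifier_translate(2)[OF e, of y] mollifier_nonneg
      by (subst integral_eq_nn_integral) auto
  qed
  have "mollify e \<phi> y - \<phi> y = (LINT z|lborel. \<phi> z * mollifier e (y - z) - \<phi> y * mollifier e (y - z))"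
    unfolding mollify_def using mi integrable_mult_mollifier[OF e \<phi>] by simp
  also have "\<bar>\<dots>\<bar> \<le> (LINT z|lborel. \<delta> * mollifier e (y - z))"
  proof (rule integral_abs_bound_integral)
    show "\<bar>\<phi> z * mollifier e (y - z) - \<phi> y * mollifier e (y - z)\<bar> \<le> \<delta> * mollifier e (y - z)"
      if "z \<in> space lborel" for z
    proof (cases "z \<in> cball y e")
      case True
      then have "\<bar>\<phi> z - \<phi> y\<bar> * mollifier e (y - z) \<le> \<delta> * mollifier e (y - z)"
        using d mollifier_nonneg by (intro mult_right_mono) auto
      then show ?thesis
        using mollifier_nonneg[of e "y - z"] by (simp add: left_diff_distrib[symmetric] abs_mult)
    next
      case False
      then have "mollifier e (y - z) = 0" using mollifier_eq_0[OF e] by (auto simp: dist_norm)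
      then show ?thesis by simp
    qed
  qed (use mi integrable_mult_mollifier[OF e \<phi>] in auto)
  also have "\<dots> = \<delta>" using mi by simp
  finally show ?thesis .
qed

text \<open>For continuous functions mollifications converge uniformly on bounded sets; density of
  these functions and the L1 bound of \<open>mollify_Young\<close> extend the convergence to every
  integrable \<open>H\<close>.\<close>

lemma mollify_L1_tendsto:
  fixes H :: "'e::euclidean_space \<Rightarrow> real"
  assumes H: "integrable lborel H" and B: "B \<in> sets borel" "bounded B"
    and e: "\<And>k. \<epsilon> k > 0" "\<epsilon> \<longlonglongrightarrow> 0"
  shows "(\<lambda>k. \<integral>\<^sup>+y\<in>B. ennreal \<bar>mollify (\<epsilon> k) H y - H y\<bar> \<partial>lborel) \<longlonglongrightarrow> 0"
proof (rule order_tendstoI)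
  fix a :: ennreal assume "0 < a"
  obtain r where "0 < r" "r < a" using dense[OF \<open>0 < a\<close>] by blast
  then obtain a' where a': "a' > 0" "ennreal a' < a"
    by (cases r) (auto simp: ennreal_less_zero_iff)
  define c where "c = measure lborel B"
  have Bfin: "emeasure lborel B = ennreal c"
    using emeasure_bounded_finite[OF B(2)] by (simp add: c_def emeasure_eq_ennreal_measure)
  \<comment> \<open>The final error is \<open>\<delta>\<close> for each of the two L1 terms and
    \<open>\<delta> * c\<close> for the uniform term on \<open>B\<close>; the denominator
    \<open>3 + c\<close> leaves one \<open>\<delta>\<close> to spare.\<close>
  define \<delta> where "\<delta> = a' / (3 + c)"
  have c: "c \<ge> 0" by (simp add: c_def)
  then have \<delta>: "\<delta> > 0" "\<delta> + \<delta> * c + \<delta> \<le> a'"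
  proof -
    show "\<delta> > 0" using c a'(1) by (simp add: \<delta>_def)
    moreover have "\<delta> * (3 + c) = a'" using c by (simp add: \<delta>_def)
    then have "\<delta> + \<delta> * c + \<delta> = a' - \<delta>" by (simp add: algebra_simps)
    ultimately show "\<delta> + \<delta> * c + \<delta> \<le> a'" by simp
  qed
  obtain \<phi> where \<phi>: "continuous_on UNIV \<phi>" "integrable lborel \<phi>" "(LINT x|lborel. \<bar>H x - \<phi> x\<bar>) < \<delta>"
    using integrable_lborel_approx_continuous[OF H] \<delta>(1) by blast
  have meas[measurable]: "H \<in> borel_measurable borel" "\<phi> \<in> borel_measurable borel" "B \<in> sets borel"
    using H \<phi> B by auto
  have mm[measurable]: "mollify e G \<in> borel_measurable borel" if "e > 0" "integrable lborel G" for e and G :: "'e \<Rightarrow> real"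
    using has_C1_derivative_onD(4)[OF mollify_C1[OF that]] by (rule borel_measurable_continuous_onI)
  have nH: "(\<integral>\<^sup>+x. ennreal \<bar>H x - \<phi> x\<bar> \<partial>lborel) \<le> ennreal \<delta>"
    using \<phi> H by (subst nn_integral_eq_integral) (auto intro!: ennreal_leI)
  obtain x0 R where R: "B \<subseteq> cball x0 R" using B(2) by (auto simp: bounded_subset_cball)
  \<comment> \<open>The radius is enlarged by 1 because, once \<open>\<epsilon> k < 1\<close>, the
    average at a point of \<open>B\<close> involves points up to distance 1 from it.\<close>
  have "uniformly_continuous_on (cball x0 (R + 1)) \<phi>"
    by (rule compact_uniformly_continuous) (use \<phi>(1) continuous_on_subset in auto)
  then obtain d where d: "d > 0" "\<And>y z. y \<in> cball x0 (R + 1) \<Longrightarrow> z \<in> cball x0 (R + 1) \<Longrightarrow> dist z y < d \<Longrightarrow> dist (\<phi> z) (\<phi> y) < \<delta>"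
    unfolding uniformly_continuous_on_def using \<delta>(1) by meson
  have "eventually (\<lambda>k. \<epsilon> k < min 1 d) sequentially"
    by (rule order_tendstoD(2)[OF e(2)]) (use d in auto)
  then show "eventually (\<lambda>k. (\<integral>\<^sup>+y\<in>B. ennreal \<bar>mollify (\<epsilon> k) H y - H y\<bar> \<partial>lborel) < a) sequentially"
  proof (rule eventually_mono)
    fix k assume k: "\<epsilon> k < min 1 d"
    have int: "integrable lborel (\<lambda>x. H x - \<phi> x)" using H \<phi> by simp
    note [measurable] = mm[OF e(1)[of k] H] mm[OF e(1)[of k] \<phi>(2)] mm[OF e(1)[of k] int]
    have "(\<integral>\<^sup>+y\<in>B. ennreal \<bar>mollify (\<epsilon> k) H y - H y\<bar> \<partial>lborel)
      \<le> (\<integral>\<^sup>+y. ennreal \<bar>mollify (\<epsilon> k) (\<lambda>x. H x - \<phi> x) y\<bar> + ennreal \<delta> * indicator B y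
          + ennreal \<bar>H y - \<phi> y\<bar> \<partial>lborel)"
    proof (rule nn_integral_mono)
      fix y
      show "ennreal \<bar>mollify (\<epsilon> k) H y - H y\<bar> * indicator B y
        \<le> ennreal \<bar>mollify (\<epsilon> k) (\<lambda>x. H x - \<phi> x) y\<bar> + ennreal \<delta> * indicator B y
          + ennreal \<bar>H y - \<phi> y\<bar>"
      proof (cases "y \<in> B")
        case True
        have "\<bar>mollify (\<epsilon> k) \<phi> y - \<phi> y\<bar> \<le> \<delta>"
        proof (rule mollify_near_continuous[OF e(1) \<phi>(2)])
          fix z assume z: "z \<in> cball y (\<epsilon> k)"
          have "y \<in> cball x0 R" using True R by auto
          moreover have "dist x0 z \<le> dist x0 y + dist y z" by (rule dist_triangle)
          ultimately have "z \<in> cball x0 (R + 1)" "y \<in> cball x0 (R + 1)" using z k by auto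
          moreover have "dist z y < d" using z k by (simp add: dist_commute)
          ultimately have "dist (\<phi> z) (\<phi> y) < \<delta>" using d(2) by blast
          then show "\<bar>\<phi> z - \<phi> y\<bar> \<le> \<delta>" by (simp add: dist_real_def)
        qed
        moreover have "mollify (\<epsilon> k) (\<lambda>x. H x - \<phi> x) y = mollify (\<epsilon> k) H y - mollify (\<epsilon> k) \<phi> y"
          unfolding mollify_def
          using integrable_mult_mollifier[OF e(1) H] integrable_mult_mollifier[OF e(1) \<phi>(2)]
          by (simp add: left_diff_distrib)
        ultimately have "\<bar>mollify (\<epsilon> k) H y - H y\<bar>
          \<le> \<bar>mollify (\<epsilon> k) (\<lambda>x. H x - \<phi> x) y\<bar> + \<delta> + \<bar>H y - \<phi> y\<bar>" by linarith
        then show ?thesis using True \<delta>(1)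
          by (simp add: ennreal_plus[symmetric] ennreal_leI del: ennreal_plus)
      qed simp
    qed
    also have "\<dots> = (\<integral>\<^sup>+y. ennreal \<bar>mollify (\<epsilon> k) (\<lambda>x. H x - \<phi> x) y\<bar> \<partial>lborel)
        + (\<integral>\<^sup>+y. ennreal \<delta> * indicator B y \<partial>lborel) + (\<integral>\<^sup>+y. ennreal \<bar>H y - \<phi> y\<bar> \<partial>lborel)"
    proof -
      have m: "(\<lambda>y. ennreal \<bar>mollify (\<epsilon> k) (\<lambda>x. H x - \<phi> x) y\<bar>) \<in> borel_measurable lborel"
        using mm[OF e(1)[of k] int] by simp
      have m': "(\<lambda>y. ennreal \<delta> * indicator B y) \<in> borel_measurable lborel"
        "(\<lambda>y. ennreal \<bar>H y - \<phi> y\<bar>) \<in> borel_measurable lborel" by measurable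
      show ?thesis
        by (simp only: nn_integral_add[OF borel_measurable_add[OF m m'(1)] m'(2)] nn_integral_add[OF m m'(1)])
    qed
    also have "\<dots> \<le> ennreal \<delta> + ennreal \<delta> * ennreal c + ennreal \<delta>"
      using nH Bfin order_trans[OF mollify_Young[OF e(1)[of k], of "\<lambda>x. H x - \<phi> x"] nH]
      by (intro add_mono) (auto simp: nn_integral_cmult)
    also have "\<dots> = ennreal (\<delta> + \<delta> * c + \<delta>)"
      using \<delta>(1) c by (simp add: ennreal_mult[symmetric] ennreal_plus[symmetric] del: ennreal_plus)
    also have "\<dots> \<le> ennreal a'" using \<delta>(2) by (rule ennreal_leI)
    finally show "(\<integral>\<^sup>+y\<in>B. ennreal \<bar>mollify (\<epsilon> k) H y - H y\<bar> \<partial>lborel) < a" using a'(2) by order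
  qed
qed simp

section \<open>Convergence in \<open>L\<^sup>1\<close>\<close>

text \<open>Lebesgue measure is complete, so the exact exceptional set is itself null. This connects
  the integration theory with the negligible sets of the statement.\<close>

lemma AE_lebesgue_on_iff:
  assumes "S \<in> sets lebesgue"
  shows "(AE x in lebesgue_on S. P x) \<longleftrightarrow> negligible {x \<in> S. \<not> P x}"
proof -
  have "(AE x in lebesgue_on S. P x) \<longleftrightarrow> (AE x in lebesgue. x \<in> S \<longrightarrow> P x)"
    using assms by (subst AE_restrict_space_iff) auto
  also have "\<dots> \<longleftrightarrow> negligible {x \<in> S. \<not> P x}"
  proof
    assume "AE x in lebesgue. x \<in> S \<longrightarrow> P x"
    then obtain N where "N \<in> null_sets lebesgue" "{x \<in> S. \<not> P x} \<subseteq> N"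
      by (rule AE_E3) auto
    then show "negligible {x \<in> S. \<not> P x}" by (metis negligible_iff_null_sets negligible_subset)
  next
    assume "negligible {x \<in> S. \<not> P x}"
    then show "AE x in lebesgue. x \<in> S \<longrightarrow> P x"
      unfolding negligible_iff_null_sets by (rule AE_I') auto
  qed
  finally show ?thesis .
qed

lemma integrable_lebesgue_on_iff:
  fixes f :: "'e::euclidean_space \<Rightarrow> real"
  assumes "S \<in> sets lebesgue"
  shows "integrable (lebesgue_on S) f \<longleftrightarrow> f absolutely_integrable_on S"
  using assms by (simp add: integrable_restrict_space set_integrable_def)

lemma integrable_lebesgue_on_negligible_cong:
  fixes f g :: "'e::euclidean_space \<Rightarrow> real"
  assumes "integrable (lebesgue_on S) f" "S \<in> sets lebesgue" "negligible {x \<in> S. f x \<noteq> g x}"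
  shows "integrable (lebesgue_on S) g"
  using assms(1) absolutely_integrable_spike[OF _ assms(3), where f=f and T=S and g=g]
  by (auto simp: integrable_lebesgue_on_iff[OF assms(2)])

lemma integral_lebesgue_on_subset:
  fixes f :: "'e::euclidean_space \<Rightarrow> real"
  assumes "S \<in> sets lebesgue" "T \<in> sets lebesgue" "S \<subseteq> T" "\<And>x. x \<in> T - S \<Longrightarrow> f x = 0"
  shows "(LINT x|lebesgue_on T. f x) = (LINT x|lebesgue_on S. f x)"
  using assms by (auto simp: integral_restrict_space indicator_def intro!: Bochner_Integration.integral_cong)

text \<open>Integrability is built in, since the integral of a non-integrable difference is 0 by
  convention and would make the limit meaningless.\<close>

definition L1_tendsto :: "'e::euclidean_space set \<Rightarrow> (nat \<Rightarrow> 'e \<Rightarrow> real) \<Rightarrow> ('e \<Rightarrow> real) \<Rightarrow> bool" where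
  "L1_tendsto B f F \<longleftrightarrow> (\<forall>k. integrable (lebesgue_on B) (f k)) \<and> integrable (lebesgue_on B) F \<and>
     (\<lambda>k. LINT y|lebesgue_on B. \<bar>f k y - F y\<bar>) \<longlonglongrightarrow> 0"

lemma L1_tendstoD:
  assumes "L1_tendsto B f F"
  shows "integrable (lebesgue_on B) (f k)" "integrable (lebesgue_on B) F"
    "(\<lambda>k. LINT y|lebesgue_on B. \<bar>f k y - F y\<bar>) \<longlonglongrightarrow> 0"
  using assms by (auto simp: L1_tendsto_def)

lemma L1_tendstoI_bound:
  assumes "\<And>k. integrable (lebesgue_on B) (f k)" "integrable (lebesgue_on B) F"
    and "\<And>k. (LINT y|lebesgue_on B. \<bar>f k y - F y\<bar>) \<le> a k" "a \<longlonglongrightarrow> 0"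
  shows "L1_tendsto B f F"
  unfolding L1_tendsto_def
proof (intro conjI allI assms)
  show "(\<lambda>k. LINT y|lebesgue_on B. \<bar>f k y - F y\<bar>) \<longlonglongrightarrow> 0"
    by (rule tendsto_sandwich[OF _ _ tendsto_const assms(4)])
      (auto intro!: always_eventually integral_nonneg_AE assms(3))
qed

text \<open>Mollification and changes of variables are estimated by nonnegative integrals;
  integrability turns these estimates into real limits.\<close>

lemma L1_tendstoI_nn:
  assumes "\<And>k. integrable (lebesgue_on B) (f k)" "integrable (lebesgue_on B) F"
    and "(\<lambda>k. \<integral>\<^sup>+y. ennreal \<bar>f k y - F y\<bar> \<partial>lebesgue_on B) \<longlonglongrightarrow> 0"
  shows "L1_tendsto B f F"
proof -
  have "(\<integral>\<^sup>+y. ennreal \<bar>f k y - F y\<bar> \<partial>lebesgue_on B) = ennreal (LINT y|lebesgue_on B. \<bar>f k y - F y\<bar>)" for k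
    using assms(1)[of k] assms(2) by (intro nn_integral_eq_integral) auto
  then have "(\<lambda>k. ennreal (LINT y|lebesgue_on B. \<bar>f k y - F y\<bar>)) \<longlonglongrightarrow> ennreal 0"
    using assms(3) by simp
  then have "(\<lambda>k. LINT y|lebesgue_on B. \<bar>f k y - F y\<bar>) \<longlonglongrightarrow> 0"
    by (subst (asm) tendsto_ennreal_iff) (auto intro!: always_eventually integral_nonneg_AE)
  then show ?thesis using assms by (simp add: L1_tendsto_def)
qed

lemma L1_tendsto_mult:
  assumes L: "L1_tendsto B f F" and q: "q \<in> borel_measurable (lebesgue_on B)" "\<And>y. y \<in> B \<Longrightarrow> \<bar>q y\<bar> \<le> C"
  shows "L1_tendsto B (\<lambda>k y. f k y * q y) (\<lambda>y. F y * q y)"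
proof (rule L1_tendstoI_bound)
  note i = L1_tendstoD[OF L]
  have sp: "\<bar>q y\<bar> \<le> C" if "y \<in> space (lebesgue_on B)" for y using q(2) that by simp
  show 1: "integrable (lebesgue_on B) (\<lambda>y. f k y * q y)" for k
    by (rule integrable_bounded_mult[OF i(1) q(1) sp])
  show 2: "integrable (lebesgue_on B) (\<lambda>y. F y * q y)"
    by (rule integrable_bounded_mult[OF i(2) q(1) sp])
  show "(LINT y|lebesgue_on B. \<bar>f k y * q y - F y * q y\<bar>) \<le> \<bar>C\<bar> * (LINT y|lebesgue_on B. \<bar>f k y - F y\<bar>)" for k
  proof -
    have "(LINT y|lebesgue_on B. \<bar>f k y * q y - F y * q y\<bar>) \<le> (LINT y|lebesgue_on B. \<bar>C\<bar> * \<bar>f k y - F y\<bar>)"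
    proof (rule integral_mono)
      fix y assume "y \<in> space (lebesgue_on B)"
      then have "\<bar>f k y - F y\<bar> * \<bar>q y\<bar> \<le> \<bar>f k y - F y\<bar> * \<bar>C\<bar>" using sp[of y] by (intro mult_left_mono) auto
      then show "\<bar>f k y * q y - F y * q y\<bar> \<le> \<bar>C\<bar> * \<bar>f k y - F y\<bar>"
        by (simp add: left_diff_distrib[symmetric] abs_mult mult.commute[of "\<bar>C\<bar>"])
    qed (use 1 2 i in auto)
    then show ?thesis by simp
  qed
  show "(\<lambda>k. \<bar>C\<bar> * (LINT y|lebesgue_on B. \<bar>f k y - F y\<bar>)) \<longlonglongrightarrow> 0"
    using tendsto_mult_right_zero[OF i(3)] by simp
qed

lemma L1_tendsto_add:
  assumes f: "L1_tendsto B f F" and g: "L1_tendsto B g G"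
  shows "L1_tendsto B (\<lambda>k y. f k y + g k y) (\<lambda>y. F y + G y)"
proof (rule L1_tendstoI_bound)
  note i = L1_tendstoD[OF f] and j = L1_tendstoD[OF g]
  show 1: "integrable (lebesgue_on B) (\<lambda>y. f k y + g k y)" for k using i j by simp
  show 2: "integrable (lebesgue_on B) (\<lambda>y. F y + G y)" using i j by simp
  show "(LINT y|lebesgue_on B. \<bar>(f k y + g k y) - (F y + G y)\<bar>)
    \<le> (LINT y|lebesgue_on B. \<bar>f k y - F y\<bar>) + (LINT y|lebesgue_on B. \<bar>g k y - G y\<bar>)" for k
  proof -
    have "(LINT y|lebesgue_on B. \<bar>(f k y + g k y) - (F y + G y)\<bar>)
      \<le> (LINT y|lebesgue_on B. \<bar>f k y - F y\<bar> + \<bar>g k y - G y\<bar>)"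
      using i j by (intro integral_mono) auto
    then show ?thesis using i j by simp
  qed
  show "(\<lambda>k. (LINT y|lebesgue_on B. \<bar>f k y - F y\<bar>) + (LINT y|lebesgue_on B. \<bar>g k y - G y\<bar>)) \<longlonglongrightarrow> 0"
    using tendsto_add[OF i(3) j(3)] by simp
qed

lemma L1_tendsto_zero: "L1_tendsto B (\<lambda>k y. 0) (\<lambda>y. 0)"
  by (simp add: L1_tendsto_def)

lemma L1_tendsto_sum:
  assumes "\<And>i. i \<in> I \<Longrightarrow> L1_tendsto B (f i) (F i)"
  shows "L1_tendsto B (\<lambda>k y. \<Sum>i\<in>I. f i k y) (\<lambda>y. \<Sum>i\<in>I. F i y)"
  using assms
proof (induction I rule: infinite_finite_induct)
  case (insert i I)
  then have "L1_tendsto B (\<lambda>k y. f i k y + (\<Sum>i\<in>I. f i k y)) (\<lambda>y. F i y + (\<Sum>i\<in>I. F i y))"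
    by (intro L1_tendsto_add) auto
  then show ?case using insert by simp
qed (auto simp: L1_tendsto_zero)

lemma L1_tendsto_integral:
  assumes L: "L1_tendsto B f F"
  shows "(\<lambda>k. LINT y|lebesgue_on B. f k y) \<longlonglongrightarrow> (LINT y|lebesgue_on B. F y)"
proof -
  note i = L1_tendstoD[OF L]
  have "(\<lambda>k. (LINT y|lebesgue_on B. f k y) - (LINT y|lebesgue_on B. F y)) \<longlonglongrightarrow> 0"
  proof (rule Lim_null_comparison[OF _ i(3)], intro always_eventually allI)
    fix k
    have "(LINT y|lebesgue_on B. f k y) - (LINT y|lebesgue_on B. F y) = (LINT y|lebesgue_on B. f k y - F y)"
      using i by simp
    also have "norm \<dots> \<le> (LINT y|lebesgue_on B. \<bar>f k y - F y\<bar>)"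
      using integral_norm_bound[of "lebesgue_on B" "\<lambda>y. f k y - F y"] by simp
    finally show "norm ((LINT y|lebesgue_on B. f k y) - (LINT y|lebesgue_on B. F y))
      \<le> (LINT y|lebesgue_on B. \<bar>f k y - F y\<bar>)" .
  qed
  then show ?thesis by (simp add: LIM_zero_iff)
qed

lemma L1_tendsto_subseq:
  assumes "L1_tendsto B f F" "strict_mono r"
  shows "L1_tendsto B (\<lambda>k. f (r k)) F"
  using assms LIMSEQ_subseq_LIMSEQ[OF L1_tendstoD(3)[OF assms(1)] assms(2)]
  by (auto simp: L1_tendsto_def o_def)

lemma L1_tendsto_unique:
  assumes F: "L1_tendsto B f F" and G: "L1_tendsto B f G" and B: "B \<in> sets lebesgue"
  shows "negligible {y \<in> B. F y \<noteq> G y}"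
proof -
  note i = L1_tendstoD[OF F] and j = L1_tendstoD[OF G]
  have int: "integrable (lebesgue_on B) (\<lambda>y. \<bar>F y - G y\<bar>)" using i j by simp
  have "(LINT y|lebesgue_on B. \<bar>F y - G y\<bar>)
    \<le> (LINT y|lebesgue_on B. \<bar>f k y - F y\<bar>) + (LINT y|lebesgue_on B. \<bar>f k y - G y\<bar>)" for k
  proof -
    have "(LINT y|lebesgue_on B. \<bar>F y - G y\<bar>) \<le> (LINT y|lebesgue_on B. \<bar>f k y - F y\<bar> + \<bar>f k y - G y\<bar>)"
      using i j by (intro integral_mono) auto
    then show ?thesis using i j by simp
  qed
  then have "(LINT y|lebesgue_on B. \<bar>F y - G y\<bar>) \<le> 0"
    using tendsto_lowerbound[OF tendsto_add[OF i(3) j(3)] always_eventually] by fastforce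
  moreover have "0 \<le> (LINT y|lebesgue_on B. \<bar>F y - G y\<bar>)" by (rule integral_nonneg_AE) simp
  ultimately have "(LINT y|lebesgue_on B. \<bar>F y - G y\<bar>) = 0" by linarith
  then have "AE y in lebesgue_on B. \<bar>F y - G y\<bar> = 0"
    using integral_nonneg_eq_0_iff_AE[OF int] by simp
  then have "AE y in lebesgue_on B. F y = G y" by (rule eventually_mono) simp
  then show ?thesis by (simp add: AE_lebesgue_on_iff[OF B])
qed

lemma L1_tendsto_cong:
  assumes L: "L1_tendsto B f F" and B: "B \<in> sets lebesgue" and N: "negligible {y \<in> B. F y \<noteq> G y}"
  shows "L1_tendsto B f G"
proof -
  note i = L1_tendstoD[OF L]
  have G: "integrable (lebesgue_on B) G"
    by (rule integrable_lebesgue_on_negligible_cong[OF i(2) B N])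
  have "AE y in lebesgue_on B. F y = G y" using N by (simp add: AE_lebesgue_on_iff[OF B])
  then have "(LINT y|lebesgue_on B. \<bar>f k y - G y\<bar>) = (LINT y|lebesgue_on B. \<bar>f k y - F y\<bar>)" for k
    using G i by (intro integral_cong_AE) (auto elim!: eventually_mono)
  then show ?thesis using i G by (simp add: L1_tendsto_def)
qed

lemma L1_tendsto_cong_seq:
  assumes "L1_tendsto B f F" "\<And>k y. y \<in> B \<Longrightarrow> f k y = g k y"
  shows "L1_tendsto B g F"
proof -
  have "integrable (lebesgue_on B) (g k) \<longleftrightarrow> integrable (lebesgue_on B) (f k)" for k
    using assms(2) by (intro Bochner_Integration.integrable_cong) auto
  moreover have "(LINT y|lebesgue_on B. \<bar>g k y - F y\<bar>) = (LINT y|lebesgue_on B. \<bar>f k y - F y\<bar>)" for k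
    using assms(2) by (intro Bochner_Integration.integral_cong) auto
  ultimately show ?thesis using assms(1) by (simp add: L1_tendsto_def)
qed

section \<open>Weak derivatives as limits of \<open>C\<^sup>1\<close> functions\<close>

text \<open>A single sequence serves \<open>h\<close> and all directions at once, so that
  compositions and products can be performed on genuine C1 functions.\<close>

definition C1_approximated ::
    "('e::euclidean_space \<Rightarrow> real) \<Rightarrow> ('e \<Rightarrow> 'e \<Rightarrow> real) \<Rightarrow> 'e set \<Rightarrow> bool" where
  "C1_approximated h h' B \<longleftrightarrow> (\<exists>g g'. (\<forall>k. has_C1_derivative_on (g k) (g' k) B) \<and>
     L1_tendsto B g h \<and> (\<forall>\<xi>. L1_tendsto B (\<lambda>k y. g' k y \<xi>) (\<lambda>y. h' y \<xi>)))"

section \<open>From weak derivatives to approximating sequences\<close>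

lemma has_weak_derivative_onD:
  assumes "has_weak_derivative_on h h' \<Omega>"
  shows "locally_integrable_on h \<Omega>" "y \<in> \<Omega> \<Longrightarrow> linear (h' y)" "locally_integrable_on (\<lambda>y. h' y \<xi>) \<Omega>"
    "\<eta> \<in> test_functions \<Omega> \<Longrightarrow> (LINT y:\<Omega>|lebesgue. h y * frechet_derivative \<eta> (at y) \<xi>)
          = - (LINT y:\<Omega>|lebesgue. h' y \<xi> * \<eta> y)"
  using assms by (auto simp: has_weak_derivative_on_def)

text \<open>Mollification is set up for \<open>lborel\<close>; a function that is only Lebesgue
  integrable on \<open>K\<close> is therefore extended by 0 and changed on a null set.\<close>

lemma absolutely_integrable_borel_version:
  fixes h :: "'e::euclidean_space \<Rightarrow> real"
  assumes "h absolutely_integrable_on K"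
  obtains H where "integrable lborel H" "AE z in lborel. indicator K z * h z = H z"
proof -
  have i: "integrable lebesgue (\<lambda>z. indicator K z * h z)"
    using assms by (simp add: set_integrable_def)
  then have "(\<lambda>z. indicator K z * h z) \<in> borel_measurable lebesgue" by auto
  then obtain H where H: "H \<in> borel_measurable lborel" "AE z in lborel. indicator K z * h z = H z"
    using completion_ex_borel_measurable_real by blast
  have "integrable lebesgue H"
    by (rule integrable_cong_AE_imp[OF i measurable_completion[OF H(1)] AE_completion])
      (use H(2) in \<open>auto elim!: eventually_mono\<close>)
  then have "integrable lborel H" using H(1) by (simp add: integrable_completion)
  then show ?thesis using that H(2) by blast
qed

lemma absolutely_integrable_continuous_compact:
  fixes f :: "'e::euclidean_space \<Rightarrow> real"
  assumes "compact K" "continuous_on K f"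
  shows "f absolutely_integrable_on K"
proof -
  have "integrable lborel (\<lambda>x. indicator K x *\<^sub>R f x)" by (rule borel_integrable_compact[OF assms])
  then show ?thesis unfolding set_integrable_def
    using integrable_completion borel_measurable_integrable by blast
qed

lemma mollify_eq_integral:
  assumes H: "AE z in lborel. indicator K z * h z = H z" "H \<in> borel_measurable lborel"
    and q: "q \<in> borel_measurable lborel" "\<And>z. z \<notin> K \<Longrightarrow> q z = 0" and K: "K \<subseteq> \<Omega>"
    and h: "h absolutely_integrable_on K"
  shows "(LINT z:\<Omega>|lebesgue. h z * q z) = (LINT z|lborel. H z * (q z :: real))"
proof -
  have "(LINT z:\<Omega>|lebesgue. h z * q z) = (LINT z|lebesgue. (indicator K z * h z) * q z)"
    unfolding set_lebesgue_integral_def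
    using q(2) K by (intro Bochner_Integration.integral_cong) (auto simp: indicator_def)
  also have "\<dots> = (LINT z|lebesgue. H z * q z)"
  proof (rule integral_cong_AE)
    show "(\<lambda>z. indicator K z * h z * q z) \<in> borel_measurable lebesgue"
      using h measurable_completion[OF q(1)] by (auto simp: set_integrable_def intro!: borel_measurable_times)
    show "(\<lambda>z. H z * q z) \<in> borel_measurable lebesgue"
      by (intro measurable_completion borel_measurable_times H q)
    show "AE z in lebesgue. indicator K z * h z * q z = H z * q z"
      using AE_completion[OF H(1)] by (rule eventually_mono) simp
  qed
  also have "\<dots> = (LINT z|lborel. H z * q z)"
    by (intro integral_completion borel_measurable_times H q)
  finally show ?thesis .
qed

text \<open>Differentiating the mollification of \<open>h\<close> puts the derivative on the
  mollifier, whose translates are test functions, so the weak identity turns it into the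
  mollification of \<open>h'\<close>. The sequences are chosen before \<open>h'\<close> and serve
  every weak derivative of \<open>h\<close>, which later yields uniqueness.\<close>

theorem weak_derivative_approximation:
  fixes h :: "'e::euclidean_space \<Rightarrow> real"
  assumes h: "locally_integrable_on h \<Omega>" and \<Omega>: "open \<Omega>" "cball x r \<subseteq> \<Omega>"
  obtains g g' where "\<And>k. has_C1_derivative_on (g k) (g' k) (ball x r)" "L1_tendsto (ball x r) g h"
    "\<And>h' \<xi>. has_weak_derivative_on h h' \<Omega> \<Longrightarrow> L1_tendsto (ball x r) (\<lambda>k y. g' k y \<xi>) (\<lambda>y. h' y \<xi>)"
proof -
  \<comment> \<open>The union \<open>K\<close> of these balls is a collar of width \<open>e\<close>:
    mollifiers of radius at most \<open>e\<close> centred in \<open>ball x r\<close> are supported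
    in \<open>K\<close>, hence in \<open>\<Omega>\<close>.\<close>
  obtain e where e: "e > 0" "(\<Union>y\<in>cball x r. cball y e) \<subseteq> \<Omega>"
    by (rule compact_subset_open_imp_cball_epsilon_subset[OF compact_cball \<Omega>])
  define K where "K = (\<Union>y\<in>cball x r. cball y e)"
  have K: "compact K" "K \<subseteq> \<Omega>" "\<And>y. y \<in> ball x r \<Longrightarrow> cball y e \<subseteq> K"
  proof -
    show "compact K" unfolding K_def by (rule compact_minkowski_sum_cball) simp
    show "K \<subseteq> \<Omega>" unfolding K_def by (rule e(2))
    show "cball y e \<subseteq> K" if "y \<in> ball x r" for y
      unfolding K_def using that by (intro UN_upper) auto
  qed
  define B where "B = ball x r"
  define \<epsilon> where "\<epsilon> k = e / Suc k" for k :: nat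
  have \<epsilon>: "\<epsilon> k > 0" "\<epsilon> k \<le> e" "\<epsilon> \<longlonglongrightarrow> 0" for k
  proof -
    show "\<epsilon> k > 0" "\<epsilon> k \<le> e" using e(1) by (simp_all add: \<epsilon>_def field_simps)
    show "\<epsilon> \<longlonglongrightarrow> 0" unfolding \<epsilon>_def
      using LIMSEQ_Suc[OF lim_const_over_n[of e]] by simp
  qed
  have Bl: "B \<in> sets lebesgue" "B \<in> sets borel" by (auto simp: B_def)
  have conv: "L1_tendsto B (\<lambda>k. mollify (\<epsilon> k) G) f"
    if f: "f absolutely_integrable_on K" and G: "integrable lborel G" "AE z in lborel. indicator K z * f z = G z" for f G
  proof (rule L1_tendstoI_nn)
    have BK: "B \<subseteq> K" using K(3) e(1) by (force simp: B_def)
    have "f absolutely_integrable_on B"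
      by (rule set_integrable_subset[OF f Bl(1) BK])
    then show fi: "integrable (lebesgue_on B) f" using Bl by (simp add: integrable_lebesgue_on_iff)
    have "mollify (\<epsilon> k) G absolutely_integrable_on cball x r" for k
      using continuous_on_subset[OF has_C1_derivative_onD(4)[OF mollify_C1[OF \<epsilon>(1) G(1)]]]
      by (intro absolutely_integrable_continuous_compact) auto
    then have "mollify (\<epsilon> k) G absolutely_integrable_on B" for k
      by (rule set_integrable_subset) (auto simp: B_def)
    then show "integrable (lebesgue_on B) (mollify (\<epsilon> k) G)" for k
      using Bl by (simp add: integrable_lebesgue_on_iff)
    have "(\<integral>\<^sup>+y. ennreal \<bar>mollify (\<epsilon> k) G y - f y\<bar> \<partial>lebesgue_on B)
        = (\<integral>\<^sup>+y\<in>B. ennreal \<bar>mollify (\<epsilon> k) G y - G y\<bar> \<partial>lborel)" for k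
    proof -
      have "(\<integral>\<^sup>+y. ennreal \<bar>mollify (\<epsilon> k) G y - f y\<bar> \<partial>lebesgue_on B)
        = (\<integral>\<^sup>+y\<in>B. ennreal \<bar>mollify (\<epsilon> k) G y - f y\<bar> \<partial>lborel)"
        using Bl by (simp add: nn_integral_restrict_space nn_integral_completion)
      also have "\<dots> = (\<integral>\<^sup>+y\<in>B. ennreal \<bar>mollify (\<epsilon> k) G y - G y\<bar> \<partial>lborel)"
        by (rule nn_integral_cong_AE, rule eventually_mono[OF G(2)]) (use BK in \<open>auto simp: indicator_def\<close>)
      finally show ?thesis .
    qed
    then show "(\<lambda>k. \<integral>\<^sup>+y. ennreal \<bar>mollify (\<epsilon> k) G y - f y\<bar> \<partial>lebesgue_on B) \<longlonglongrightarrow> 0"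
      using mollify_L1_tendsto[OF G(1) Bl(2) _ \<epsilon>(1,3)] by (simp add: B_def)
  qed
  have hK: "h absolutely_integrable_on K" using h K by (auto simp: locally_integrable_on_def)
  obtain H where H: "integrable lborel H" "AE z in lborel. indicator K z * h z = H z"
    by (rule absolutely_integrable_borel_version[OF hK])
  define D where "D k y \<xi> = (LINT z|lborel. H z * frechet_derivative (mollifier (\<epsilon> k)) (at (y - z)) \<xi>)" for k y \<xi>
  show ?thesis
  proof (rule that[of "\<lambda>k. mollify (\<epsilon> k) H" D])
    show "has_C1_derivative_on (mollify (\<epsilon> k) H) (D k) (ball x r)" for k
      unfolding D_def by (rule has_C1_derivative_on_subset[OF mollify_C1[OF \<epsilon>(1) H(1)]]) simp
    show "L1_tendsto (ball x r) (\<lambda>k. mollify (\<epsilon> k) H) h"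
      using conv[OF hK H] by (simp add: B_def)
    fix h' \<xi> assume w: "has_weak_derivative_on h h' \<Omega>"
    note wD = has_weak_derivative_onD[OF w]
    have h'K: "(\<lambda>y. h' y \<xi>) absolutely_integrable_on K"
      using wD(3) K by (auto simp: locally_integrable_on_def)
    obtain G where G: "integrable lborel G" "AE z in lborel. indicator K z * h' z \<xi> = G z"
      by (rule absolutely_integrable_borel_version[OF h'K])
    have "mollify (\<epsilon> k) G y = D k y \<xi>" if y: "y \<in> B" for k y
    proof -
      define \<eta> where "\<eta> z = mollifier (\<epsilon> k) (y - z)" for z
      define \<rho>' where "\<rho>' = (\<lambda>z. frechet_derivative (mollifier (\<epsilon> k)) (at (z::'e)))"
      have cb: "cball y (\<epsilon> k) \<subseteq> K" using K(3)[of y] y \<epsilon>(2)[of k] by (auto simp: B_def)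
      have \<eta>: "\<eta> \<in> test_functions \<Omega>"
        unfolding \<eta>_def by (rule mollifier_translate_test_function[OF \<epsilon>(1)]) (use cb K in auto)
      \<comment> \<open>The inner derivative -1 of \<open>y - z\<close> will cancel the minus sign
        of the weak identity.\<close>
      have \<eta>': "(\<eta> has_derivative (\<lambda>\<zeta>. \<rho>' (y - z) (- \<zeta>))) (at z)" for z
        unfolding \<eta>_def \<rho>'_def
        by (rule has_derivative_compose[OF _ has_C1_derivative_onD(1)[OF mollifier_C1 UNIV_I]])
          (auto intro!: derivative_eq_intros)
      have lin: "linear (\<rho>' z)" for z unfolding \<rho>'_def using has_C1_derivative_onD(3)[OF mollifier_C1] by blast
      have fr: "frechet_derivative \<eta> (at z) \<xi> = - \<rho>' (y - z) \<xi>" for z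
        using frechet_derivative_at[OF \<eta>'] lin linear_neg by metis
      have z0: "\<eta> z = 0" "\<rho>' (y - z) \<xi> = 0" if "z \<notin> K" for z
      proof -
        have "y - z \<notin> cball 0 (\<epsilon> k)" using that subsetD[OF cb, of z] by (auto simp: dist_norm norm_minus_commute)
        then show "\<eta> z = 0" "\<rho>' (y - z) \<xi> = 0"
          using mollifier_eq_0[OF \<epsilon>(1)] has_C1_derivative_on_vanishes_outside[OF mollifier_C1 closed_cball mollifier_eq_0[OF \<epsilon>(1)]]
          unfolding \<eta>_def \<rho>'_def by blast+
      qed
      have m: "\<eta> \<in> borel_measurable lborel" unfolding \<eta>_def by measurable
      have m': "(\<lambda>z. \<rho>' (y - z) \<xi>) \<in> borel_measurable lborel"
        unfolding \<rho>'_def by (rule measurable_compose[OF _ mollifier_frechet_measurable]) simp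
      have "mollify (\<epsilon> k) G y = (LINT z|lborel. G z * \<eta> z)" by (simp add: mollify_def \<eta>_def)
      also have "\<dots> = (LINT z:\<Omega>|lebesgue. h' z \<xi> * \<eta> z)"
        by (rule mollify_eq_integral[symmetric, OF G(2) _ m z0(1) K(2) h'K]) (use G in auto)
      also have "\<dots> = - (LINT z:\<Omega>|lebesgue. h z * frechet_derivative \<eta> (at z) \<xi>)"
        using wD(4)[OF \<eta>, of \<xi>] by simp
      also have "\<dots> = (LINT z:\<Omega>|lebesgue. h z * \<rho>' (y - z) \<xi>)"
        by (simp add: fr set_lebesgue_integral_def)
      also have "\<dots> = (LINT z|lborel. H z * \<rho>' (y - z) \<xi>)"
        by (rule mollify_eq_integral[OF H(2) _ m' z0(2) K(2) hK]) (use H in auto)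
      finally show ?thesis by (simp add: D_def \<rho>'_def)
    qed
    then show "L1_tendsto (ball x r) (\<lambda>k y. D k y \<xi>) (\<lambda>y. h' y \<xi>)"
      using L1_tendsto_cong_seq[OF conv[OF h'K G]] by (simp add: B_def)
  qed
qed

lemma has_weak_derivative_imp_C1_approximated:
  assumes "has_weak_derivative_on h h' \<Omega>" "open \<Omega>" "cball x r \<subseteq> \<Omega>"
  shows "C1_approximated h h' (ball x r)"
  using weak_derivative_approximation[OF has_weak_derivative_onD(1)[OF assms(1)] assms(2,3)] assms(1)
  unfolding C1_approximated_def by metis

lemma negligible_if_locally_negligible:
  assumes "\<And>x. x \<in> S \<Longrightarrow> \<exists>U. open U \<and> x \<in> U \<and> negligible (S \<inter> U)"
  shows "negligible S"
  unfolding locally_negligible_alt[of S] using assms by (meson IntI openin_open_Int)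

text \<open>On small balls both derivatives are L1 limits of one and the same sequence.\<close>

lemma has_weak_derivative_on_unique:
  fixes h :: "'e::euclidean_space \<Rightarrow> real"
  assumes w: "has_weak_derivative_on h h' \<Omega>" "has_weak_derivative_on h h'' \<Omega>" and \<Omega>: "open \<Omega>"
  shows "negligible {y \<in> \<Omega>. \<exists>\<xi>. h' y \<xi> \<noteq> h'' y \<xi>}"
proof (rule negligible_if_locally_negligible)
  fix x assume "x \<in> {y \<in> \<Omega>. \<exists>\<xi>. h' y \<xi> \<noteq> h'' y \<xi>}"
  then obtain r where r: "r > 0" "cball x r \<subseteq> \<Omega>" using \<Omega> open_contains_cball_eq by blast
  obtain g g' where "\<And>k. has_C1_derivative_on (g k) (g' k) (ball x r)" "L1_tendsto (ball x r) g h"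
    and g': "\<And>h' \<xi>. has_weak_derivative_on h h' \<Omega> \<Longrightarrow> L1_tendsto (ball x r) (\<lambda>k y. g' k y \<xi>) (\<lambda>y. h' y \<xi>)"
    using weak_derivative_approximation[OF has_weak_derivative_onD(1)[OF w(1)] \<Omega> r(2)] by metis
  have N: "negligible {y \<in> ball x r. h' y b \<noteq> h'' y b}" for b
    by (rule L1_tendsto_unique[OF g'[OF w(1)] g'[OF w(2)]]) auto
  \<comment> \<open>By linearity a discrepancy in some direction already shows in a basis direction,
    so the union over all \<open>\<xi>\<close> reduces to a finite one.\<close>
  have "negligible (\<Union>b\<in>Basis. {y \<in> ball x r. h' y b \<noteq> h'' y b})"
    by (intro negligible_Union finite_imageI) (use N in auto)
  moreover have "{y \<in> \<Omega>. \<exists>\<xi>. h' y \<xi> \<noteq> h'' y \<xi>} \<inter> ball x r \<subseteq> (\<Union>b\<in>Basis. {y \<in> ball x r. h' y b \<noteq> h'' y b})"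
  proof clarify
    fix y \<xi> assume y: "y \<in> \<Omega>" "y \<in> ball x r" "h' y \<xi> \<noteq> h'' y \<xi>"
    then have "h' y \<xi> = (\<Sum>b\<in>Basis. (\<xi> \<bullet> b) *\<^sub>R h' y b)" "h'' y \<xi> = (\<Sum>b\<in>Basis. (\<xi> \<bullet> b) *\<^sub>R h'' y b)"
      using linear_euclidean_expansion has_weak_derivative_onD(2) w by blast+
    then have "\<exists>b\<in>Basis. h' y b \<noteq> h'' y b" using y(3) by (metis (no_types, lifting) sum.cong)
    then show "y \<in> (\<Union>b\<in>Basis. {y \<in> ball x r. h' y b \<noteq> h'' y b})" using y by auto
  qed
  ultimately have "negligible ({y \<in> \<Omega>. \<exists>\<xi>. h' y \<xi> \<noteq> h'' y \<xi>} \<inter> ball x r)"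
    by (rule negligible_subset)
  then show "\<exists>U. open U \<and> x \<in> U \<and> negligible ({y \<in> \<Omega>. \<exists>\<xi>. h' y \<xi> \<noteq> h'' y \<xi>} \<inter> U)"
    using r(1) by (intro exI[of _ "ball x r"]) auto
qed

section \<open>Integration by parts for approximable functions\<close>

lemma integral_C1_derivative_eq_0:
  fixes w :: "'e::euclidean_space \<Rightarrow> real"
  assumes w: "has_C1_derivative_on w w' UNIV" and K: "compact K" "\<And>x. x \<notin> K \<Longrightarrow> w x = 0"
  shows "(LINT y|lebesgue. w' y \<xi>) = 0"
proof -
  obtain C where C: "C > 0" "\<And>x. norm (w x) \<le> C" "\<And>x y. norm (w x - w y) \<le> C * norm (x - y)"
    using has_C1_derivative_on_compact_support_bounded[OF w K] by metis
  obtain R where R: "\<And>x. x \<in> K \<Longrightarrow> norm x \<le> R" using compact_imp_bounded[OF K(1)] by (auto simp: bounded_iff)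
  define t where "t n = inverse (real (Suc n))" for n
  have t: "0 < t n" "t n \<le> 1" "t \<longlonglongrightarrow> 0" for n
    unfolding t_def using LIMSEQ_inverse_real_of_nat by (simp_all add: field_simps)
  have [measurable]: "w \<in> borel_measurable borel" "(\<lambda>y. w' y \<xi>) \<in> borel_measurable borel"
    using has_C1_derivative_onD(2,4)[OF w] by (auto intro: borel_measurable_continuous_onI)
  have "integrable lborel (\<lambda>x. indicator K x *\<^sub>R w x)"
    by (rule borel_integrable_compact[OF K(1)]) (use has_C1_derivative_onD(4)[OF w] continuous_on_subset in auto)
  moreover have "(\<lambda>x. indicator K x *\<^sub>R w x) = w" using K(2) by (auto simp: indicator_def fun_eq_iff)
  ultimately have iw: "integrable lborel w" by simp
  have tr: "integrable lborel (\<lambda>y. w (a + y))" "(LINT y|lborel. w (a + y)) = (LINT y|lborel. w y)" for a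
  proof -
    have "integrable (distr lborel borel ((+) a)) w" using iw by (simp add: lborel_distr_plus)
    then show "integrable lborel (\<lambda>y. w (a + y))" by (subst (asm) integrable_distr_eq) auto
    have "(LINT y|lborel. w y) = integral\<^sup>L (distr lborel borel ((+) a)) w" by (simp add: lborel_distr_plus)
    also have "\<dots> = (LINT y|lborel. w (a + y))" by (subst integral_distr) auto
    finally show "(LINT y|lborel. w (a + y)) = (LINT y|lborel. w y)" by simp
  qed
  \<comment> \<open>By translation invariance every difference quotient has integral 0, and the
    quotients converge to the directional derivative.\<close>
  define q where "q n y = (w (t n *\<^sub>R \<xi> + y) - w y) / t n" for n y
  have "(\<lambda>n. LINT y|lborel. q n y) \<longlonglongrightarrow> (LINT y|lborel. w' y \<xi>)"
  proof (rule integral_dominated_convergence)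
    \<comment> \<open>Since \<open>t n \<le> 1\<close>, a point beyond radius
      \<open>R + norm \<xi>\<close> is outside \<open>K\<close> before and after the shift, so all
      quotients are supported in one ball.\<close>
    show "integrable lborel (\<lambda>y::'e. C * norm \<xi> * indicator (cball 0 (R + norm \<xi>)) y)"
      using emeasure_bounded_finite[of "cball (0::'e) (R + norm \<xi>)"]
      by (intro integrable_mult_right integrable_real_indicator) auto
    show "AE y in lborel. (\<lambda>n. q n y) \<longlonglongrightarrow> w' y \<xi>"
    proof (intro AE_I2)
      fix y
      have lin: "linear (w' y)" using has_C1_derivative_onD(3)[OF w] by simp
      have "(w has_derivative w' y) (at (0 *\<^sub>R \<xi> + y))" using has_C1_derivative_onD(1)[OF w] by simp
      then have "((\<lambda>s. w (s *\<^sub>R \<xi> + y)) has_derivative (\<lambda>s. w' y (s *\<^sub>R \<xi>))) (at 0)"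
        by (rule has_derivative_compose[rotated]) (auto intro!: derivative_eq_intros)
      then have "((\<lambda>s. w (s *\<^sub>R \<xi> + y)) has_real_derivative w' y \<xi>) (at 0)"
        by (simp add: has_field_derivative_def linear_scale[OF lin] mult.commute[of _ "w' y \<xi>"])
      then have "((\<lambda>s. (w (s *\<^sub>R \<xi> + y) - w y) / s) \<longlongrightarrow> w' y \<xi>) (at 0)"
        by (simp add: DERIV_def)
      then show "(\<lambda>n. q n y) \<longlonglongrightarrow> w' y \<xi>"
        unfolding tendsto_at_iff_sequentially q_def
        using t(3) less_imp_neq[OF t(1), THEN not_sym] by (auto simp: o_def elim!: allE[of _ t])
    qed
    show "AE y in lborel. norm (q n y) \<le> C * norm \<xi> * indicator (cball 0 (R + norm \<xi>)) y" for n
    proof (intro AE_I2)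
      fix y
      show "norm (q n y) \<le> C * norm \<xi> * indicator (cball 0 (R + norm \<xi>)) y"
      proof (cases "y \<in> cball 0 (R + norm \<xi>)")
        case True
        have "\<bar>w (t n *\<^sub>R \<xi> + y) - w y\<bar> \<le> C * norm \<xi> * t n"
          using C(3)[of "t n *\<^sub>R \<xi> + y" y] t(1)[of n] by (simp add: mult_ac)
        then show ?thesis using True t(1)[of n] by (simp add: q_def divide_le_eq)
      next
        case False
        then have y: "norm y > R + norm \<xi>" by simp
        have "norm (t n *\<^sub>R \<xi>) \<le> norm \<xi>" using t(1,2)[of n] mult_right_mono[of "t n" 1 "norm \<xi>"] by simp
        then have "norm (t n *\<^sub>R \<xi> + y) > R" using y norm_triangle_ineq2[of y "- (t n *\<^sub>R \<xi>)"] by (simp add: add.commute)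
        then have "w (t n *\<^sub>R \<xi> + y) = 0" by (metis K(2) R not_less)
        moreover have "w y = 0"
        proof (rule K(2), rule notI)
          assume "y \<in> K"
          from R[OF this] y norm_ge_zero[of \<xi>] show False by linarith
        qed
        ultimately show ?thesis using C(1) by (simp add: q_def)
      qed
    qed
  qed (auto simp: q_def)
  moreover have "(LINT y|lborel. q n y) = 0" for n
    unfolding q_def using tr[of "t n *\<^sub>R \<xi>"] iw by simp
  ultimately have "(LINT y|lborel. w' y \<xi>) = 0" by (simp add: LIMSEQ_const_iff)
  then show ?thesis by (subst integral_completion) auto
qed

lemma test_functions_support:
  assumes "\<eta> \<in> test_functions \<Omega>"
  obtains K where "compact K" "K \<subseteq> \<Omega>" "\<And>x. x \<notin> K \<Longrightarrow> \<eta> x = 0"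
  using assms closure_subset[of "{y. \<eta> y \<noteq> 0}"]
  by (intro that[of "closure {y. \<eta> y \<noteq> 0}"]) (auto simp: test_functions_def)

lemma test_functions_C1:
  "\<eta> \<in> test_functions \<Omega> \<Longrightarrow> has_C1_derivative_on \<eta> (\<lambda>x. frechet_derivative \<eta> (at x)) UNIV"
  unfolding Ck_on_1_iff[symmetric] by (simp only: test_functions_def mem_Collect_eq)

lemma C1_function_lebesgue_measurable:
  assumes "has_C1_derivative_on \<eta> \<eta>' UNIV" "S \<in> sets lebesgue"
  shows "\<eta> \<in> borel_measurable (lebesgue_on S)" "(\<lambda>y. \<eta>' y \<xi>) \<in> borel_measurable (lebesgue_on S)"
  using has_C1_derivative_onD(2,4)[OF assms(1)] assms(2)
  by (auto intro!: continuous_imp_measurable_on_sets_lebesgue intro: continuous_on_subset)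

text \<open>For the approximating functions the integrand is the derivative of a compactly supported
  C1 product; boundedness of \<open>\<eta>\<close> and of its derivative lets the identity pass to
  the L1 limit. Class C1 is allowed for \<open>\<eta>\<close> because test functions will be
  multiplied by C1 bumps.\<close>

lemma C1_approximated_integration_by_parts:
  assumes h: "C1_approximated h h' B" and B: "open B"
    and \<eta>: "has_C1_derivative_on \<eta> \<eta>' UNIV" and K: "compact K" "K \<subseteq> B" "\<And>x. x \<notin> K \<Longrightarrow> \<eta> x = 0"
  shows "(LINT y|lebesgue_on B. h y * \<eta>' y \<xi> + h' y \<xi> * \<eta> y) = 0"
proof -
  obtain g g' where g: "\<And>k. has_C1_derivative_on (g k) (g' k) B" "L1_tendsto B g h"
    "\<And>\<xi>. L1_tendsto B (\<lambda>k y. g' k y \<xi>) (\<lambda>y. h' y \<xi>)"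
    using h unfolding C1_approximated_def by metis
  have Bl: "B \<in> sets lebesgue" using B by (simp add: borel_open)
  obtain C where C: "\<And>x. norm (\<eta> x) \<le> C" "\<And>x \<xi>. norm (\<eta>' x \<xi>) \<le> C * norm \<xi>"
    using has_C1_derivative_on_compact_support_bounded[OF \<eta> K(1,3)] by metis
  note m = C1_function_lebesgue_measurable[OF \<eta> Bl]
  have "L1_tendsto B (\<lambda>k y. g k y * \<eta>' y \<xi> + g' k y \<xi> * \<eta> y) (\<lambda>y. h y * \<eta>' y \<xi> + h' y \<xi> * \<eta> y)"
    by (intro L1_tendsto_add L1_tendsto_mult[OF g(2) m(2)[of \<xi>], of "C * norm \<xi>"] L1_tendsto_mult[OF g(3) m(1), of C])
      (use C in auto)
  then have "(\<lambda>k. LINT y|lebesgue_on B. g k y * \<eta>' y \<xi> + g' k y \<xi> * \<eta> y)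
    \<longlonglongrightarrow> (LINT y|lebesgue_on B. h y * \<eta>' y \<xi> + h' y \<xi> * \<eta> y)"
    by (rule L1_tendsto_integral)
  moreover have "(LINT y|lebesgue_on B. g k y * \<eta>' y \<xi> + g' k y \<xi> * \<eta> y) = 0" for k
  proof -
    \<comment> \<open>The product of \<open>g k\<close> and \<open>\<eta>\<close> lives on
      \<open>B\<close>; extended by 0 it is C1 on the whole space, as \<open>\<eta>\<close> vanishes
      outside the compact \<open>K\<close> inside \<open>B\<close>.\<close>
    have "(LINT y|lebesgue. (if y \<in> B then g k y * \<eta>' y \<xi> + g' k y \<xi> * \<eta> y else 0)) = 0"
      by (rule integral_C1_derivative_eq_0[OF has_C1_derivative_on_cutoff[OF g(1) B \<eta> compact_imp_closed[OF K(1)] K(2,3)] K(1)])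
        (use K in auto)
    moreover have "(LINT y|lebesgue_on B. g k y * \<eta>' y \<xi> + g' k y \<xi> * \<eta> y)
      = (LINT y|lebesgue. (if y \<in> B then g k y * \<eta>' y \<xi> + g' k y \<xi> * \<eta> y else 0))"
      using Bl by (auto simp: integral_restrict_space intro!: Bochner_Integration.integral_cong)
    ultimately show ?thesis by simp
  qed
  ultimately show ?thesis by (simp add: LIMSEQ_const_iff)
qed

lemma locally_integrable_onI:
  fixes f :: "'e::euclidean_space \<Rightarrow> real"
  assumes "\<And>x. x \<in> \<Omega> \<Longrightarrow> \<exists>B. open B \<and> x \<in> B \<and> f absolutely_integrable_on B"
  shows "locally_integrable_on f \<Omega>"
  unfolding locally_integrable_on_def
proof (intro allI impI)
  fix K assume K: "compact K \<and> K \<subseteq> \<Omega>"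
  have "\<forall>x\<in>\<Omega>. \<exists>B. open B \<and> x \<in> B \<and> f absolutely_integrable_on B" using assms by blast
  from bchoice[OF this] obtain B where B: "\<And>x. x \<in> \<Omega> \<Longrightarrow> open (B x) \<and> x \<in> B x \<and> f absolutely_integrable_on (B x)"
    by blast
  obtain F where F: "F \<subseteq> K" "finite F" "K \<subseteq> (\<Union>x\<in>F. B x)"
    by (rule compactE_image[of K K B]) (use K B in blast)+
  have "f absolutely_integrable_on (\<Union>x\<in>F. B x)"
    by (rule set_integrable_UN[OF F(2)]) (use B F K in \<open>auto intro!: borel_open[THEN sets_completionI_sets] simp: subset_iff\<close>)
  then show "f absolutely_integrable_on K"
    by (rule set_integrable_subset) (use K F in \<open>auto intro: lmeasurable_compact fmeasurableD\<close>)
qed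

lemma locally_integrable_times_compact_support:
  fixes h :: "'e::euclidean_space \<Rightarrow> real"
  assumes h: "locally_integrable_on h \<Omega>" and \<Omega>: "open \<Omega>" and K: "compact K" "K \<subseteq> \<Omega>" "\<And>x. x \<notin> K \<Longrightarrow> q x = 0"
    and q: "q \<in> borel_measurable (lebesgue_on UNIV)" "\<And>x. \<bar>q x\<bar> \<le> C"
  shows "integrable (lebesgue_on \<Omega>) (\<lambda>x. h x * q x)"
proof -
  have Kl: "K \<in> sets lebesgue" and \<Omega>l: "\<Omega> \<in> sets lebesgue"
    using K(1) \<Omega> by (auto intro: lmeasurable_compact fmeasurableD simp: borel_open)
  have i: "integrable lebesgue (\<lambda>x. indicator K x * h x)"
    using h K by (simp add: locally_integrable_on_def set_integrable_def)
  have "integrable lebesgue (\<lambda>x. (indicator K x * h x) * q x)"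
    by (rule integrable_bounded_mult[OF i, of _ C]) (use q in \<open>auto simp: lebesgue_on_UNIV_eq\<close>)
  moreover have "(\<lambda>x. (indicator K x * h x) * q x) = (\<lambda>x. indicator \<Omega> x *\<^sub>R (h x * q x))"
    using K(2,3) by (auto simp: indicator_def fun_eq_iff)
  ultimately show ?thesis using \<Omega>l by (simp add: integrable_restrict_space)
qed

lemma weak_identity_integrable:
  fixes h :: "'e::euclidean_space \<Rightarrow> real"
  assumes h: "locally_integrable_on h \<Omega>" "locally_integrable_on (\<lambda>y. h' y \<xi>) \<Omega>" and \<Omega>: "open \<Omega>"
    and \<eta>: "has_C1_derivative_on \<eta> \<eta>' UNIV" and K: "compact K" "K \<subseteq> \<Omega>" "\<And>x. x \<notin> K \<Longrightarrow> \<eta> x = 0"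
  shows "integrable (lebesgue_on \<Omega>) (\<lambda>y. h y * \<eta>' y \<xi>)" "integrable (lebesgue_on \<Omega>) (\<lambda>y. h' y \<xi> * \<eta> y)"
proof -
  obtain C where C: "\<And>x. norm (\<eta> x) \<le> C" "\<And>x \<xi>. norm (\<eta>' x \<xi>) \<le> C * norm \<xi>"
    using has_C1_derivative_on_compact_support_bounded[OF \<eta> K(1,3)] by metis
  have m: "\<eta> \<in> borel_measurable (lebesgue_on UNIV)" "(\<lambda>y. \<eta>' y \<xi>) \<in> borel_measurable (lebesgue_on UNIV)"
    using C1_function_lebesgue_measurable[OF \<eta>] by auto
  have z: "\<eta>' x \<xi> = 0" if "x \<notin> K" for x
    by (rule has_C1_derivative_on_vanishes_outside[OF \<eta> compact_imp_closed[OF K(1)] K(3) that])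
  show "integrable (lebesgue_on \<Omega>) (\<lambda>y. h y * \<eta>' y \<xi>)"
    by (rule locally_integrable_times_compact_support[OF h(1) \<Omega> K(1,2) z m(2), of "C * norm \<xi>"]) (use C in auto)
  show "integrable (lebesgue_on \<Omega>) (\<lambda>y. h' y \<xi> * \<eta> y)"
    by (rule locally_integrable_times_compact_support[OF h(2) \<Omega> K m(1), of C]) (use C in auto)
qed

text \<open>The test function is split by the cutoffs \<open>\<beta>\<close>, \<open>1 - \<beta>\<close> of the balls of a finite cover of its support,
  one ball at a time.\<close>

lemma C1_approximated_weak_identity:
  fixes h :: "'e::euclidean_space \<Rightarrow> real"
  assumes h: "locally_integrable_on h \<Omega>" "\<And>\<xi>. locally_integrable_on (\<lambda>y. h' y \<xi>) \<Omega>" and \<Omega>: "open \<Omega>"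
    and "finite F"
    and "\<And>p. p \<in> F \<Longrightarrow> snd p > 0 \<and> ball (fst p) (snd p) \<subseteq> \<Omega> \<and> C1_approximated h h' (ball (fst p) (snd p))"
    and "has_C1_derivative_on \<eta> \<eta>' UNIV" "compact K" "K \<subseteq> \<Omega>" "\<And>x. x \<notin> K \<Longrightarrow> \<eta> x = 0"
    and "K \<subseteq> (\<Union>p\<in>F. ball (fst p) (snd p / 2))"
  shows "(LINT y|lebesgue_on \<Omega>. h y * \<eta>' y \<xi> + h' y \<xi> * \<eta> y) = 0"
  using assms(4-)
\<comment> \<open>The induction runs over C1 functions, since multiplication by the C1 bump leaves
  the smooth class.\<close>
proof (induction F arbitrary: \<eta> \<eta>' K rule: finite_induct)
  case empty
  then have "\<eta> x = 0" "\<eta>' x \<xi> = 0" for x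
    using has_C1_derivative_on_vanishes_outside[OF empty(2), of "{}"] by auto
  then show ?case by simp
next
  case (insert p F)
  obtain a r where p: "p = (a, r)" by (cases p)
  have r: "r > 0" "ball a r \<subseteq> \<Omega>" "C1_approximated h h' (ball a r)"
    using insert.prems(1)[of p] p by auto
  note \<eta> = insert.prems(2) and K = insert.prems(3-5)
  have \<Omega>l: "\<Omega> \<in> sets lebesgue" using \<Omega> by (simp add: borel_open)
  obtain \<beta> \<beta>' where \<beta>: "has_C1_derivative_on \<beta> \<beta>' UNIV" "\<And>x. x \<in> ball a (r / 2) \<Longrightarrow> \<beta> x = 1"
    "\<And>x. x \<notin> cball a (3 / 4 * r) \<Longrightarrow> \<beta> x = (0::real)"
    by (rule C1_bump_exists[OF r(1), of a]) blast
  define \<eta>1 where "\<eta>1 x = \<eta> x * \<beta> x" for x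
  define \<eta>1' where "\<eta>1' x \<xi> = \<eta> x * \<beta>' x \<xi> + \<eta>' x \<xi> * \<beta> x" for x \<xi>
  have \<eta>1: "has_C1_derivative_on \<eta>1 \<eta>1' UNIV"
    unfolding \<eta>1_def \<eta>1'_def by (rule has_C1_derivative_on_mult[OF \<eta> \<beta>(1)])
  have \<eta>2: "has_C1_derivative_on (\<lambda>x. \<eta> x - \<eta>1 x) (\<lambda>x \<xi>. \<eta>' x \<xi> - \<eta>1' x \<xi>) UNIV"
    by (rule has_C1_derivative_on_diff[OF \<eta> \<eta>1])
  have K1: "compact (K \<inter> cball a (3 / 4 * r))" "K \<inter> cball a (3 / 4 * r) \<subseteq> ball a r"
    "\<And>x. x \<notin> K \<inter> cball a (3 / 4 * r) \<Longrightarrow> \<eta>1 x = 0"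
    using K(1,3) \<beta>(3) r(1) by (auto simp: compact_Int_closed \<eta>1_def)
  have "(LINT y|lebesgue_on \<Omega>. h y * \<eta>1' y \<xi> + h' y \<xi> * \<eta>1 y)
      = (LINT y|lebesgue_on (ball a r). h y * \<eta>1' y \<xi> + h' y \<xi> * \<eta>1 y)"
  proof (rule integral_lebesgue_on_subset[OF _ \<Omega>l r(2)])
    fix y assume "y \<in> \<Omega> - ball a r"
    then have "y \<notin> K \<inter> cball a (3 / 4 * r)" using K1(2) by blast
    then show "h y * \<eta>1' y \<xi> + h' y \<xi> * \<eta>1 y = 0"
      using K1(3) has_C1_derivative_on_vanishes_outside[OF \<eta>1 compact_imp_closed[OF K1(1)] K1(3)] by simp
  qed simp
  also have "\<dots> = 0" by (rule C1_approximated_integration_by_parts[OF r(3) open_ball \<eta>1 K1])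
  finally have 1: "(LINT y|lebesgue_on \<Omega>. h y * \<eta>1' y \<xi> + h' y \<xi> * \<eta>1 y) = 0" .
  \<comment> \<open>On the half ball \<open>\<beta> = 1\<close>, so the remainder
    \<open>\<eta> - \<eta>1\<close> is supported in the part of \<open>K\<close> that the other half
    balls cover.\<close>
  have K2: "compact (K - ball a (r / 2))" "K - ball a (r / 2) \<subseteq> \<Omega>"
    "\<And>x. x \<notin> K - ball a (r / 2) \<Longrightarrow> \<eta> x - \<eta>1 x = 0"
    using K \<beta>(2) by (auto simp: compact_diff \<eta>1_def)
  have 2: "(LINT y|lebesgue_on \<Omega>. h y * (\<eta>' y \<xi> - \<eta>1' y \<xi>) + h' y \<xi> * (\<eta> y - \<eta>1 y)) = 0"
    by (rule insert.IH[OF _ \<eta>2 K2]) (use insert.prems(1,6) p in auto)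
  have K1': "K \<inter> cball a (3 / 4 * r) \<subseteq> \<Omega>" using K(2) by auto
  note i1 = weak_identity_integrable[where h'=h' and \<xi>=\<xi>, OF h(1) h(2)[of \<xi>] \<Omega> \<eta>1 K1(1) K1' K1(3)]
  note i2 = weak_identity_integrable[where h'=h' and \<xi>=\<xi>, OF h(1) h(2)[of \<xi>] \<Omega> \<eta>2 K2]
  have "(LINT y|lebesgue_on \<Omega>. h y * \<eta>' y \<xi> + h' y \<xi> * \<eta> y) =
    (LINT y|lebesgue_on \<Omega>. (h y * \<eta>1' y \<xi> + h' y \<xi> * \<eta>1 y)
      + (h y * (\<eta>' y \<xi> - \<eta>1' y \<xi>) + h' y \<xi> * (\<eta> y - \<eta>1 y)))"
    by (intro Bochner_Integration.integral_cong) (auto simp: algebra_simps)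
  also have "\<dots> = 0"
    using 1 2 Bochner_Integration.integral_add[OF Bochner_Integration.integrable_add[OF i1] Bochner_Integration.integrable_add[OF i2]]
    by simp
  finally show ?case .
qed

text \<open>Approximations near each point suffice, and those on different balls may be unrelated,
  because the weak identity involves \<open>h\<close> and \<open>h'\<close> alone. The chain rule,
  the change of charts and the gluing all rest on this criterion.\<close>

theorem has_weak_derivative_onI_C1_approximated:
  fixes h :: "'e::euclidean_space \<Rightarrow> real"
  assumes \<Omega>: "open \<Omega>" and lin: "\<And>y. y \<in> \<Omega> \<Longrightarrow> linear (h' y)"
    and app: "\<And>x. x \<in> \<Omega> \<Longrightarrow> \<exists>r>0. ball x r \<subseteq> \<Omega> \<and> C1_approximated h h' (ball x r)"
  shows "has_weak_derivative_on h h' \<Omega>"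
proof -
  have ai: "h absolutely_integrable_on (ball x r)" "(\<lambda>y. h' y \<xi>) absolutely_integrable_on (ball x r)"
    if "C1_approximated h h' (ball x r)" for x r \<xi>
    using that unfolding C1_approximated_def L1_tendsto_def by (auto simp: integrable_lebesgue_on_iff)
  have h: "locally_integrable_on h \<Omega>" "locally_integrable_on (\<lambda>y. h' y \<xi>) \<Omega>" for \<xi>
    using app ai by (intro locally_integrable_onI; meson centre_in_ball open_ball)+
  have \<Omega>l: "\<Omega> \<in> sets lebesgue" using \<Omega> by (simp add: borel_open)
  have "(LINT y:\<Omega>|lebesgue. h y * frechet_derivative \<eta> (at y) \<xi>) = - (LINT y:\<Omega>|lebesgue. h' y \<xi> * \<eta> y)"
    if \<eta>: "\<eta> \<in> test_functions \<Omega>" for \<eta> \<xi>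
  proof -
    obtain K where K: "compact K" "K \<subseteq> \<Omega>" "\<And>x. x \<notin> K \<Longrightarrow> \<eta> x = 0"
      by (rule test_functions_support[OF \<eta>]) blast
    have \<eta>1: "has_C1_derivative_on \<eta> (\<lambda>x. frechet_derivative \<eta> (at x)) UNIV"
      by (rule test_functions_C1[OF \<eta>])
    have "\<forall>x\<in>\<Omega>. \<exists>r>0. ball x r \<subseteq> \<Omega> \<and> C1_approximated h h' (ball x r)" using app by blast
    from bchoice[OF this] obtain r where r: "\<And>x. x \<in> \<Omega> \<Longrightarrow> r x > 0 \<and> ball x (r x) \<subseteq> \<Omega> \<and> C1_approximated h h' (ball x (r x))"
      by blast
    \<comment> \<open>Half radii, because the bump of a ball is known to equal 1 on the concentric
      ball of half the radius.\<close>
    obtain F where F: "F \<subseteq> K" "finite F" "K \<subseteq> (\<Union>x\<in>F. ball x (r x / 2))"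
    proof (rule compactE_image[OF K(1), of K "\<lambda>x. ball x (r x / 2)"])
      show "K \<subseteq> (\<Union>x\<in>K. ball x (r x / 2))" using r K(2) by force
    qed auto
    have F\<Omega>: "snd p > 0 \<and> ball (fst p) (snd p) \<subseteq> \<Omega> \<and> C1_approximated h h' (ball (fst p) (snd p))"
      if p: "p \<in> (\<lambda>x. (x, r x)) ` F" for p
    proof -
      obtain x where x: "x \<in> F" "p = (x, r x)" using p by blast
      have "x \<in> \<Omega>" using x(1) F(1) K(2) by blast
      from r[OF this] show ?thesis by (simp add: x(2))
    qed
    have cov: "K \<subseteq> (\<Union>p\<in>(\<lambda>x. (x, r x)) ` F. ball (fst p) (snd p / 2))"
    proof
      fix y assume "y \<in> K"
      then obtain x where "x \<in> F" "y \<in> ball x (r x / 2)" using F(3) by blast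
      then show "y \<in> (\<Union>p\<in>(\<lambda>x. (x, r x)) ` F. ball (fst p) (snd p / 2))"
        by (intro UN_I[of "(x, r x)"]) auto
    qed
    have "(LINT y|lebesgue_on \<Omega>. h y * frechet_derivative \<eta> (at y) \<xi> + h' y \<xi> * \<eta> y) = 0"
      by (rule C1_approximated_weak_identity[OF h \<Omega> _ F\<Omega> \<eta>1 K cov]) (rule finite_imageI[OF F(2)])
    then have "(LINT y|lebesgue_on \<Omega>. h y * frechet_derivative \<eta> (at y) \<xi>) = - (LINT y|lebesgue_on \<Omega>. h' y \<xi> * \<eta> y)"
      using weak_identity_integrable[where h'=h' and \<xi>=\<xi>, OF h(1) h(2)[of \<xi>] \<Omega> \<eta>1 K] by simp
    then show ?thesis
      using \<Omega>l by (simp add: set_lebesgue_integral_def integral_restrict_space)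
  qed
  then show ?thesis using h lin by (auto simp: has_weak_derivative_on_def)
qed

section \<open>Localisation and modification on negligible sets\<close>

lemma C1_approximated_cong:
  assumes "C1_approximated h h' B" "B \<in> sets lebesgue"
    "negligible {y \<in> B. h y \<noteq> k y}" "negligible {y \<in> B. \<exists>\<xi>. h' y \<xi> \<noteq> k' y \<xi>}"
  shows "C1_approximated k k' B"
proof -
  have "negligible {y \<in> B. h' y \<xi> \<noteq> k' y \<xi>}" for \<xi>
    by (rule negligible_subset[OF assms(4)]) auto
  then have cong: "L1_tendsto B f (\<lambda>y. k' y \<xi>)" if "L1_tendsto B f (\<lambda>y. h' y \<xi>)" for f \<xi>
    by (rule L1_tendsto_cong[OF that assms(2)])
  show ?thesis
    using assms(1) cong L1_tendsto_cong[OF _ assms(2,3)] unfolding C1_approximated_def by (elim ex_forward) simp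
qed

text \<open>Gluing principle: L1 limits ignore negligible sets, so near each point a pair that
  agrees almost everywhere with \<open>h\<close>, \<open>h'\<close> is enough. It allows derivatives
  to be patched from countably many charts.\<close>

lemma has_weak_derivative_on_localI:
  fixes h :: "'e::euclidean_space \<Rightarrow> real"
  assumes \<Omega>: "open \<Omega>" and lin: "\<And>y. y \<in> \<Omega> \<Longrightarrow> linear (h' y)"
    and loc: "\<And>x. x \<in> \<Omega> \<Longrightarrow> \<exists>V k k'. open V \<and> x \<in> V \<and> V \<subseteq> \<Omega> \<and> has_weak_derivative_on k k' V \<and>
      negligible {y \<in> V. k y \<noteq> h y} \<and> negligible {y \<in> V. \<exists>\<xi>. k' y \<xi> \<noteq> h' y \<xi>}"
  shows "has_weak_derivative_on h h' \<Omega>"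
proof (rule has_weak_derivative_onI_C1_approximated[OF \<Omega> lin])
  fix x assume "x \<in> \<Omega>"
  then obtain V k k' where V: "open V" "x \<in> V" "V \<subseteq> \<Omega>" "has_weak_derivative_on k k' V"
    "negligible {y \<in> V. k y \<noteq> h y}" "negligible {y \<in> V. \<exists>\<xi>. k' y \<xi> \<noteq> h' y \<xi>}"
    using loc by meson
  obtain r where r: "r > 0" "cball x r \<subseteq> V" using V(1,2) open_contains_cball_eq by blast
  then have rV: "ball x r \<subseteq> V" using ball_subset_cball by blast
  have "C1_approximated h h' (ball x r)"
  proof (rule C1_approximated_cong[OF has_weak_derivative_imp_C1_approximated[OF V(4,1) r(2)]])
    show "negligible {y \<in> ball x r. k y \<noteq> h y}" using rV by (intro negligible_subset[OF V(5)]) auto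
    show "negligible {y \<in> ball x r. \<exists>\<xi>. k' y \<xi> \<noteq> h' y \<xi>}" using rV by (intro negligible_subset[OF V(6)]) auto
  qed auto
  then show "\<exists>r>0. ball x r \<subseteq> \<Omega> \<and> C1_approximated h h' (ball x r)" using r rV V(3) by blast
qed

lemma has_weak_derivative_on_subset:
  fixes h :: "'e::euclidean_space \<Rightarrow> real"
  assumes "has_weak_derivative_on h h' \<Omega>" "open \<Omega>" "open V" "V \<subseteq> \<Omega>"
  shows "has_weak_derivative_on h h' V"
proof (rule has_weak_derivative_onI_C1_approximated[OF assms(3)])
  show "linear (h' y)" if "y \<in> V" for y using that assms has_weak_derivative_onD(2) by blast
  fix x assume "x \<in> V"
  then obtain r where r: "r > 0" "cball x r \<subseteq> V" using assms(3) open_contains_cball_eq by blast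
  then show "\<exists>r>0. ball x r \<subseteq> V \<and> C1_approximated h h' (ball x r)"
    using has_weak_derivative_imp_C1_approximated[OF assms(1,2), of x r] assms(4) ball_subset_cball by blast
qed

section \<open>Chain rule and locality of the weak derivative\<close>

text \<open>The error splits into \<open>(f - F) * q\<close> and \<open>F * (q - Q)\<close>: the
  first is small because the \<open>q k\<close> are bounded uniformly, the second by dominated
  convergence.\<close>

lemma L1_tendsto_mult_AE:
  assumes L: "L1_tendsto B f F"
    and q: "\<And>k. q k \<in> borel_measurable (lebesgue_on B)" "Q \<in> borel_measurable (lebesgue_on B)"
      "AE y in lebesgue_on B. (\<lambda>k. q k y) \<longlonglongrightarrow> Q y"
      "\<And>k y. y \<in> B \<Longrightarrow> \<bar>q k y\<bar> \<le> C" "\<And>y. y \<in> B \<Longrightarrow> \<bar>Q y\<bar> \<le> C"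
  shows "L1_tendsto B (\<lambda>k y. f k y * q k y) (\<lambda>y. F y * Q y)"
proof (rule L1_tendstoI_bound)
  note i = L1_tendstoD[OF L]
  show 1: "integrable (lebesgue_on B) (\<lambda>y. f k y * q k y)" for k
    by (rule integrable_bounded_mult[OF i(1) q(1), of _ C]) (use q(4) in auto)
  show 2: "integrable (lebesgue_on B) (\<lambda>y. F y * Q y)"
    by (rule integrable_bounded_mult[OF i(2) q(2), of C]) (use q(5) in auto)
  have 3: "integrable (lebesgue_on B) (\<lambda>y. \<bar>F y\<bar> * \<bar>q k y - Q y\<bar>)" for k
  proof (rule integrable_bounded_mult[of _ _ _ "C + C"])
    show "\<bar>\<bar>q k y - Q y\<bar>\<bar> \<le> C + C" if "y \<in> space (lebesgue_on B)" for y
      using q(4)[of y k] q(5)[of y] that by simp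
  qed (use i(2) q(1,2) in auto)
  show "(LINT y|lebesgue_on B. \<bar>f k y * q k y - F y * Q y\<bar>)
    \<le> \<bar>C\<bar> * (LINT y|lebesgue_on B. \<bar>f k y - F y\<bar>) + (LINT y|lebesgue_on B. \<bar>F y\<bar> * \<bar>q k y - Q y\<bar>)" for k
  proof -
    have "(LINT y|lebesgue_on B. \<bar>f k y * q k y - F y * Q y\<bar>)
      \<le> (LINT y|lebesgue_on B. \<bar>C\<bar> * \<bar>f k y - F y\<bar> + \<bar>F y\<bar> * \<bar>q k y - Q y\<bar>)"
    proof (rule integral_mono)
      fix y assume "y \<in> space (lebesgue_on B)"
      then have C: "\<bar>q k y\<bar> \<le> \<bar>C\<bar>" using q(4)[of y k] by simp
      have "f k y * q k y - F y * Q y = (f k y - F y) * q k y + F y * (q k y - Q y)"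
        by (simp add: algebra_simps)
      then have "\<bar>f k y * q k y - F y * Q y\<bar> \<le> \<bar>f k y - F y\<bar> * \<bar>q k y\<bar> + \<bar>F y\<bar> * \<bar>q k y - Q y\<bar>"
        by (metis abs_mult abs_triangle_ineq)
      also have "\<bar>f k y - F y\<bar> * \<bar>q k y\<bar> \<le> \<bar>f k y - F y\<bar> * \<bar>C\<bar>" using C by (intro mult_left_mono) auto
      finally show "\<bar>f k y * q k y - F y * Q y\<bar> \<le> \<bar>C\<bar> * \<bar>f k y - F y\<bar> + \<bar>F y\<bar> * \<bar>q k y - Q y\<bar>"
        by (simp add: mult.commute)
    qed (use 1 2 3 i in auto)
    then show ?thesis using i 3 by simp
  qed
  have "(\<lambda>k. LINT y|lebesgue_on B. \<bar>F y\<bar> * \<bar>q k y - Q y\<bar>) \<longlonglongrightarrow> (LINT y|lebesgue_on B. 0)"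
  proof (rule integral_dominated_convergence)
    show "integrable (lebesgue_on B) (\<lambda>y. \<bar>F y\<bar> * (C + C))" using i by simp
    show "AE y in lebesgue_on B. (\<lambda>k. \<bar>F y\<bar> * \<bar>q k y - Q y\<bar>) \<longlonglongrightarrow> 0"
      using q(3) by (rule eventually_mono) (auto intro!: tendsto_eq_intros simp: LIM_zero_iff tendsto_rabs_zero_iff)
    show "AE y in lebesgue_on B. norm (\<bar>F y\<bar> * \<bar>q k y - Q y\<bar>) \<le> \<bar>F y\<bar> * (C + C)" for k
    proof (intro AE_I2)
      fix y assume "y \<in> space (lebesgue_on B)"
      then have "\<bar>q k y - Q y\<bar> \<le> C + C" using q(4)[of y k] q(5)[of y] by simp
      then have "\<bar>F y\<bar> * \<bar>q k y - Q y\<bar> \<le> \<bar>F y\<bar> * (C + C)" by (intro mult_left_mono) auto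
      then show "norm (\<bar>F y\<bar> * \<bar>q k y - Q y\<bar>) \<le> \<bar>F y\<bar> * (C + C)" by (simp add: abs_mult)
    qed
  qed (use 3 in auto)
  then show "(\<lambda>k. \<bar>C\<bar> * (LINT y|lebesgue_on B. \<bar>f k y - F y\<bar>) + (LINT y|lebesgue_on B. \<bar>F y\<bar> * \<bar>q k y - Q y\<bar>)) \<longlonglongrightarrow> 0"
    using tendsto_add[OF tendsto_mult_right_zero[OF i(3), of "\<bar>C\<bar>"]] by simp
qed

lemma linear_functional_expansion:
  fixes l :: "'f::euclidean_space \<Rightarrow> real"
  assumes "linear l" shows "l w = (\<Sum>b\<in>Basis. (w \<bullet> b) * l b)"
  using linear_euclidean_expansion[OF assms, of w] by simp

text \<open>The bound on \<open>F'\<close> makes \<open>F\<close> Lipschitz, so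
  \<open>F (G k)\<close> converges in L1. Its derivative is a sum of L1 convergent factors times
  \<open>F' (G k) b\<close>, which is bounded and, by continuity, converges almost everywhere along
  a subsequence.\<close>

theorem has_weak_derivative_on_compose:
  fixes v :: "'e::euclidean_space \<Rightarrow> 'f::euclidean_space" and F :: "'f \<Rightarrow> real"
  assumes \<Omega>: "open \<Omega>"
    and v: "\<And>b. b \<in> Basis \<Longrightarrow> has_weak_derivative_on (\<lambda>y. v y \<bullet> b) (\<lambda>y \<xi>. v' y \<xi> \<bullet> b) \<Omega>"
    and F: "has_C1_derivative_on F F' UNIV" and FC: "\<And>z \<zeta>. \<bar>F' z \<zeta>\<bar> \<le> C * norm \<zeta>"
  shows "has_weak_derivative_on (\<lambda>y. F (v y)) (\<lambda>y \<xi>. F' (v y) (v' y \<xi>)) \<Omega>"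
proof (rule has_weak_derivative_onI_C1_approximated[OF \<Omega>])
  have Flin: "linear (F' z)" for z using has_C1_derivative_onD(3)[OF F] by simp
  show "linear (\<lambda>\<xi>. F' (v y) (v' y \<xi>))" if "y \<in> \<Omega>" for y
  proof -
    have "linear (v' y)" using linear_componentwise_iff has_weak_derivative_onD(2)[OF v] that by blast
    from linear_compose[OF this Flin] show ?thesis by (simp add: o_def)
  qed
  have FL: "\<bar>F a - F b\<bar> \<le> C * norm (a - b)" for a b
  proof -
    have "norm (F a - F b) \<le> C * norm (a - b)"
      by (rule differentiable_bound[of UNIV F F'])
        (use has_C1_derivative_onD(1)[OF F] FC in \<open>auto intro: onorm_le\<close>)
    then show ?thesis by simp
  qed
  fix x assume "x \<in> \<Omega>"
  then obtain r where r: "r > 0" "cball x r \<subseteq> \<Omega>" using \<Omega> open_contains_cball_eq by blast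
  define B where "B = ball x r"
  have Bl: "B \<in> sets lebesgue" by (simp add: B_def)
  have "\<forall>b\<in>Basis. \<exists>g g'. (\<forall>k. has_C1_derivative_on (g k) (g' k) B) \<and> L1_tendsto B g (\<lambda>y. v y \<bullet> b) \<and>
     (\<forall>\<xi>. L1_tendsto B (\<lambda>k y. g' k y \<xi>) (\<lambda>y. v' y \<xi> \<bullet> b))"
    using has_weak_derivative_imp_C1_approximated[OF v \<Omega> r(2)] unfolding C1_approximated_def B_def by blast
  then obtain g g' where g: "\<And>b k. b \<in> Basis \<Longrightarrow> has_C1_derivative_on (g b k) (g' b k) B"
    "\<And>b. b \<in> Basis \<Longrightarrow> L1_tendsto B (g b) (\<lambda>y. v y \<bullet> b)"
    "\<And>b \<xi>. b \<in> Basis \<Longrightarrow> L1_tendsto B (\<lambda>k y. g' b k y \<xi>) (\<lambda>y. v' y \<xi> \<bullet> b)"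
    by metis
  \<comment> \<open>Adding the errors of all coordinates gives one subsequence along which every
    coordinate converges almost everywhere.\<close>
  define err where "err k y = (\<Sum>b\<in>Basis. \<bar>g b k y - v y \<bullet> b\<bar>)" for k y
  have erri: "integrable (lebesgue_on B) (err k)" for k
    unfolding err_def using L1_tendstoD(1,2)[OF g(2)] by (intro Bochner_Integration.integrable_sum) auto
  have err0: "(\<lambda>k. LINT y|lebesgue_on B. err k y) \<longlonglongrightarrow> 0"
  proof -
    have "(LINT y|lebesgue_on B. err k y) = (\<Sum>b\<in>Basis. LINT y|lebesgue_on B. \<bar>g b k y - v y \<bullet> b\<bar>)" for k
      unfolding err_def using L1_tendstoD(1,2)[OF g(2)] by (intro Bochner_Integration.integral_sum) auto
    moreover have "(\<lambda>k. \<Sum>b\<in>Basis. LINT y|lebesgue_on B. \<bar>g b k y - v y \<bullet> b\<bar>) \<longlonglongrightarrow> 0"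
      using tendsto_sum[of Basis "\<lambda>b k. LINT y|lebesgue_on B. \<bar>g b k y - v y \<bullet> b\<bar>" "\<lambda>_. 0"] L1_tendstoD(3)[OF g(2)]
      by auto
    ultimately show ?thesis by simp
  qed
  have errn: "norm (err k y) = err k y" for k y by (simp add: err_def sum_nonneg)
  have "\<exists>r. strict_mono r \<and> (AE y in lebesgue_on B. (\<lambda>n. err (r n) y) \<longlonglongrightarrow> 0)"
    by (rule tendsto_L1_AE_subseq) (use erri err0 errn in auto)
  then obtain \<rho> where \<rho>: "strict_mono \<rho>" "AE y in lebesgue_on B. (\<lambda>n. err (\<rho> n) y) \<longlonglongrightarrow> 0" by blast
  define G where "G k y = (\<Sum>b\<in>Basis. g b (\<rho> k) y *\<^sub>R b)" for k y
  define G' where "G' k y \<xi> = (\<Sum>b\<in>Basis. g' b (\<rho> k) y \<xi> *\<^sub>R b)" for k y \<xi>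
  have G: "has_C1_derivative_on (G k) (G' k) B" for k
    unfolding G_def G'_def by (intro has_C1_derivative_on_sum has_C1_derivative_on_scaleR_left g(1))
  have G_near: "norm (G k y - v y) \<le> err (\<rho> k) y" for k y
  proof -
    have "G k y - v y = (\<Sum>b\<in>Basis. (g b (\<rho> k) y - v y \<bullet> b) *\<^sub>R b)"
      by (simp add: G_def scaleR_diff_left sum_subtractf euclidean_representation)
    also have "norm \<dots> \<le> err (\<rho> k) y" unfolding err_def by (rule sum_norm_le) simp
    finally show ?thesis .
  qed
  have Gb: "G' k y \<xi> \<bullet> b = g' b (\<rho> k) y \<xi>" if "b \<in> Basis" for k y \<xi> b
    using that by (simp add: G'_def inner_sum_left inner_Basis if_distrib cong: if_cong)
  have Gm: "G k \<in> borel_measurable (lebesgue_on B)" for k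
    using has_C1_derivative_onD(4)[OF G] Bl by (rule continuous_imp_measurable_on_sets_lebesgue)
  have vm: "v \<in> borel_measurable (lebesgue_on B)"
    unfolding borel_measurable_euclidean_space[of v] using L1_tendstoD(2)[OF g(2)] by blast
  have Fm: "F \<in> borel_measurable borel" "(\<lambda>z. F' z b) \<in> borel_measurable borel" for b
    using has_C1_derivative_onD(2,4)[OF F] by (auto intro: borel_measurable_continuous_onI)
  have Glim: "AE y in lebesgue_on B. (\<lambda>k. G k y) \<longlonglongrightarrow> v y"
    using \<rho>(2)
  proof (rule eventually_mono)
    fix y assume "(\<lambda>n. err (\<rho> n) y) \<longlonglongrightarrow> 0"
    then have "(\<lambda>k. G k y - v y) \<longlonglongrightarrow> 0"
      by (rule Lim_null_comparison[rotated]) (use G_near in \<open>simp add: always_eventually\<close>)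
    then show "(\<lambda>k. G k y) \<longlonglongrightarrow> v y" by (simp add: LIM_zero_iff)
  qed
  \<comment> \<open>\<open>F\<close> may be unbounded; its linear growth and the finite measure of
    the ball make the compositions integrable.\<close>
  have fin: "emeasure lebesgue B < \<infinity>" unfolding B_def using emeasure_lborel_ball_finite by (simp add: emeasure_completion)
  have iF: "integrable (lebesgue_on B) (\<lambda>y. F (w y))"
    if w: "w \<in> borel_measurable (lebesgue_on B)" "\<And>b. b \<in> Basis \<Longrightarrow> integrable (lebesgue_on B) (\<lambda>y. w y \<bullet> b)" for w
  proof (rule Bochner_Integration.integrable_bound)
    show "integrable (lebesgue_on B) (\<lambda>y. \<bar>F 0\<bar> + \<bar>C\<bar> * (\<Sum>b\<in>Basis. \<bar>w y \<bullet> b\<bar>))"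
    proof (intro Bochner_Integration.integrable_add integrable_mult_right Bochner_Integration.integrable_sum)
      show "integrable (lebesgue_on B) (\<lambda>y. \<bar>F 0\<bar>)"
        using fin Bl by (intro finite_measure.integrable_const finite_measureI) (simp add: emeasure_restrict_space)
    qed (use w(2) in auto)
    show "(\<lambda>y. F (w y)) \<in> borel_measurable (lebesgue_on B)" by (rule measurable_compose[OF w(1) Fm(1)])
    show "AE y in lebesgue_on B. norm (F (w y)) \<le> norm (\<bar>F 0\<bar> + \<bar>C\<bar> * (\<Sum>b\<in>Basis. \<bar>w y \<bullet> b\<bar>))"
    proof (intro AE_I2)
      fix y
      have "\<bar>F (w y) - F 0\<bar> \<le> C * norm (w y)" using FL[of "w y" 0] by simp
      also have "\<dots> \<le> \<bar>C\<bar> * (\<Sum>b\<in>Basis. \<bar>w y \<bullet> b\<bar>)" by (intro mult_mono norm_le_l1) auto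
      finally show "norm (F (w y)) \<le> norm (\<bar>F 0\<bar> + \<bar>C\<bar> * (\<Sum>b\<in>Basis. \<bar>w y \<bullet> b\<bar>))" by simp
    qed
  qed
  have 1: "L1_tendsto B (\<lambda>k y. F (G k y)) (\<lambda>y. F (v y))"
  proof (rule L1_tendstoI_bound)
    have Gi: "integrable (lebesgue_on B) (\<lambda>y. G k y \<bullet> b)" if "b \<in> Basis" for k b
    proof -
      have "G k y \<bullet> b = g b (\<rho> k) y" for y
        using that by (simp add: G_def inner_sum_left inner_Basis if_distrib cong: if_cong)
      then show ?thesis using L1_tendstoD(1)[OF g(2)[OF that]] by simp
    qed
    show i1: "integrable (lebesgue_on B) (\<lambda>y. F (G k y))" for k by (rule iF[OF Gm Gi])
    show i2: "integrable (lebesgue_on B) (\<lambda>y. F (v y))" by (rule iF[OF vm L1_tendstoD(2)[OF g(2)]])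
    show "(LINT y|lebesgue_on B. \<bar>F (G k y) - F (v y)\<bar>) \<le> \<bar>C\<bar> * (LINT y|lebesgue_on B. err (\<rho> k) y)" for k
    proof -
      have "(LINT y|lebesgue_on B. \<bar>F (G k y) - F (v y)\<bar>) \<le> (LINT y|lebesgue_on B. \<bar>C\<bar> * err (\<rho> k) y)"
      proof (rule integral_mono)
        fix y
        have "C * norm (G k y - v y) \<le> \<bar>C\<bar> * err (\<rho> k) y" by (intro mult_mono G_near) auto
        then show "\<bar>F (G k y) - F (v y)\<bar> \<le> \<bar>C\<bar> * err (\<rho> k) y" using FL[of "G k y" "v y"] by linarith
      qed (use i1 i2 erri in auto)
      then show ?thesis by simp
    qed
    show "(\<lambda>k. \<bar>C\<bar> * (LINT y|lebesgue_on B. err (\<rho> k) y)) \<longlonglongrightarrow> 0"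
      using tendsto_mult_right_zero[OF LIMSEQ_subseq_LIMSEQ[OF err0 \<rho>(1)]] by (simp add: o_def)
  qed
  have 2: "L1_tendsto B (\<lambda>k y. F' (G k y) (G' k y \<xi>)) (\<lambda>y. F' (v y) (v' y \<xi>))" for \<xi>
  proof -
    have "L1_tendsto B (\<lambda>k y. \<Sum>b\<in>Basis. g' b (\<rho> k) y \<xi> * F' (G k y) b) (\<lambda>y. \<Sum>b\<in>Basis. (v' y \<xi> \<bullet> b) * F' (v y) b)"
    proof (rule L1_tendsto_sum)
      fix b :: 'f assume b: "b \<in> Basis"
      show "L1_tendsto B (\<lambda>k y. g' b (\<rho> k) y \<xi> * F' (G k y) b) (\<lambda>y. v' y \<xi> \<bullet> b * F' (v y) b)"
      proof (rule L1_tendsto_mult_AE[OF L1_tendsto_subseq[OF g(3)[OF b] \<rho>(1)]])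
        show "(\<lambda>y. F' (G k y) b) \<in> borel_measurable (lebesgue_on B)" for k by (rule measurable_compose[OF Gm Fm(2)])
        show "(\<lambda>y. F' (v y) b) \<in> borel_measurable (lebesgue_on B)" by (rule measurable_compose[OF vm Fm(2)])
        show "AE y in lebesgue_on B. (\<lambda>k. F' (G k y) b) \<longlonglongrightarrow> F' (v y) b"
          using Glim
        proof (rule eventually_mono)
          fix y assume "(\<lambda>k. G k y) \<longlonglongrightarrow> v y"
          then show "(\<lambda>k. F' (G k y) b) \<longlonglongrightarrow> F' (v y) b"
            by (rule continuous_on_tendsto_compose[OF has_C1_derivative_onD(2)[OF F, of b]]) auto
        qed
        show "\<bar>F' (G k y) b\<bar> \<le> C" "\<bar>F' (v y) b\<bar> \<le> C" for k y using FC[of _ b] b by simp_all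
      qed
    qed
    moreover have "F' (G k y) (G' k y \<xi>) = (\<Sum>b\<in>Basis. g' b (\<rho> k) y \<xi> * F' (G k y) b)" for k y
      using linear_functional_expansion[OF Flin, of "G k y" "G' k y \<xi>"] Gb by simp
    moreover have "F' (v y) (v' y \<xi>) = (\<Sum>b\<in>Basis. (v' y \<xi> \<bullet> b) * F' (v y) b)" for y
      by (rule linear_functional_expansion[OF Flin])
    ultimately show ?thesis by simp
  qed
  have "C1_approximated (\<lambda>y. F (v y)) (\<lambda>y \<xi>. F' (v y) (v' y \<xi>)) B"
    unfolding C1_approximated_def
    by (rule exI[of _ "\<lambda>k y. F (G k y)"], rule exI[of _ "\<lambda>k y \<xi>. F' (G k y) (G' k y \<xi>)"])
      (intro conjI allI 1 2 has_C1_derivative_on_compose[OF G F] subset_UNIV)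
  then show "\<exists>r>0. ball x r \<subseteq> \<Omega> \<and> C1_approximated (\<lambda>y. F (v y)) (\<lambda>y \<xi>. F' (v y) (v' y \<xi>)) (ball x r)"
    using r ball_subset_cball unfolding B_def by blast
qed

lemma has_weak_derivative_on_diff:
  fixes h k :: "'e::euclidean_space \<Rightarrow> real"
  assumes \<Omega>: "open \<Omega>" and h: "has_weak_derivative_on h h' \<Omega>" and k: "has_weak_derivative_on k k' \<Omega>"
  shows "has_weak_derivative_on (\<lambda>y. h y - k y) (\<lambda>y \<xi>. h' y \<xi> - k' y \<xi>) \<Omega>"
proof (rule has_weak_derivative_onI_C1_approximated[OF \<Omega>])
  show "linear (\<lambda>\<xi>. h' y \<xi> - k' y \<xi>)" if "y \<in> \<Omega>" for y
    using linear_compose_sub has_weak_derivative_onD(2)[OF h that] has_weak_derivative_onD(2)[OF k that] by blast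
  fix x assume "x \<in> \<Omega>"
  then obtain r where r: "r > 0" "cball x r \<subseteq> \<Omega>" using \<Omega> open_contains_cball_eq by blast
  have diff: "L1_tendsto B (\<lambda>k y. f k y - g k y) (\<lambda>y. F y - G y)" if "L1_tendsto B f F" "L1_tendsto B g G"
    for B :: "'e set" and f g F G
    using L1_tendsto_add[OF that(1) L1_tendsto_mult[OF that(2), of "\<lambda>_. -1" 1]] by simp
  have "C1_approximated (\<lambda>y. h y - k y) (\<lambda>y \<xi>. h' y \<xi> - k' y \<xi>) (ball x r)"
    using has_weak_derivative_imp_C1_approximated[OF h \<Omega> r(2)] has_weak_derivative_imp_C1_approximated[OF k \<Omega> r(2)]
    unfolding C1_approximated_def
  proof (elim exE conjE)
    fix f f' g g'
    assume a: "\<forall>n. has_C1_derivative_on (f n) (f' n) (ball x r)" "L1_tendsto (ball x r) f h"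
      "\<forall>\<xi>. L1_tendsto (ball x r) (\<lambda>n y. f' n y \<xi>) (\<lambda>y. h' y \<xi>)"
      "\<forall>n. has_C1_derivative_on (g n) (g' n) (ball x r)" "L1_tendsto (ball x r) g k"
      "\<forall>\<xi>. L1_tendsto (ball x r) (\<lambda>n y. g' n y \<xi>) (\<lambda>y. k' y \<xi>)"
    show "\<exists>q q'. (\<forall>n. has_C1_derivative_on (q n) (q' n) (ball x r)) \<and> L1_tendsto (ball x r) q (\<lambda>y. h y - k y) \<and>
      (\<forall>\<xi>. L1_tendsto (ball x r) (\<lambda>n y. q' n y \<xi>) (\<lambda>y. h' y \<xi> - k' y \<xi>))"
      by (rule exI[of _ "\<lambda>n y. f n y - g n y"], rule exI[of _ "\<lambda>n y \<xi>. f' n y \<xi> - g' n y \<xi>"])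
        (use a diff has_C1_derivative_on_diff in blast)
  qed
  then show "\<exists>r>0. ball x r \<subseteq> \<Omega> \<and> C1_approximated (\<lambda>y. h y - k y) (\<lambda>y \<xi>. h' y \<xi> - k' y \<xi>) (ball x r)"
    using r ball_subset_cball by blast
qed

section \<open>The derivative on a coincidence set\<close>

lemma abs_arctan_le: "\<bar>arctan x\<bar> \<le> \<bar>x\<bar>"
proof -
  have "norm (arctan x - arctan 0) \<le> 1 * norm (x - 0)"
  proof (rule differentiable_bound[of UNIV arctan "\<lambda>x h. inverse (1 + x\<^sup>2) * h"])
    show "(arctan has_derivative (\<lambda>h. inverse (1 + x\<^sup>2) * h)) (at x within UNIV)" for x
      using DERIV_arctan[of x] by (simp add: has_field_derivative_def)
    have "norm (inverse (1 + x\<^sup>2) * h) \<le> 1 * norm h" for x h :: real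
      by (simp add: abs_mult mult_left_le_one_le inverse_le_1_iff)
    then show "onorm ((*) (inverse (1 + x\<^sup>2))) \<le> 1" for x :: real by (intro onorm_le)
  qed auto
  then show ?thesis by simp
qed

lemma borel_measurable_locally_integrable:
  fixes h :: "'e::euclidean_space \<Rightarrow> real"
  assumes h: "locally_integrable_on h \<Omega>" and \<Omega>: "open \<Omega>"
  shows "h \<in> borel_measurable (lebesgue_on \<Omega>)"
proof -
  obtain K :: "nat \<Rightarrow> 'e set" where K: "\<And>n. compact (K n)" "\<And>n. K n \<subseteq> \<Omega>" "(\<Union>n. K n) = \<Omega>"
    using open_Union_compact_subsets[OF \<Omega>] by metis
  have Kl: "K n \<in> sets lebesgue" for n using K(1) by (simp add: fmeasurableD lmeasurable_compact)
  have \<Omega>l: "\<Omega> \<in> sets lebesgue" using \<Omega> by (simp add: borel_open)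
  show ?thesis
  proof (rule measurable_piecewise_restrict[of "range K"])
    show "space (lebesgue_on \<Omega>) \<subseteq> \<Union> (range K)" using K(3) by simp
    show "A \<inter> space (lebesgue_on \<Omega>) \<in> sets (lebesgue_on \<Omega>)" if "A \<in> range K" for A
      using that Kl K(2) \<Omega>l by (auto simp: sets_restrict_space_iff Int_absorb2)
    show "h \<in> borel_measurable (restrict_space (lebesgue_on \<Omega>) A)" if A: "A \<in> range K" for A
    proof -
      obtain n where n: "A = K n" using A by blast
      have "h absolutely_integrable_on A" using h K n by (auto simp: locally_integrable_on_def)
      then have "h \<in> borel_measurable (lebesgue_on A)"
        using integrable_lebesgue_on_iff[OF Kl] n by (metis borel_measurable_integrable)
      moreover have "restrict_space (lebesgue_on \<Omega>) A = lebesgue_on A"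
        using K(2) n \<Omega>l Kl by (subst restrict_restrict_space) (auto simp: Int_absorb1)
      ultimately show ?thesis by simp
    qed
  qed auto
qed

text \<open>For \<open>v = v1 - v2\<close> the functions \<open>arctan (n v) / n\<close> tend to \<open>0\<close> while their derivatives
  \<open>Dv / (1 + (n v)\<^sup>2)\<close> tend to the restriction of \<open>Dv\<close> to \<open>{v = 0}\<close>, which is thus a weak derivative of \<open>0\<close>.\<close>

theorem has_weak_derivative_on_locality:
  fixes v1 v2 :: "'e::euclidean_space \<Rightarrow> real"
  assumes \<Omega>: "open \<Omega>" and v: "has_weak_derivative_on v1 v1' \<Omega>" "has_weak_derivative_on v2 v2' \<Omega>"
  shows "negligible {y \<in> \<Omega>. v1 y = v2 y \<and> (\<exists>\<xi>. v1' y \<xi> \<noteq> v2' y \<xi>)}"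
proof -
  define v where "v y = v1 y - v2 y" for y
  define v' where "v' y \<xi> = v1' y \<xi> - v2' y \<xi>" for y \<xi>
  have w: "has_weak_derivative_on v v' \<Omega>"
    unfolding v_def v'_def by (rule has_weak_derivative_on_diff[OF \<Omega> v])
  note wD = has_weak_derivative_onD[OF w]
  have \<Omega>l: "\<Omega> \<in> sets lebesgue" using \<Omega> by (simp add: borel_open)
  define a where "a n y = inverse (Suc n) * arctan (Suc n * v y)" for n :: nat and y
  define d where "d n y \<xi> = v' y \<xi> * inverse (1 + (Suc n * v y)\<^sup>2)" for n :: nat and y \<xi>
  define H where "H y \<xi> = (if v y = 0 then v' y \<xi> else 0)" for y \<xi>
  have aw: "has_weak_derivative_on (a n) (d n) \<Omega>" for n
  proof -
    have "has_weak_derivative_on (\<lambda>y. (\<lambda>t. inverse (Suc n) * arctan (Suc n * t)) (v y))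
        (\<lambda>y \<xi>. (\<lambda>t \<zeta>. \<zeta> * inverse (1 + (Suc n * t)\<^sup>2)) (v y) (v' y \<xi>)) \<Omega>"
    proof (rule has_weak_derivative_on_compose[where v=v and v'=v' and C=1, OF \<Omega>])
      show "has_weak_derivative_on (\<lambda>y. v y \<bullet> b) (\<lambda>y \<xi>. v' y \<xi> \<bullet> b) \<Omega>" if "b \<in> Basis" for b
        using w that by simp
      show "has_C1_derivative_on (\<lambda>t. inverse (Suc n) * arctan (Suc n * t)) (\<lambda>t \<zeta>. \<zeta> * inverse (1 + (Suc n * t)\<^sup>2)) UNIV"
      proof (rule has_C1_derivative_onI)
        fix t :: real
        have "((\<lambda>t. inverse (Suc n) * arctan (Suc n * t)) has_real_derivative inverse (1 + (Suc n * t)\<^sup>2)) (at t)"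
          by (rule derivative_eq_intros refl | simp)+
        then show "((\<lambda>t. inverse (Suc n) * arctan (Suc n * t)) has_derivative (\<lambda>\<zeta>. \<zeta> * inverse (1 + (Suc n * t)\<^sup>2))) (at t)"
          by (simp add: has_field_derivative_def mult.commute[of _ "inverse (1 + _)"])
        have "1 + (real (Suc n) * x)\<^sup>2 \<noteq> 0" for x by (metis add_nonneg_eq_0_iff zero_le_one zero_le_power2 zero_neq_one)
        then show "continuous_on UNIV (\<lambda>t. \<zeta> * inverse (1 + (real (Suc n) * t)\<^sup>2))" for \<zeta>
          by (intro continuous_intros) auto
      qed
      show "\<bar>\<zeta> * inverse (1 + (Suc n * t)\<^sup>2)\<bar> \<le> 1 * norm \<zeta>" for t \<zeta> :: real
        by (simp add: abs_mult mult_left_le inverse_le_1_iff)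
    qed
    then show ?thesis by (simp add: a_def[abs_def] d_def[abs_def])
  qed
  have ab: "\<bar>a n y\<bar> \<le> \<bar>v y\<bar>" "\<bar>d n y \<xi>\<bar> \<le> \<bar>v' y \<xi>\<bar>" for n y \<xi>
  proof -
    have "\<bar>a n y\<bar> = inverse (Suc n) * \<bar>arctan (Suc n * v y)\<bar>" by (simp add: a_def abs_mult)
    also have "\<dots> \<le> inverse (Suc n) * \<bar>Suc n * v y\<bar>" by (intro mult_left_mono abs_arctan_le) auto
    also have "\<dots> = \<bar>v y\<bar>" by (simp add: abs_mult)
    finally show "\<bar>a n y\<bar> \<le> \<bar>v y\<bar>" .
    show "\<bar>d n y \<xi>\<bar> \<le> \<bar>v' y \<xi>\<bar>" by (simp add: d_def abs_mult mult_left_le inverse_le_1_iff)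
  qed
  have alim: "(\<lambda>n. a n y) \<longlonglongrightarrow> 0" for y
  proof (rule Lim_null_comparison)
    show "eventually (\<lambda>n. norm (a n y) \<le> inverse (Suc n) * (pi / 2)) sequentially"
    proof (intro always_eventually allI)
      fix n
      have "\<bar>arctan (Suc n * v y)\<bar> \<le> pi / 2" using arctan_bounded[of "Suc n * v y"] by linarith
      then show "norm (a n y) \<le> inverse (Suc n) * (pi / 2)"
        unfolding a_def by (simp add: abs_mult mult_left_mono del: of_nat_Suc)
    qed
    show "(\<lambda>n. inverse (Suc n) * (pi / 2)) \<longlonglongrightarrow> 0"
      using tendsto_mult_left_zero[OF LIMSEQ_inverse_real_of_nat] .
  qed
  have dlim: "(\<lambda>n. d n y \<xi>) \<longlonglongrightarrow> H y \<xi>" for y \<xi>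
  proof (cases "v y = 0")
    case True
    then show ?thesis by (simp add: d_def H_def)
  next
    case False
    \<comment> \<open>Off the zero set the denominator is at least
      \<open>(v y)\<^sup>2 * Suc n\<close>, which forces the decay.\<close>
    have bound: "\<bar>d n y \<xi>\<bar> \<le> \<bar>v' y \<xi>\<bar> / (v y)\<^sup>2 * inverse (Suc n)" for n
    proof -
      have "(v y)\<^sup>2 * Suc n \<le> (v y)\<^sup>2 * (Suc n)\<^sup>2" by (intro mult_left_mono) (auto simp: power2_eq_square)
      also have "\<dots> \<le> 1 + (Suc n * v y)\<^sup>2" by (simp add: power_mult_distrib mult.commute)
      finally have "inverse (1 + (Suc n * v y)\<^sup>2) \<le> inverse ((v y)\<^sup>2 * Suc n)"
        using False by (intro le_imp_inverse_le) auto
      then have "\<bar>v' y \<xi>\<bar> * inverse (1 + (Suc n * v y)\<^sup>2) \<le> \<bar>v' y \<xi>\<bar> * inverse ((v y)\<^sup>2 * Suc n)"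
        by (intro mult_left_mono) auto
      moreover have "0 \<le> inverse (1 + (Suc n * v y)\<^sup>2)" by simp
      ultimately show ?thesis unfolding d_def by (simp add: abs_mult divide_inverse mult_ac del: of_nat_Suc)
    qed
    have "(\<lambda>n. d n y \<xi>) \<longlonglongrightarrow> 0"
      by (rule Lim_null_comparison[OF always_eventually[OF allI] tendsto_mult_right_zero[OF LIMSEQ_inverse_real_of_nat]])
        (unfold real_norm_def, rule bound)
    then show ?thesis using False by (simp add: H_def)
  qed
  have m: "v \<in> borel_measurable (lebesgue_on \<Omega>)" "(\<lambda>y. v' y \<xi>) \<in> borel_measurable (lebesgue_on \<Omega>)"
    "a n \<in> borel_measurable (lebesgue_on \<Omega>)" "(\<lambda>y. d n y \<xi>) \<in> borel_measurable (lebesgue_on \<Omega>)" for \<xi> n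
    by (intro borel_measurable_locally_integrable[OF _ \<Omega>] wD(1,3) has_weak_derivative_onD(1,3)[OF aw])+
  have Hm: "(\<lambda>y. H y \<xi>) \<in> borel_measurable (lebesgue_on \<Omega>)" for \<xi>
    by (rule borel_measurable_LIMSEQ_real[OF dlim m(4)])
  have Hli: "locally_integrable_on (\<lambda>y. H y \<xi>) \<Omega>" for \<xi>
    unfolding locally_integrable_on_def
  proof (intro allI impI)
    fix K assume K: "compact K \<and> K \<subseteq> \<Omega>"
    then have Kl: "K \<in> sets lebesgue" by (simp add: fmeasurableD lmeasurable_compact)
    have "integrable (lebesgue_on K) (\<lambda>y. v' y \<xi>)"
      using wD(3) K Kl by (simp add: locally_integrable_on_def integrable_lebesgue_on_iff)
    moreover have "(\<lambda>y. H y \<xi>) \<in> borel_measurable (lebesgue_on K)"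
      using measurable_restrict_mono[OF Hm] K by blast
    ultimately have "integrable (lebesgue_on K) (\<lambda>y. H y \<xi>)"
      by (rule Bochner_Integration.integrable_bound) (simp add: H_def)
    then show "(\<lambda>y. H y \<xi>) absolutely_integrable_on K" by (simp add: integrable_lebesgue_on_iff[OF Kl])
  qed
  have Hlin: "linear (H y)" if "y \<in> \<Omega>" for y
  proof -
    have "H y = (if v y = 0 then v' y else (\<lambda>_. 0))" by (auto simp: H_def fun_eq_iff)
    then show ?thesis using wD(2)[OF that] by (simp add: linear_iff)
  qed
  \<comment> \<open>The weak identity of \<open>a n\<close> passes to the limit by dominated
    convergence: \<open>a n\<close> and \<open>d n\<close> are bounded by \<open>v\<close> and
    \<open>v'\<close>, which are integrable against a test function and its derivatives.\<close>
  have H0: "has_weak_derivative_on (\<lambda>y. 0) H \<Omega>"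
    unfolding has_weak_derivative_on_def
  proof (intro conjI allI ballI)
    show "locally_integrable_on (\<lambda>y. 0) \<Omega>" by (simp add: locally_integrable_on_def)
    fix \<eta> \<xi> assume \<eta>: "\<eta> \<in> test_functions \<Omega>"
    obtain K where K: "compact K" "K \<subseteq> \<Omega>" "\<And>x. x \<notin> K \<Longrightarrow> \<eta> x = 0"
      by (rule test_functions_support[OF \<eta>]) blast
    define \<eta>' where "\<eta>' = (\<lambda>x. frechet_derivative \<eta> (at x))"
    have \<eta>1: "has_C1_derivative_on \<eta> \<eta>' UNIV"
      unfolding \<eta>'_def by (rule test_functions_C1[OF \<eta>])
    have i: "integrable (lebesgue_on \<Omega>) (\<lambda>y. v y * \<eta>' y \<xi>)" "integrable (lebesgue_on \<Omega>) (\<lambda>y. v' y \<xi> * \<eta> y)"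
      using weak_identity_integrable[where h'=v' and \<xi>=\<xi>, OF wD(1,3) \<Omega> \<eta>1 K] by blast+
    note m\<eta> = C1_function_lebesgue_measurable[OF \<eta>1 \<Omega>l]
    have "(\<lambda>n. LINT y|lebesgue_on \<Omega>. a n y * \<eta>' y \<xi>) \<longlonglongrightarrow> (LINT y|lebesgue_on \<Omega>. 0 * \<eta>' y \<xi>)"
    proof (rule integral_dominated_convergence)
      show "integrable (lebesgue_on \<Omega>) (\<lambda>y. \<bar>v y * \<eta>' y \<xi>\<bar>)" using i by simp
      show "AE y in lebesgue_on \<Omega>. (\<lambda>n. a n y * \<eta>' y \<xi>) \<longlonglongrightarrow> 0 * \<eta>' y \<xi>"
        by (intro AE_I2 tendsto_mult_right alim)
      show "AE y in lebesgue_on \<Omega>. norm (a n y * \<eta>' y \<xi>) \<le> \<bar>v y * \<eta>' y \<xi>\<bar>" for n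
        using ab by (intro AE_I2) (simp add: abs_mult mult_right_mono)
    qed (intro borel_measurable_times borel_measurable_const m(3) m\<eta>(2))+
    then have l1: "(\<lambda>n. LINT y|lebesgue_on \<Omega>. a n y * \<eta>' y \<xi>) \<longlonglongrightarrow> 0" by simp
    have l2: "(\<lambda>n. LINT y|lebesgue_on \<Omega>. d n y \<xi> * \<eta> y) \<longlonglongrightarrow> (LINT y|lebesgue_on \<Omega>. H y \<xi> * \<eta> y)"
    proof (rule integral_dominated_convergence)
      show "integrable (lebesgue_on \<Omega>) (\<lambda>y. \<bar>v' y \<xi> * \<eta> y\<bar>)" using i by simp
      show "AE y in lebesgue_on \<Omega>. (\<lambda>n. d n y \<xi> * \<eta> y) \<longlonglongrightarrow> H y \<xi> * \<eta> y"
        by (intro AE_I2 tendsto_mult_right dlim)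
      show "AE y in lebesgue_on \<Omega>. norm (d n y \<xi> * \<eta> y) \<le> \<bar>v' y \<xi> * \<eta> y\<bar>" for n
        using ab by (intro AE_I2) (simp add: abs_mult mult_right_mono)
    qed (intro borel_measurable_times m(4) Hm m\<eta>(1))+
    have "(LINT y|lebesgue_on \<Omega>. a n y * \<eta>' y \<xi>) = - (LINT y|lebesgue_on \<Omega>. d n y \<xi> * \<eta> y)" for n
      using has_weak_derivative_onD(4)[OF aw \<eta>, of n \<xi>] \<Omega>l
      by (simp add: set_lebesgue_integral_def integral_restrict_space \<eta>'_def)
    then have "(\<lambda>n. LINT y|lebesgue_on \<Omega>. a n y * \<eta>' y \<xi>) \<longlonglongrightarrow> - (LINT y|lebesgue_on \<Omega>. H y \<xi> * \<eta> y)"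
      using tendsto_minus[OF l2] by simp
    then have "(LINT y|lebesgue_on \<Omega>. H y \<xi> * \<eta> y) = 0" using LIMSEQ_unique[OF l1] by (metis neg_equal_0_iff_equal)
    then show "(LINT y:\<Omega>|lebesgue. 0 * frechet_derivative \<eta> (at y) \<xi>) = - (LINT y:\<Omega>|lebesgue. H y \<xi> * \<eta> y)"
      using \<Omega>l by (simp add: set_lebesgue_integral_def integral_restrict_space)
  qed (use Hli Hlin in auto)
  \<comment> \<open>The zero function also has weak derivative 0, so uniqueness makes
    \<open>H\<close> vanish almost everywhere, that is, \<open>v'\<close> vanishes almost everywhere
    on the zero set of \<open>v\<close>.\<close>
  have "has_weak_derivative_on (\<lambda>y. 0) (\<lambda>y \<xi>. 0) \<Omega>"
    by (auto simp: has_weak_derivative_on_def locally_integrable_on_def linear_zero set_lebesgue_integral_def)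
  from has_weak_derivative_on_unique[OF H0 this \<Omega>] show ?thesis
    by (rule negligible_subset) (auto simp: H_def v_def v'_def)
qed

section \<open>Invariance under \<open>C\<^sup>1\<close> diffeomorphisms\<close>

text \<open>Lipschitz maps within one dimension preserve null sets, and a continuous map that does
  so also preserves Lebesgue measurability.\<close>

lemma Lipschitz_image_lebesgue:
  fixes f :: "'e::euclidean_space \<Rightarrow> 'e"
  assumes L: "L > 0" "\<And>x y. x \<in> U \<Longrightarrow> y \<in> U \<Longrightarrow> norm (f x - f y) \<le> L * norm (x - y)"
  shows "negligible N \<Longrightarrow> N \<subseteq> U \<Longrightarrow> negligible (f ` N)"
    and "S \<in> sets lebesgue \<Longrightarrow> S \<subseteq> U \<Longrightarrow> f ` S \<in> sets lebesgue"
proof -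
  show neg: "negligible (f ` N)" if "negligible N" "N \<subseteq> U" for N
    by (rule negligible_locally_Lipschitz_image[OF order_refl that(1)])
      (use L(2) that(2) in \<open>meson IntD1 open_UNIV subsetD UNIV_I\<close>)
  have cont: "continuous_on U f"
  proof (rule continuous_onI)
    fix x e assume "x \<in> U" "(0::real) < e"
    then show "\<exists>d>0. \<forall>x'\<in>U. dist x' x < d \<longrightarrow> dist (f x') (f x) \<le> e"
      using L by (intro exI[of _ "e / L"]) (force simp: dist_norm field_simps intro: order_trans)
  qed
  show "f ` S \<in> sets lebesgue" if "S \<in> sets lebesgue" "S \<subseteq> U"
    by (rule sets_lebesgue_continuous_image[OF that(1) cont neg that(2)])
qed

text \<open>By Vitali's theorem disjoint closed balls fill \<open>U\<close> up to a null set, and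
  the image of each lies in a ball of radius \<open>L * r\<close>. Working with balls on both sides
  gives the factor \<open>L ^ DIM('e)\<close> without a further constant.\<close>

lemma emeasure_Lipschitz_image_open:
  fixes f :: "'e::euclidean_space \<Rightarrow> 'e"
  assumes U: "open U" and inj: "inj_on f U"
    and L: "L > 0" "\<And>x y. x \<in> U \<Longrightarrow> y \<in> U \<Longrightarrow> norm (f x - f y) \<le> L * norm (x - y)"
  shows "emeasure lebesgue (f ` U) \<le> ennreal (L ^ DIM('e)) * emeasure lebesgue U"
proof -
  have neg: "negligible (f ` N)" if "negligible N" "N \<subseteq> U" for N
    by (rule Lipschitz_image_lebesgue(1)[OF L that])
  have leb: "f ` S \<in> sets lebesgue" if "S \<in> sets lebesgue" "S \<subseteq> U" for S
    by (rule Lipschitz_image_lebesgue(2)[OF L that])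
  define K where "K = {p. 0 < snd p \<and> cball (fst p) (snd p) \<subseteq> U}"
  obtain C where C: "countable C" "C \<subseteq> K"
     "pairwise (\<lambda>p q. disjnt (cball (fst p) (snd p)) (cball (fst q) (snd q))) C"
     "negligible (U - (\<Union>p\<in>C. cball (fst p) (snd p)))"
  proof (rule Vitali_covering_theorem_cballs[of K snd U fst])
    show "0 < snd p" if "p \<in> K" for p using that by (simp add: K_def)
    fix x d assume "x \<in> U" "(0::real) < d"
    obtain r where r: "r > 0" "cball x r \<subseteq> U" using U \<open>x \<in> U\<close> open_contains_cball_eq by blast
    show "\<exists>p. p \<in> K \<and> x \<in> cball (fst p) (snd p) \<and> snd p < d"
      using r \<open>0 < d\<close> by (intro exI[of _ "(x, min r (d / 2))"]) (auto simp: K_def)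
  qed blast
  define b where "b p = cball (fst p) (snd p)" for p :: "'e \<times> real"
  define N where "N = U - (\<Union>p\<in>C. b p)"
  have N: "negligible N" "N \<subseteq> U" using C(4) by (auto simp: N_def b_def)
  have bU: "b p \<subseteq> U" if "p \<in> C" for p using that C(2) by (auto simp: K_def b_def)
  have bl: "b p \<in> sets lebesgue" for p by (simp add: b_def)
  have img: "emeasure lebesgue (f ` b p) \<le> ennreal (L ^ DIM('e)) * emeasure lebesgue (b p)" if p: "p \<in> C" for p
  proof -
    obtain a r where ar: "p = (a, r)" "r > 0" using p C(2) by (cases p) (auto simp: K_def)
    have "f ` b p \<subseteq> cball (f a) (L * r)"
    proof clarify
      fix y assume "y \<in> b p"
      then have y: "y \<in> U" "a \<in> U" "norm (a - y) \<le> r" using bU[OF p] ar by (auto simp: b_def dist_norm)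
      then have "norm (f a - f y) \<le> L * norm (a - y)" by (intro L)
      also have "\<dots> \<le> L * r" using y L by (intro mult_left_mono) auto
      finally show "f y \<in> cball (f a) (L * r)" by (simp add: dist_norm)
    qed
    then have "emeasure lebesgue (f ` b p) \<le> emeasure lebesgue (cball (f a) (L * r))"
      by (intro emeasure_mono) auto
    also have "\<dots> = ennreal (L ^ DIM('e)) * emeasure lebesgue (cball a r)"
      using ar L by (simp add: emeasure_cball ennreal_mult[symmetric] power_mult_distrib mult_ac)
    finally show ?thesis by (simp add: b_def ar)
  qed
  have disj: "disjoint_family_on b C"
    using C(3) by (auto simp: disjoint_family_on_def pairwise_def b_def disjnt_def)
  have "emeasure lebesgue (f ` U) \<le> emeasure lebesgue ((\<Union>p\<in>C. f ` b p) \<union> f ` N)"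
  proof (rule emeasure_mono)
    show "f ` U \<subseteq> (\<Union>p\<in>C. f ` b p) \<union> f ` N" unfolding N_def by blast
    show "(\<Union>p\<in>C. f ` b p) \<union> f ` N \<in> sets lebesgue"
      using C(1) leb[OF bl bU] neg[OF N] by (intro sets.Un sets.countable_UN') (auto simp: negligible_imp_sets)
  qed
  also have "\<dots> \<le> emeasure lebesgue (\<Union>p\<in>C. f ` b p) + emeasure lebesgue (f ` N)"
    using C(1) leb[OF bl bU] neg[OF N]
    by (intro emeasure_subadditive sets.countable_UN') (auto simp: negligible_imp_sets)
  also have "emeasure lebesgue (f ` N) = 0" using neg[OF N] unfolding negligible_iff_null_sets by (rule null_setsD1)
  also have "emeasure lebesgue (\<Union>p\<in>C. f ` b p) = (\<integral>\<^sup>+p. emeasure lebesgue (f ` b p) \<partial>count_space C)"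
  proof (rule emeasure_UN_countable[OF _ C(1)])
    show "f ` b p \<in> sets lebesgue" if "p \<in> C" for p by (rule leb[OF bl bU[OF that]])
    show "disjoint_family_on (\<lambda>p. f ` b p) C"
      unfolding disjoint_family_on_def
    proof (intro ballI impI)
      fix p q assume "p \<in> C" "q \<in> C" "p \<noteq> q"
      then show "f ` b p \<inter> f ` b q = {}"
        using inj_on_image_Int[OF inj bU bU] disj by (metis disjoint_family_on_def image_empty)
    qed
  qed
  also have "\<dots> \<le> (\<integral>\<^sup>+p. ennreal (L ^ DIM('e)) * emeasure lebesgue (b p) \<partial>count_space C)"
    by (rule nn_integral_mono) (use img in auto)
  also have "\<dots> = ennreal (L ^ DIM('e)) * (\<integral>\<^sup>+p. emeasure lebesgue (b p) \<partial>count_space C)"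
    by (rule nn_integral_cmult) simp
  also have "(\<integral>\<^sup>+p. emeasure lebesgue (b p) \<partial>count_space C) = emeasure lebesgue (\<Union>p\<in>C. b p)"
    by (rule emeasure_UN_countable[symmetric, OF bl C(1) disj])
  also have "\<dots> \<le> emeasure lebesgue U"
    using bU U by (intro emeasure_mono) (auto simp: borel_open)
  finally show ?thesis by (simp add: mult_left_mono)
qed

text \<open>Outer regularity reduces to the open case; the open neighbourhood is intersected with
  \<open>U\<close>, where the map is injective and Lipschitz.\<close>

lemma emeasure_Lipschitz_image:
  fixes f :: "'e::euclidean_space \<Rightarrow> 'e"
  assumes U: "open U" and inj: "inj_on f U"
    and L: "L > 0" "\<And>x y. x \<in> U \<Longrightarrow> y \<in> U \<Longrightarrow> norm (f x - f y) \<le> L * norm (x - y)"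
    and S: "S \<in> sets lebesgue" "S \<subseteq> U"
  shows "f ` S \<in> sets lebesgue" "emeasure lebesgue (f ` S) \<le> ennreal (L ^ DIM('e)) * emeasure lebesgue S"
proof -
  show "f ` S \<in> sets lebesgue"
    by (rule Lipschitz_image_lebesgue(2)[OF L S])
  show "emeasure lebesgue (f ` S) \<le> ennreal (L ^ DIM('e)) * emeasure lebesgue S"
  proof (rule ennreal_le_epsilon)
    fix e :: real assume "e > 0"
    define c where "c = L ^ DIM('e)"
    have c: "c > 0" using L by (simp add: c_def)
    obtain T where T: "open T" "S \<subseteq> T" "T - S \<in> lmeasurable" "emeasure lebesgue (T - S) < ennreal (e / c)"
      using sets_lebesgue_outer_open[OF S(1), of "e / c"] \<open>e > 0\<close> c by auto
    have "emeasure lebesgue (f ` S) \<le> emeasure lebesgue (f ` (U \<inter> T))"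
    proof (rule emeasure_mono)
      show "f ` (U \<inter> T) \<in> sets lebesgue"
        by (rule Lipschitz_image_lebesgue(2)[OF L]) (use U T(1) in \<open>auto simp: borel_open\<close>)
    qed (use S T in auto)
    also have "\<dots> \<le> ennreal c * emeasure lebesgue (U \<inter> T)"
      unfolding c_def by (rule emeasure_Lipschitz_image_open) (use U T(1) L inj in \<open>auto intro: inj_on_subset\<close>)
    also have "\<dots> \<le> ennreal c * (emeasure lebesgue S + ennreal (e / c))"
    proof (rule mult_left_mono)
      have "emeasure lebesgue (U \<inter> T) \<le> emeasure lebesgue (S \<union> (T - S))"
        using S T by (intro emeasure_mono) (auto simp: fmeasurableD)
      also have "\<dots> \<le> emeasure lebesgue S + emeasure lebesgue (T - S)"
        using S T by (intro emeasure_subadditive) (auto simp: fmeasurableD)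
      finally show "emeasure lebesgue (U \<inter> T) \<le> emeasure lebesgue S + ennreal (e / c)"
        using T(4) by (meson add_left_mono less_imp_le order_trans)
    qed simp
    also have "\<dots> = ennreal c * emeasure lebesgue S + ennreal e"
      using c \<open>e > 0\<close> by (simp add: distrib_left ennreal_mult[symmetric])
    finally show "emeasure lebesgue (f ` S) \<le> ennreal (L ^ DIM('e)) * emeasure lebesgue S + ennreal e"
      by (simp add: c_def)
  qed
qed

text \<open>The image measure is compared with a multiple of Lebesgue measure. An upper bound is
  enough to transport convergence, so the Lipschitz constant of the inverse stands in for the
  Jacobian determinant.\<close>

lemma nn_integral_bi_Lipschitz_compose:
  fixes \<Phi> \<Psi> :: "'e::euclidean_space \<Rightarrow> 'e"
  assumes B: "open B1" "open B2" "open (\<Phi> ` B1)" "\<Phi> ` B1 \<subseteq> B2"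
    and inv: "\<And>y. y \<in> B1 \<Longrightarrow> \<Psi> (\<Phi> y) = y" and inj: "inj_on \<Psi> B2"
    and L: "L > 0" "\<And>x y. x \<in> B2 \<Longrightarrow> y \<in> B2 \<Longrightarrow> norm (\<Psi> x - \<Psi> y) \<le> L * norm (x - y)"
  shows "\<Phi> \<in> measurable (lebesgue_on B1) (lebesgue_on B2)"
    "F \<in> borel_measurable (lebesgue_on B2) \<Longrightarrow>
      (\<integral>\<^sup>+y. F (\<Phi> y) \<partial>lebesgue_on B1) \<le> ennreal (L ^ DIM('e)) * (\<integral>\<^sup>+z. F z \<partial>lebesgue_on B2)"
proof -
  have Bl: "B1 \<in> sets lebesgue" "B2 \<in> sets lebesgue" "\<Phi> ` B1 \<in> sets lebesgue"
    using B by (simp_all add: borel_open)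
  \<comment> \<open>Preimages under \<open>\<Phi>\<close> are images under the Lipschitz map
    \<open>\<Psi>\<close>, which yields both their measurability and the bound on their
    measure.\<close>
  have pre: "\<Phi> -` A \<inter> B1 = \<Psi> ` (A \<inter> \<Phi> ` B1)" for A
  proof
    show "\<Phi> -` A \<inter> B1 \<subseteq> \<Psi> ` (A \<inter> \<Phi> ` B1)"
      using inv by (force intro: rev_image_eqI)
    show "\<Psi> ` (A \<inter> \<Phi> ` B1) \<subseteq> \<Phi> -` A \<inter> B1"
      using inv by auto
  qed
  have preimg: "\<Phi> -` A \<inter> B1 \<in> sets lebesgue"
    "emeasure lebesgue (\<Phi> -` A \<inter> B1) \<le> ennreal (L ^ DIM('e)) * emeasure lebesgue A"
    if A: "A \<in> sets lebesgue" "A \<subseteq> B2" for A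
  proof -
    have A': "A \<inter> \<Phi> ` B1 \<in> sets lebesgue" "A \<inter> \<Phi> ` B1 \<subseteq> B2" using A Bl by auto
    show "\<Phi> -` A \<inter> B1 \<in> sets lebesgue"
      unfolding pre by (rule emeasure_Lipschitz_image(1)[OF B(2) inj L A'])
    have "emeasure lebesgue (\<Psi> ` (A \<inter> \<Phi> ` B1)) \<le> ennreal (L ^ DIM('e)) * emeasure lebesgue (A \<inter> \<Phi> ` B1)"
      by (rule emeasure_Lipschitz_image(2)[OF B(2) inj L A'])
    also have "\<dots> \<le> ennreal (L ^ DIM('e)) * emeasure lebesgue A"
      using A Bl by (intro mult_left_mono emeasure_mono) auto
    finally show "emeasure lebesgue (\<Phi> -` A \<inter> B1) \<le> ennreal (L ^ DIM('e)) * emeasure lebesgue A"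
      unfolding pre .
  qed
  show m: "\<Phi> \<in> measurable (lebesgue_on B1) (lebesgue_on B2)"
  proof (rule measurableI)
    show "\<Phi> x \<in> space (lebesgue_on B2)" if "x \<in> space (lebesgue_on B1)" for x using that B(4) by auto
    show "\<Phi> -` A \<inter> space (lebesgue_on B1) \<in> sets (lebesgue_on B1)" if "A \<in> sets (lebesgue_on B2)" for A
      using that preimg(1)[of A] Bl by (auto simp: sets_restrict_space_iff)
  qed
  show "(\<integral>\<^sup>+y. F (\<Phi> y) \<partial>lebesgue_on B1) \<le> ennreal (L ^ DIM('e)) * (\<integral>\<^sup>+z. F z \<partial>lebesgue_on B2)"
    if F: "F \<in> borel_measurable (lebesgue_on B2)"
  proof -
    let ?c = "ennreal (L ^ DIM('e))"
    have "(\<integral>\<^sup>+y. F (\<Phi> y) \<partial>lebesgue_on B1) = (\<integral>\<^sup>+z. F z \<partial>distr (lebesgue_on B1) (lebesgue_on B2) \<Phi>)"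
      by (rule nn_integral_distr[symmetric, OF m]) (use F in simp)
    also have "\<dots> \<le> (\<integral>\<^sup>+z. F z \<partial>scale_measure ?c (lebesgue_on B2))"
    proof (rule nn_integral_mono_measure)
      show "distr (lebesgue_on B1) (lebesgue_on B2) \<Phi> \<le> scale_measure ?c (lebesgue_on B2)"
      proof (subst le_measure, simp, intro ballI)
        fix A assume "A \<in> sets (distr (lebesgue_on B1) (lebesgue_on B2) \<Phi>)"
        then have A: "A \<in> sets (lebesgue_on B2)" "A \<in> sets lebesgue" "A \<subseteq> B2"
          using Bl by (auto simp: sets_restrict_space_iff)
        have "emeasure (distr (lebesgue_on B1) (lebesgue_on B2) \<Phi>) A = emeasure lebesgue (\<Phi> -` A \<inter> B1)"
          using emeasure_distr[OF m A(1)] Bl by (simp add: emeasure_restrict_space)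
        also have "\<dots> \<le> ?c * emeasure lebesgue A" by (rule preimg(2)[OF A(2,3)])
        also have "\<dots> = emeasure (scale_measure ?c (lebesgue_on B2)) A"
          using A Bl by (simp add: emeasure_restrict_space)
        finally show "emeasure (distr (lebesgue_on B1) (lebesgue_on B2) \<Phi>) A
          \<le> emeasure (scale_measure ?c (lebesgue_on B2)) A" .
      qed
    qed simp
    also have "\<dots> = ?c * (\<integral>\<^sup>+z. F z \<partial>lebesgue_on B2)" by (rule nn_integral_scale_measure[OF F])
    finally show ?thesis .
  qed
qed

lemma L1_tendsto_compose:
  fixes \<Phi> \<Psi> :: "'e::euclidean_space \<Rightarrow> 'e"
  assumes B: "open B1" "open B2" "open (\<Phi> ` B1)" "\<Phi> ` B1 \<subseteq> B2"
    and inv: "\<And>y. y \<in> B1 \<Longrightarrow> \<Psi> (\<Phi> y) = y" and inj: "inj_on \<Psi> B2"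
    and L: "L > 0" "\<And>x y. x \<in> B2 \<Longrightarrow> y \<in> B2 \<Longrightarrow> norm (\<Psi> x - \<Psi> y) \<le> L * norm (x - y)"
    and f: "L1_tendsto B2 f F"
  shows "L1_tendsto B1 (\<lambda>k y. f k (\<Phi> y)) (\<lambda>y. F (\<Phi> y))"
proof (rule L1_tendstoI_nn)
  note nb = nn_integral_bi_Lipschitz_compose[OF B inv inj L]
  note i = L1_tendstoD[OF f]
  have int: "integrable (lebesgue_on B1) (\<lambda>y. g (\<Phi> y))" if g: "integrable (lebesgue_on B2) g" for g :: "'e \<Rightarrow> real"
  proof (rule integrableI_bounded)
    show "(\<lambda>y. g (\<Phi> y)) \<in> borel_measurable (lebesgue_on B1)" using g by (intro measurable_compose[OF nb(1)]) auto
    have "(\<integral>\<^sup>+y. ennreal (norm (g (\<Phi> y))) \<partial>lebesgue_on B1)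
      \<le> ennreal (L ^ DIM('e)) * (\<integral>\<^sup>+z. ennreal (norm (g z)) \<partial>lebesgue_on B2)"
      using g by (intro nb(2)[of "\<lambda>z. ennreal (norm (g z))"]) auto
    also have "\<dots> < \<infinity>" using g by (simp add: integrable_iff_bounded ennreal_mult_less_top)
    finally show "(\<integral>\<^sup>+y. ennreal (norm (g (\<Phi> y))) \<partial>lebesgue_on B1) < \<infinity>" .
  qed
  show "integrable (lebesgue_on B1) (\<lambda>y. f k (\<Phi> y))" "integrable (lebesgue_on B1) (\<lambda>y. F (\<Phi> y))" for k
    using i by (auto intro: int)
  have "(\<lambda>k. ennreal (L ^ DIM('e)) * ennreal (LINT z|lebesgue_on B2. \<bar>f k z - F z\<bar>)) \<longlonglongrightarrow> ennreal (L ^ DIM('e)) * ennreal 0"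
    using i(3) by (intro ennreal_tendsto_cmult tendsto_ennrealI) auto
  then have lim: "(\<lambda>k. ennreal (L ^ DIM('e)) * ennreal (LINT z|lebesgue_on B2. \<bar>f k z - F z\<bar>)) \<longlonglongrightarrow> 0" by simp
  show "(\<lambda>k. \<integral>\<^sup>+y. ennreal \<bar>f k (\<Phi> y) - F (\<Phi> y)\<bar> \<partial>lebesgue_on B1) \<longlonglongrightarrow> 0"
  proof (rule tendsto_sandwich[OF _ _ tendsto_const lim], simp, intro always_eventually allI)
    fix k
    have "(\<integral>\<^sup>+y. ennreal \<bar>f k (\<Phi> y) - F (\<Phi> y)\<bar> \<partial>lebesgue_on B1)
      \<le> ennreal (L ^ DIM('e)) * (\<integral>\<^sup>+z. ennreal \<bar>f k z - F z\<bar> \<partial>lebesgue_on B2)"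
      using i(1)[of k] i(2) by (intro nb(2)[of "\<lambda>z. ennreal \<bar>f k z - F z\<bar>"]) auto
    also have "(\<integral>\<^sup>+z. ennreal \<bar>f k z - F z\<bar> \<partial>lebesgue_on B2) = ennreal (LINT z|lebesgue_on B2. \<bar>f k z - F z\<bar>)"
      using i(1)[of k] i(2) by (intro nn_integral_eq_integral) auto
    finally show "(\<integral>\<^sup>+y. ennreal \<bar>f k (\<Phi> y) - F (\<Phi> y)\<bar> \<partial>lebesgue_on B1)
      \<le> ennreal (L ^ DIM('e)) * ennreal (LINT z|lebesgue_on B2. \<bar>f k z - F z\<bar>)" .
  qed
qed

text \<open>The approximating functions are composed with \<open>\<Phi>\<close>, which keeps them
  C1; the L1 convergence survives because \<open>\<Psi>\<close> is Lipschitz on small balls.\<close>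

theorem has_weak_derivative_on_diffeomorphism:
  fixes \<Phi> \<Psi> :: "'e::euclidean_space \<Rightarrow> 'e"
  assumes \<Omega>: "open \<Omega>1" "open \<Omega>2" and \<Phi>: "has_C1_derivative_on \<Phi> \<Phi>' \<Omega>1" and \<Psi>: "has_C1_derivative_on \<Psi> \<Psi>' \<Omega>2"
    and inv: "\<And>y. y \<in> \<Omega>1 \<Longrightarrow> \<Phi> y \<in> \<Omega>2 \<and> \<Psi> (\<Phi> y) = y" "\<And>z. z \<in> \<Omega>2 \<Longrightarrow> \<Psi> z \<in> \<Omega>1 \<and> \<Phi> (\<Psi> z) = z"
    and h: "has_weak_derivative_on h h' \<Omega>2"
  shows "has_weak_derivative_on (\<lambda>y. h (\<Phi> y)) (\<lambda>y \<xi>. h' (\<Phi> y) (\<Phi>' y \<xi>)) \<Omega>1"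
proof (rule has_weak_derivative_onI_C1_approximated[OF \<Omega>(1)])
  show "linear (\<lambda>\<xi>. h' (\<Phi> y) (\<Phi>' y \<xi>))" if "y \<in> \<Omega>1" for y
    using linear_compose[OF has_C1_derivative_onD(3)[OF \<Phi> that] has_weak_derivative_onD(2)[OF h]] inv(1)[OF that]
    by (simp add: o_def)
  fix x assume x: "x \<in> \<Omega>1"
  then obtain r2 where r2: "r2 > 0" "cball (\<Phi> x) r2 \<subseteq> \<Omega>2" using inv(1) \<Omega>(2) open_contains_cball_eq by blast
  define B2 where "B2 = ball (\<Phi> x) r2"
  \<comment> \<open>The ball is convex, so the mean value inequality provides the Lipschitz bound of
    the inverse map that \<open>L1_tendsto_compose\<close> requires.\<close>
  obtain L where L: "L > 0" "\<And>y z. y \<in> cball (\<Phi> x) r2 \<Longrightarrow> z \<in> cball (\<Phi> x) r2 \<Longrightarrow> norm (\<Psi> y - \<Psi> z) \<le> L * norm (y - z)"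
    by (rule has_C1_derivative_on_Lipschitz[OF \<Psi> compact_cball r2(2) convex_cball]) blast
  have "open (\<Omega>1 \<inter> \<Phi> -` B2)"
    by (rule continuous_open_preimage[OF has_C1_derivative_onD(4)[OF \<Phi>] \<Omega>(1)]) (simp add: B2_def)
  moreover have "x \<in> \<Omega>1 \<inter> \<Phi> -` B2" using x r2(1) by (simp add: B2_def)
  ultimately obtain r1 where r1: "r1 > 0" "cball x r1 \<subseteq> \<Omega>1 \<inter> \<Phi> -` B2" using open_contains_cball_eq by blast
  define B1 where "B1 = ball x r1"
  have B1: "B1 \<subseteq> cball x r1" "B1 \<subseteq> \<Omega>1" using r1(2) ball_subset_cball unfolding B1_def by blast+
  have B2: "B2 \<subseteq> \<Omega>2" using r2(2) ball_subset_cball unfolding B2_def by blast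
  \<comment> \<open>Rewritten as a preimage under the continuous map \<open>\<Psi>\<close>, the
    image of \<open>B1\<close> is seen to be open.\<close>
  have "\<Phi> ` B1 = \<Omega>2 \<inter> \<Psi> -` B1"
  proof
    show "\<Phi> ` B1 \<subseteq> \<Omega>2 \<inter> \<Psi> -` B1" using inv(1) B1(2) by (auto simp: subset_iff)
    show "\<Omega>2 \<inter> \<Psi> -` B1 \<subseteq> \<Phi> ` B1" using inv(2) by (force simp: image_iff)
  qed
  then have op: "open (\<Phi> ` B1)"
    using continuous_open_preimage[OF has_C1_derivative_onD(4)[OF \<Psi>] \<Omega>(2), of B1] by (simp add: B1_def)
  have sub: "\<Phi> ` B1 \<subseteq> B2" using r1(2) B1(1) by blast
  have opB: "open B1" "open B2" by (auto simp: B1_def B2_def)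
  have inv': "\<Psi> (\<Phi> y) = y" if "y \<in> B1" for y using inv(1) B1(2) that by blast
  have L': "norm (\<Psi> y - \<Psi> z) \<le> L * norm (y - z)" if "y \<in> B2" "z \<in> B2" for y z
    using L(2) that ball_subset_cball unfolding B2_def by blast
  have inj: "inj_on \<Psi> B2" using inv(2) B2 by (metis inj_onI subset_iff)
  have comp: "L1_tendsto B1 (\<lambda>k y. f k (\<Phi> y)) (\<lambda>y. F (\<Phi> y))" if "L1_tendsto B2 f F" for f F
    by (rule L1_tendsto_compose[OF opB op sub _ inj L(1) _ that]) (use inv' L' in auto)
  obtain C where C: "C > 0" "\<And>y \<xi>. y \<in> cball x r1 \<Longrightarrow> norm (\<Phi>' y \<xi>) \<le> C * norm \<xi>"
    by (rule has_C1_derivative_on_bounded[OF \<Phi> compact_cball[of x r1]]) (use r1(2) in auto)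
  obtain g g' where g: "\<And>k. has_C1_derivative_on (g k) (g' k) B2" "L1_tendsto B2 g h"
    "\<And>\<xi>. L1_tendsto B2 (\<lambda>k y. g' k y \<xi>) (\<lambda>y. h' y \<xi>)"
    using has_weak_derivative_imp_C1_approximated[OF h \<Omega>(2) r2(2)] unfolding C1_approximated_def B2_def[symmetric] by metis
  have 1: "has_C1_derivative_on (\<lambda>y. g k (\<Phi> y)) (\<lambda>y \<xi>. g' k (\<Phi> y) (\<Phi>' y \<xi>)) B1" for k
    by (rule has_C1_derivative_on_compose[OF has_C1_derivative_on_subset[OF \<Phi> B1(2)] g(1) sub])
  have 2: "L1_tendsto B1 (\<lambda>k y. g k (\<Phi> y)) (\<lambda>y. h (\<Phi> y))" by (rule comp[OF g(2)])
  have 3: "L1_tendsto B1 (\<lambda>k y. g' k (\<Phi> y) (\<Phi>' y \<xi>)) (\<lambda>y. h' (\<Phi> y) (\<Phi>' y \<xi>))" for \<xi>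
  proof -
    \<comment> \<open>The direction \<open>\<Phi>' y \<xi>\<close> varies with \<open>y\<close>; its
      basis coefficients are bounded and measurable multipliers.\<close>
    have "L1_tendsto B1 (\<lambda>k y. \<Sum>b\<in>Basis. g' k (\<Phi> y) b * (\<Phi>' y \<xi> \<bullet> b)) (\<lambda>y. \<Sum>b\<in>Basis. h' (\<Phi> y) b * (\<Phi>' y \<xi> \<bullet> b))"
    proof (rule L1_tendsto_sum, rule L1_tendsto_mult[OF comp[OF g(3)]])
      fix b :: 'e assume b: "b \<in> Basis"
      have "continuous_on B1 (\<lambda>y. \<Phi>' y \<xi> \<bullet> b)"
        by (intro continuous_intros continuous_on_subset[OF has_C1_derivative_onD(2)[OF \<Phi>] B1(2)])
      then show "(\<lambda>y. \<Phi>' y \<xi> \<bullet> b) \<in> borel_measurable (lebesgue_on B1)"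
        by (rule continuous_imp_measurable_on_sets_lebesgue) (simp add: B1_def)
      show "\<bar>\<Phi>' y \<xi> \<bullet> b\<bar> \<le> C * norm \<xi>" if "y \<in> B1" for y
        using C(2)[of y \<xi>] Basis_le_norm[OF b, of "\<Phi>' y \<xi>"] B1(1) that by force
    qed
    then have "L1_tendsto B1 (\<lambda>k y. g' k (\<Phi> y) (\<Phi>' y \<xi>)) (\<lambda>y. \<Sum>b\<in>Basis. h' (\<Phi> y) b * (\<Phi>' y \<xi> \<bullet> b))"
    proof (rule L1_tendsto_cong_seq)
      fix k y assume "y \<in> B1"
      then have "linear (g' k (\<Phi> y))" using sub by (intro has_C1_derivative_onD(3)[OF g(1)]) auto
      from linear_functional_expansion[OF this, of "\<Phi>' y \<xi>"]
      show "(\<Sum>b\<in>Basis. g' k (\<Phi> y) b * (\<Phi>' y \<xi> \<bullet> b)) = g' k (\<Phi> y) (\<Phi>' y \<xi>)"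
        by (simp add: mult.commute)
    qed
    then show ?thesis
    proof (rule L1_tendsto_cong)
      have "(\<Sum>b\<in>Basis. h' (\<Phi> y) b * (\<Phi>' y \<xi> \<bullet> b)) = h' (\<Phi> y) (\<Phi>' y \<xi>)" if "y \<in> B1" for y
        using linear_functional_expansion[OF has_weak_derivative_onD(2)[OF h], of "\<Phi> y" "\<Phi>' y \<xi>"] inv(1) B1(2) that
        by (auto simp: mult.commute)
      then have "{y \<in> B1. (\<Sum>b\<in>Basis. h' (\<Phi> y) b * (\<Phi>' y \<xi> \<bullet> b)) \<noteq> h' (\<Phi> y) (\<Phi>' y \<xi>)} = {}" by blast
      then show "negligible {y \<in> B1. (\<Sum>b\<in>Basis. h' (\<Phi> y) b * (\<Phi>' y \<xi> \<bullet> b)) \<noteq> h' (\<Phi> y) (\<Phi>' y \<xi>)}"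
        by (simp only: negligible_empty)
    qed (simp add: B1_def)
  qed
  have "C1_approximated (\<lambda>y. h (\<Phi> y)) (\<lambda>y \<xi>. h' (\<Phi> y) (\<Phi>' y \<xi>)) B1"
    unfolding C1_approximated_def
    by (rule exI[of _ "\<lambda>k y. g k (\<Phi> y)"], rule exI[of _ "\<lambda>k y \<xi>. g' k (\<Phi> y) (\<Phi>' y \<xi>)"])
      (intro conjI allI 1 2 3)
  then show "\<exists>r>0. ball x r \<subseteq> \<Omega>1 \<and> C1_approximated (\<lambda>y. h (\<Phi> y)) (\<lambda>y \<xi>. h' (\<Phi> y) (\<Phi>' y \<xi>)) (ball x r)"
    using r1(1) B1(2) unfolding B1_def by blast
qed

section \<open>Charts\<close>

context
  fixes M :: "('a::{t2_space,second_countable_topology}, 'e::euclidean_space) chart set"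
  assumes dm: "differentiable_manifold M"
begin

lemma chart_topology:
  assumes "c \<in> M"
  shows "open (chart_dom c)" "open (chart_ran c)"
    "homeomorphism (chart_dom c) (chart_ran c) (chart_map c) (chart_inv c)"
  using dm assms unfolding differentiable_manifold_def topological_chart_def by blast+

lemma chart_simps:
  assumes "c \<in> M"
  shows "x \<in> chart_dom c \<Longrightarrow> chart_inv c (chart_map c x) = x"
    "y \<in> chart_ran c \<Longrightarrow> chart_map c (chart_inv c y) = y"
    "y \<in> chart_ran c \<Longrightarrow> chart_inv c y \<in> chart_dom c"
proof -
  note h = chart_topology(3)[OF assms]
  show "x \<in> chart_dom c \<Longrightarrow> chart_inv c (chart_map c x) = x" by (rule homeomorphism_apply1[OF h])
  show "y \<in> chart_ran c \<Longrightarrow> chart_map c (chart_inv c y) = y" by (rule homeomorphism_apply2[OF h])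
  show "y \<in> chart_ran c \<Longrightarrow> chart_inv c y \<in> chart_dom c" using homeomorphism_image2[OF h] by blast
qed

lemma chart_continuous:
  assumes "c \<in> M"
  shows "continuous_on (chart_dom c) (chart_map c)" "continuous_on (chart_ran c) (chart_inv c)"
  using chart_topology(3)[OF assms] by (auto simp: homeomorphism_def)

lemma chart_covers: "\<exists>c\<in>M. x \<in> chart_dom c"
  using dm unfolding differentiable_manifold_def by (metis UNIV_I UN_iff)

lemma chart_image_open:
  assumes "c \<in> M" "open W" "W \<subseteq> chart_dom c"
  shows "open (chart_map c ` W)"
proof -
  have "chart_map c ` W = chart_ran c \<inter> chart_inv c -` W"
  proof
    show "chart_map c ` W \<subseteq> chart_ran c \<inter> chart_inv c -` W"
      using assms(3) chart_simps(1)[OF assms(1)] by auto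
    show "chart_ran c \<inter> chart_inv c -` W \<subseteq> chart_map c ` W"
    proof
      fix y assume y: "y \<in> chart_ran c \<inter> chart_inv c -` W"
      show "y \<in> chart_map c ` W"
        by (rule image_eqI[of _ _ "chart_inv c y"]) (use y chart_simps(2)[OF assms(1), of y] in auto)
    qed
  qed
  then show ?thesis
    using continuous_open_preimage[OF chart_continuous(2) chart_topology(2) assms(2)] assms(1) by simp
qed

lemma chart_preimage_open:
  assumes "c \<in> M" "open W"
  shows "open (chart_dom c \<inter> chart_map c -` W)"
  using continuous_open_preimage[OF chart_continuous(1) chart_topology(1) assms(2)] assms(1) by simp

lemma transition_C1:
  assumes "c \<in> M" "d \<in> M"
  shows "has_C1_derivative_on (chart_map d \<circ> chart_inv c)
    (\<lambda>y. frechet_derivative (chart_map d \<circ> chart_inv c) (at y)) (chart_map c ` (chart_dom c \<inter> chart_dom d))"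
proof -
  have "C1_compatible c d" using dm assms unfolding differentiable_manifold_def by blast
  then show ?thesis unfolding C1_compatible_def Ck_on_1_iff by blast
qed

lemma transition_has_derivative:
  assumes "c \<in> M" "d \<in> M" "x \<in> chart_dom c" "x \<in> chart_dom d"
  shows "(chart_map d \<circ> chart_inv c has_derivative
    frechet_derivative (chart_map d \<circ> chart_inv c) (at (chart_map c x))) (at (chart_map c x))"
  using has_C1_derivative_onD(1)[OF transition_C1[OF assms(1,2)]] assms(3,4) by blast

text \<open>Near the point, \<open>f\<close> read in \<open>c\<close> is \<open>f\<close> read in
  \<open>d\<close> after the change of charts. The codomain of \<open>f\<close> is free: for a chart
  map this becomes the compatibility of tangent vectors, for a real function the independence of
  \<open>differential\<close> of the chart.\<close>

lemma chart_change_has_derivative: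
  assumes c: "c \<in> M" "x \<in> chart_dom c" and d: "d \<in> M" "x \<in> chart_dom d"
    and f: "(f \<circ> chart_inv d has_derivative f') (at (chart_map d x))"
  shows "(f \<circ> chart_inv c has_derivative
    (\<lambda>\<xi>. f' (frechet_derivative (chart_map d \<circ> chart_inv c) (at (chart_map c x)) \<xi>))) (at (chart_map c x))"
proof -
  let ?S = "chart_map c ` (chart_dom c \<inter> chart_dom d)"
  have "(f \<circ> chart_inv d has_derivative f') (at ((chart_map d \<circ> chart_inv c) (chart_map c x)))"
    using f chart_simps(1)[OF c] by simp
  from has_derivative_compose[OF transition_has_derivative[OF c(1) d(1) c(2) d(2)] this]
  have D: "((\<lambda>y. (f \<circ> chart_inv d) ((chart_map d \<circ> chart_inv c) y)) has_derivative
    (\<lambda>\<xi>. f' (frechet_derivative (chart_map d \<circ> chart_inv c) (at (chart_map c x)) \<xi>))) (at (chart_map c x))" .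
  have "open ?S" using chart_image_open[OF c(1)] chart_topology(1) c d by (simp add: open_Int)
  moreover have "chart_map c x \<in> ?S" using c d by blast
  moreover have "(f \<circ> chart_inv d) ((chart_map d \<circ> chart_inv c) y) = (f \<circ> chart_inv c) y" if "y \<in> ?S" for y
    using that chart_simps(1)[OF c(1)] chart_simps(1)[OF d(1)] by auto
  ultimately show ?thesis using has_derivative_transform_within_open[OF D] by blast
qed

lemma chart_change_frechet:
  assumes c: "c \<in> M" "x \<in> chart_dom c" and d: "d \<in> M" "x \<in> chart_dom d"
    and f: "(f \<circ> chart_inv d) differentiable (at (chart_map d x))"
  shows "frechet_derivative (f \<circ> chart_inv c) (at (chart_map c x)) \<xi> =
    frechet_derivative (f \<circ> chart_inv d) (at (chart_map d x))
      (frechet_derivative (chart_map d \<circ> chart_inv c) (at (chart_map c x)) \<xi>)"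
proof -
  have "(f \<circ> chart_inv d has_derivative frechet_derivative (f \<circ> chart_inv d) (at (chart_map d x))) (at (chart_map d x))"
    using f by (simp add: frechet_derivative_works)
  from frechet_derivative_at[OF chart_change_has_derivative[OF c d this]] show ?thesis by (metis (mono_tags))
qed

section \<open>Tangent vectors in coordinates\<close>

lemma transition_self:
  assumes "c \<in> M" "x \<in> chart_dom c"
  shows "frechet_derivative (chart_map c \<circ> chart_inv c) (at (chart_map c x)) \<xi> = \<xi>"
proof -
  have "((\<lambda>y. y) has_derivative (\<lambda>\<xi>. \<xi>)) (at (chart_map c x))" by simp
  then have "(chart_map c \<circ> chart_inv c has_derivative (\<lambda>\<xi>. \<xi>)) (at (chart_map c x))"
    by (rule has_derivative_transform_within_open[OF _ chart_topology(2)[OF assms(1)]])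
      (use assms chart_simps(2) in auto)
  from frechet_derivative_at[OF this] show ?thesis by metis
qed

lemma tangent_spaceD:
  assumes "v \<in> tangent_space M x" "c \<in> M" "d \<in> M" "x \<in> chart_dom c" "x \<in> chart_dom d"
  shows "v d = frechet_derivative (chart_map d \<circ> chart_inv c) (at (chart_map c x)) (v c)"
  using assms unfolding tangent_space_def by blast

text \<open>The compatibility of components demanded by \<open>tangent_space\<close> is the chain
  rule for three charts.\<close>

lemma chart_inv_deriv_tangent:
  assumes c: "c \<in> M" and y: "y \<in> chart_ran c"
  shows "fst (chart_inv_deriv M c y \<xi>) = chart_inv c y"
    "snd (chart_inv_deriv M c y \<xi>) \<in> tangent_space M (chart_inv c y)"
    "chart_inv_deriv M c y \<xi> \<in> tangent_bundle M"
proof -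
  show 1: "fst (chart_inv_deriv M c y \<xi>) = chart_inv c y" by (simp add: chart_inv_deriv_def)
  have x: "chart_inv c y \<in> chart_dom c" "chart_map c (chart_inv c y) = y"
    using chart_simps[OF c] y by auto
  have tr: "snd (chart_inv_deriv M c y \<xi>) e = frechet_derivative (chart_map e \<circ> chart_inv d)
      (at (chart_map d (chart_inv c y))) (snd (chart_inv_deriv M c y \<xi>) d)"
    if d: "d \<in> M" "chart_inv c y \<in> chart_dom d" and e: "e \<in> M" "chart_inv c y \<in> chart_dom e" for d e
  proof -
    have "chart_map e \<circ> chart_inv d differentiable at (chart_map d (chart_inv c y))"
      using transition_has_derivative[OF d(1) e(1) d(2) e(2)] by (auto simp: differentiable_def)
    from chart_change_frechet[OF c x(1) d this, of \<xi>] show ?thesis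
      using d e x(2) by (simp add: chart_inv_deriv_def)
  qed
  show 2: "snd (chart_inv_deriv M c y \<xi>) \<in> tangent_space M (chart_inv c y)"
    unfolding tangent_space_def mem_Collect_eq
  proof (intro conjI ballI allI impI)
    show "snd (chart_inv_deriv M c y \<xi>) e = frechet_derivative (chart_map e \<circ> chart_inv d)
      (at (chart_map d (chart_inv c y))) (snd (chart_inv_deriv M c y \<xi>) d)"
      if "d \<in> M" "e \<in> M" "chart_inv c y \<in> chart_dom d \<and> chart_inv c y \<in> chart_dom e" for d e
      using tr that by blast
    show "snd (chart_inv_deriv M c y \<xi>) d = 0" if "\<not> (d \<in> M \<and> chart_inv c y \<in> chart_dom d)" for d
      unfolding chart_inv_deriv_def snd_conv using that by (rule if_not_P)
  qed
  then show "chart_inv_deriv M c y \<xi> \<in> tangent_bundle M"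
    unfolding tangent_bundle_def using 1 by (metis SigmaI UNIV_I prod.collapse)
qed

text \<open>A tangent vector is determined by its component in one chart, so a statement on a whole
  fibre can be tested on the vectors \<open>chart_inv_deriv M c y \<xi>\<close>.\<close>

lemma tangent_vector_eq_chart_inv_deriv:
  assumes v: "v \<in> tangent_space M x" and c: "c \<in> M" "x \<in> chart_dom c"
  shows "(x, v) = chart_inv_deriv M c (chart_map c x) (v c)"
proof -
  have "v d = snd (chart_inv_deriv M c (chart_map c x) (v c)) d" for d
  proof (cases "d \<in> M \<and> x \<in> chart_dom d")
    case True
    then show ?thesis using tangent_spaceD[OF v c(1) _ c(2)] chart_simps(1)[OF c] by (simp add: chart_inv_deriv_def)
  next
    case False
    then have "v d = 0" using v unfolding tangent_space_def by blast
    then show ?thesis using False chart_simps(1)[OF c] by (auto simp: chart_inv_deriv_def)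
  qed
  then show ?thesis using chart_simps(1)[OF c] by (intro prod_eqI ext) (auto simp: chart_inv_deriv_def)
qed

lemma chart_inv_deriv_linear:
  assumes c: "c \<in> M" and y: "y \<in> chart_ran c"
  shows "snd (chart_inv_deriv M c y (a *\<^sub>R \<xi> + b *\<^sub>R \<zeta>))
    = (\<lambda>d. a *\<^sub>R snd (chart_inv_deriv M c y \<xi>) d + b *\<^sub>R snd (chart_inv_deriv M c y \<zeta>) d)"
proof -
  have x: "chart_inv c y \<in> chart_dom c" "chart_map c (chart_inv c y) = y"
    using chart_simps[OF c] y by auto
  have "linear (frechet_derivative (chart_map d \<circ> chart_inv c) (at y))"
    if "d \<in> M" "chart_inv c y \<in> chart_dom d" for d
    using transition_has_derivative[OF c that(1) x(1) that(2)] x(2) has_derivative_linear by auto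
  then show ?thesis by (auto simp: chart_inv_deriv_def linear_add linear_scale fun_eq_iff)
qed

lemma linear_on_fibre_chart_inv_deriv:
  assumes l: "linear_on_fibre (tangent_space M (chart_inv c y)) (\<lambda>v. \<omega> (chart_inv c y, v))"
    and c: "c \<in> M" and y: "y \<in> chart_ran c"
  shows "linear (\<lambda>\<xi>. \<omega> (chart_inv_deriv M c y \<xi>))"
proof -
  have *: "\<omega> (chart_inv_deriv M c y (a *\<^sub>R \<xi> + b *\<^sub>R \<zeta>))
      = a *\<^sub>R \<omega> (chart_inv_deriv M c y \<xi>) + b *\<^sub>R \<omega> (chart_inv_deriv M c y \<zeta>)" for a b \<xi> \<zeta>
  proof -
    have e: "\<omega> (chart_inv_deriv M c y \<xi>) = \<omega> (chart_inv c y, snd (chart_inv_deriv M c y \<xi>))" for \<xi>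
      by (simp add: chart_inv_deriv_def)
    show ?thesis
      unfolding e chart_inv_deriv_linear[OF c y]
      using l chart_inv_deriv_tangent(2)[OF c y] unfolding linear_on_fibre_def by blast
  qed
  show ?thesis
  proof (rule linearI)
    show "\<omega> (chart_inv_deriv M c y (\<xi> + \<zeta>)) = \<omega> (chart_inv_deriv M c y \<xi>) + \<omega> (chart_inv_deriv M c y \<zeta>)" for \<xi> \<zeta>
      using *[of 1 \<xi> 1 \<zeta>] by simp
    show "\<omega> (chart_inv_deriv M c y (r *\<^sub>R \<xi>)) = r *\<^sub>R \<omega> (chart_inv_deriv M c y \<xi>)" for r \<xi>
      using *[of r \<xi> 0 \<xi>] by simp
  qed
qed

text \<open>Frees \<open>differential\<close> from the chart chosen by \<open>SOME\<close>, by the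
  chain rule between the two charts.\<close>

lemma differential_eq:
  assumes f: "C1 M f" and X: "(p, v) \<in> tangent_bundle M" and d: "d \<in> M" "p \<in> chart_dom d"
  shows "differential M f (p, v) = frechet_derivative (f \<circ> chart_inv d) (at (chart_map d p)) (v d)"
proof -
  define c where "c = (SOME c. c \<in> M \<and> p \<in> chart_dom c)"
  have c: "c \<in> M" "p \<in> chart_dom c"
    using someI_ex[of "\<lambda>c. c \<in> M \<and> p \<in> chart_dom c"] chart_covers unfolding c_def by blast+
  have v: "v \<in> tangent_space M p" using X by (simp add: tangent_bundle_def)
  have "chart_map d p \<in> chart_ran d" using d by blast
  moreover have "has_C1_derivative_on (f \<circ> chart_inv d) (\<lambda>x. frechet_derivative (f \<circ> chart_inv d) (at x)) (chart_ran d)"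
    using f d(1) unfolding C1_def Ck_on_1_iff by blast
  ultimately have diff: "(f \<circ> chart_inv d) differentiable (at (chart_map d p))"
    using has_C1_derivative_onD(1) unfolding differentiable_def by blast
  have "differential M f (p, v) = frechet_derivative (f \<circ> chart_inv c) (at (chart_map c p)) (v c)"
    by (simp add: differential_def chart_deriv_def Let_def c_def)
  also have "\<dots> = frechet_derivative (f \<circ> chart_inv d) (at (chart_map d p)) (v d)"
    by (subst chart_change_frechet[OF c d diff]) (simp add: tangent_spaceD[OF v c(1) d(1) c(2) d(2)])
  finally show ?thesis .
qed

lemma almost_everywhere_iff:
  "almost_everywhere M P \<longleftrightarrow> (\<forall>c\<in>M. negligible {y \<in> chart_ran c. \<not> P (chart_inv c y)})"
proof -
  have "chart_map c ` {x \<in> chart_dom c. \<not> P x} = {y \<in> chart_ran c. \<not> P (chart_inv c y)}" if c: "c \<in> M" for c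
  proof
    show "chart_map c ` {x \<in> chart_dom c. \<not> P x} \<subseteq> {y \<in> chart_ran c. \<not> P (chart_inv c y)}"
      using chart_simps(1)[OF c] by auto
    show "{y \<in> chart_ran c. \<not> P (chart_inv c y)} \<subseteq> chart_map c ` {x \<in> chart_dom c. \<not> P x}"
    proof clarify
      fix x assume "\<not> P (chart_inv c (chart_map c x))" "x \<in> chart_dom c"
      then show "chart_map c x \<in> chart_map c ` {x \<in> chart_dom c. \<not> P x}"
        using chart_simps(1)[OF c] by auto
    qed
  qed
  then show ?thesis unfolding almost_everywhere_def by simp
qed

text \<open>Over a chart the coordinate vectors exhaust the fibre, so equality on fibres becomes the
  negligibility of a Euclidean set, common to all directions.\<close>

lemma ae_equal_on_fibres_iff:
  "ae_equal_on_fibres M \<alpha> \<beta> \<longleftrightarrow>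
    (\<forall>c\<in>M. negligible {y \<in> chart_ran c. \<exists>\<xi>. \<alpha> (chart_inv_deriv M c y \<xi>) \<noteq> \<beta> (chart_inv_deriv M c y \<xi>)})"
proof -
  have "(\<forall>v\<in>tangent_space M (chart_inv c y). \<alpha> (chart_inv c y, v) = \<beta> (chart_inv c y, v))
    \<longleftrightarrow> (\<forall>\<xi>. \<alpha> (chart_inv_deriv M c y \<xi>) = \<beta> (chart_inv_deriv M c y \<xi>))" if c: "c \<in> M" and y: "y \<in> chart_ran c" for c y
  proof (intro iffI allI ballI)
    fix \<xi> assume "\<forall>v\<in>tangent_space M (chart_inv c y). \<alpha> (chart_inv c y, v) = \<beta> (chart_inv c y, v)"
    then show "\<alpha> (chart_inv_deriv M c y \<xi>) = \<beta> (chart_inv_deriv M c y \<xi>)"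
      using chart_inv_deriv_tangent(2)[OF c y, of \<xi>] by (simp add: chart_inv_deriv_def)
  next
    fix v assume "\<forall>\<xi>. \<alpha> (chart_inv_deriv M c y \<xi>) = \<beta> (chart_inv_deriv M c y \<xi>)" "v \<in> tangent_space M (chart_inv c y)"
    then show "\<alpha> (chart_inv c y, v) = \<beta> (chart_inv c y, v)"
      using tangent_vector_eq_chart_inv_deriv[of v "chart_inv c y" c] c chart_simps(2,3)[OF c y] by simp
  qed
  then have "{y \<in> chart_ran c. \<not> (\<forall>v\<in>tangent_space M (chart_inv c y). \<alpha> (chart_inv c y, v) = \<beta> (chart_inv c y, v))}
    = {y \<in> chart_ran c. \<exists>\<xi>. \<alpha> (chart_inv_deriv M c y \<xi>) \<noteq> \<beta> (chart_inv_deriv M c y \<xi>)}" if "c \<in> M" for c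
    using that by blast
  then show ?thesis unfolding ae_equal_on_fibres_def almost_everywhere_iff by simp
qed

end

text \<open>Lindelof's theorem, with free indices so that an open set can carry data such as a local
  derivative or a cutoff. Indexing by \<open>nat\<close> allows countable unions of negligible sets
  as well as the choice of a least index.\<close>

lemma countable_subcover_sequence:
  fixes U :: "'i \<Rightarrow> 'a::second_countable_topology set"
  assumes "\<And>x. \<exists>i. P i \<and> x \<in> U i" "\<And>i. P i \<Longrightarrow> open (U i)"
  obtains s :: "nat \<Rightarrow> 'i" where "\<And>k. P (s k)" "\<And>x. \<exists>k. x \<in> U (s k)"
proof -
  obtain F where F: "F \<subseteq> U ` {i. P i}" "countable F" "\<Union>F = \<Union>(U ` {i. P i})"
    by (rule Lindelof[of "U ` {i. P i}"]) (use assms(2) in auto)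
  have cov: "\<Union>F = UNIV" using F(3) assms(1) by auto
  then have "F \<noteq> {}" by auto
  have "\<forall>S\<in>F. \<exists>i. P i \<and> S = U i" using F(1) by blast
  from bchoice[OF this] obtain p where p: "\<And>S. S \<in> F \<Longrightarrow> P (p S) \<and> S = U (p S)" by blast
  show ?thesis
  proof
    show "P (p (from_nat_into F k))" for k by (rule conjunct1[OF p[OF from_nat_into[OF \<open>F \<noteq> {}\<close>]]])
    fix x
    have "x \<in> \<Union>F" by (simp add: cov)
    then obtain S where S: "S \<in> F" "x \<in> S" by (rule UnionE)
    obtain k where k: "from_nat_into F k = S" using from_nat_into_surj[OF F(2) S(1)] ..
    have "x \<in> U (p S)" by (rule subst[OF conjunct2[OF p[OF S(1)]], of "\<lambda>T. x \<in> T"]) (rule S(2))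
    then show "\<exists>k. x \<in> U (p (from_nat_into F k))" using k by blast
  qed
qed

section \<open>Weak derivatives on manifolds\<close>

lemma has_weak_derivative_on_cong:
  fixes h :: "'e::euclidean_space \<Rightarrow> real"
  assumes "has_weak_derivative_on h h' \<Omega>" "open \<Omega>" "\<And>y. y \<in> \<Omega> \<Longrightarrow> h y = k y"
    "\<And>y \<xi>. y \<in> \<Omega> \<Longrightarrow> h' y \<xi> = k' y \<xi>"
  shows "has_weak_derivative_on k k' \<Omega>"
proof (rule has_weak_derivative_on_localI[OF assms(2)])
  show "linear (k' y)" if "y \<in> \<Omega>" for y
  proof -
    have "h' y = k' y" using assms(4)[OF that] by blast
    then show ?thesis using has_weak_derivative_onD(2)[OF assms(1) that] by simp
  qed
  have "{y \<in> \<Omega>. h y \<noteq> k y} = {}" "{y \<in> \<Omega>. \<exists>\<xi>. h' y \<xi> \<noteq> k' y \<xi>} = {}" using assms(3,4) by auto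
  then have n: "negligible {y \<in> \<Omega>. h y \<noteq> k y}" "negligible {y \<in> \<Omega>. \<exists>\<xi>. h' y \<xi> \<noteq> k' y \<xi>}"
    by (simp_all only: negligible_empty)
  show "\<exists>V k0 k0'. open V \<and> x \<in> V \<and> V \<subseteq> \<Omega> \<and> has_weak_derivative_on k0 k0' V \<and>
      negligible {y \<in> V. k0 y \<noteq> k y} \<and> negligible {y \<in> V. \<exists>\<xi>. k0' y \<xi> \<noteq> k' y \<xi>}" if "x \<in> \<Omega>" for x
    using that assms(1,2) n by blast
qed

lemma weak_derivative_chart_change:
  assumes dm: "differentiable_manifold M" and c: "c \<in> M" and d: "d \<in> M"
    and W: "open W" "W \<subseteq> chart_dom c" "W \<subseteq> chart_dom d"
    and w: "has_weak_derivative_on (g \<circ> chart_inv d) h' (chart_map d ` W)"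
  shows "has_weak_derivative_on (g \<circ> chart_inv c)
    (\<lambda>y \<xi>. h' (chart_map d (chart_inv c y)) (frechet_derivative (chart_map d \<circ> chart_inv c) (at y) \<xi>)) (chart_map c ` W)"
proof -
  have op: "open (chart_map c ` W)" "open (chart_map d ` W)"
    using chart_image_open[OF dm] c d W by auto
  have sub: "chart_map c ` W \<subseteq> chart_map c ` (chart_dom c \<inter> chart_dom d)"
    "chart_map d ` W \<subseteq> chart_map d ` (chart_dom d \<inter> chart_dom c)" using W by auto
  have "has_weak_derivative_on (\<lambda>y. (g \<circ> chart_inv d) ((chart_map d \<circ> chart_inv c) y))
    (\<lambda>y \<xi>. h' ((chart_map d \<circ> chart_inv c) y) (frechet_derivative (chart_map d \<circ> chart_inv c) (at y) \<xi>)) (chart_map c ` W)"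
  proof (rule has_weak_derivative_on_diffeomorphism[OF op
        has_C1_derivative_on_subset[OF transition_C1[OF dm c d] sub(1)]
        has_C1_derivative_on_subset[OF transition_C1[OF dm d c] sub(2)] _ _ w])
    show "(chart_map d \<circ> chart_inv c) y \<in> chart_map d ` W \<and>
        (chart_map c \<circ> chart_inv d) ((chart_map d \<circ> chart_inv c) y) = y" if "y \<in> chart_map c ` W" for y
      using that W chart_simps(1)[OF dm c] chart_simps(1)[OF dm d] by (auto simp: subset_iff)
    show "(chart_map c \<circ> chart_inv d) y \<in> chart_map c ` W \<and>
        (chart_map d \<circ> chart_inv c) ((chart_map c \<circ> chart_inv d) y) = y" if "y \<in> chart_map d ` W" for y
      using that W chart_simps(1)[OF dm c] chart_simps(1)[OF dm d] by (auto simp: subset_iff)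
  qed
  then show ?thesis
  proof (rule has_weak_derivative_on_cong[OF _ op(1)])
    show "(g \<circ> chart_inv d) ((chart_map d \<circ> chart_inv c) y) = (g \<circ> chart_inv c) y" if "y \<in> chart_map c ` W" for y
      using that W chart_simps(1)[OF dm c] chart_simps(1)[OF dm d] by (auto simp: subset_iff)
  qed simp
qed

text \<open>The hypothesis supplies one suitable chart around each point, whereas a weak derivative
  has to work in every chart of the maximal atlas. The local derivatives of countably many charts
  agree almost everywhere on overlaps and are patched together.\<close>

theorem is_weak_derivative_exists:
  fixes M :: "('a::{t2_space,second_countable_topology}, 'e::euclidean_space) chart set"
  assumes dm: "differentiable_manifold M" and g: "weakly_differentiable M g"
  shows "\<exists>\<omega>. is_weak_derivative M g \<omega>"
proof -
  define P where "P p \<longleftrightarrow> fst p \<in> M \<and> has_weak_derivative_on (g \<circ> chart_inv (fst p)) (snd p) (chart_ran (fst p))"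
    for p :: "('a, 'e) chart \<times> ('e \<Rightarrow> 'e \<Rightarrow> real)"
  obtain s where s: "\<And>k. P (s k)" "\<And>x. \<exists>k::nat. x \<in> chart_dom (fst (s k))"
  proof (rule countable_subcover_sequence[of P "\<lambda>p. chart_dom (fst p)"])
    show "\<exists>p. P p \<and> x \<in> chart_dom (fst p)" for x
    proof -
      obtain c h' where "c \<in> M" "x \<in> chart_dom c" "has_weak_derivative_on (g \<circ> chart_inv c) h' (chart_ran c)"
        using g unfolding weakly_differentiable_def by blast
      then show ?thesis by (intro exI[of _ "(c, h')"]) (simp add: P_def)
    qed
    show "open (chart_dom (fst p))" if "P p" for p using that chart_topology(1)[OF dm] by (simp add: P_def)
  qed blast
  define C where "C k = fst (s k)" for k
  define h where "h k = snd (s k)" for k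
  have C: "C k \<in> M" and h: "has_weak_derivative_on (g \<circ> chart_inv (C k)) (h k) (chart_ran (C k))" for k
    using s(1)[of k] by (auto simp: P_def C_def h_def)
  \<comment> \<open>Each point uses the first chart of the sequence that contains it. Measurability
    comes for free, as the patched form agrees almost everywhere with each local weak
    derivative.\<close>
  define \<kappa> where "\<kappa> x = (LEAST k. x \<in> chart_dom (C k))" for x
  have \<kappa>: "x \<in> chart_dom (C (\<kappa> x))" for x
    unfolding \<kappa>_def C_def by (rule LeastI_ex[of "\<lambda>k. x \<in> chart_dom (fst (s k))"]) (rule s(2))
  define \<omega> where "\<omega> X = h (\<kappa> (fst X)) (chart_map (C (\<kappa> (fst X))) (fst X)) (snd X (C (\<kappa> (fst X))))" for X
  have lin: "linear_on_fibre (tangent_space M x) (\<lambda>v. \<omega> (x, v))" for x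
  proof -
    have "linear (h (\<kappa> x) (chart_map (C (\<kappa> x)) x))"
      by (rule has_weak_derivative_onD(2)[OF h imageI[OF \<kappa>]])
    then show ?thesis by (simp add: linear_on_fibre_def \<omega>_def linear_add linear_scale)
  qed
  have "has_weak_derivative_on (g \<circ> chart_inv c) (\<lambda>y \<xi>. \<omega> (chart_inv_deriv M c y \<xi>)) (chart_ran c)" if c: "c \<in> M" for c
  proof (rule has_weak_derivative_on_localI[OF chart_topology(2)[OF dm c]])
    show "linear (\<lambda>\<xi>. \<omega> (chart_inv_deriv M c y \<xi>))" if "y \<in> chart_ran c" for y
      by (rule linear_on_fibre_chart_inv_deriv[OF dm lin c that])
    define W where "W k = chart_dom c \<inter> chart_dom (C k)" for k
    define V where "V k = chart_map c ` W k" for k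
    define H where "H k y \<xi> = h k (chart_map (C k) (chart_inv c y)) (frechet_derivative (chart_map (C k) \<circ> chart_inv c) (at y) \<xi>)"
      for k y \<xi>
    have W: "open (W k)" "W k \<subseteq> chart_dom c" "W k \<subseteq> chart_dom (C k)" for k
      unfolding W_def using open_Int[OF chart_topology(1)[OF dm c] chart_topology(1)[OF dm C]] by blast+
    have V: "open (V k)" "V k \<subseteq> chart_ran c" for k
      unfolding V_def by (rule chart_image_open[OF dm c W(1,2)]) (rule image_mono[OF W(2)])
    have HV: "has_weak_derivative_on (g \<circ> chart_inv c) (H k) (V k)" for k
    proof -
      have "has_weak_derivative_on (g \<circ> chart_inv (C k)) (h k) (chart_map (C k) ` W k)"
        by (rule has_weak_derivative_on_subset[OF h chart_topology(2)[OF dm C] chart_image_open[OF dm C W(1,3)]])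
          (rule image_mono[OF W(3)])
      from weak_derivative_chart_change[OF dm c C W this] show ?thesis unfolding H_def V_def .
    qed
    have N: "negligible {y \<in> V j \<inter> V k. \<exists>\<xi>. H j y \<xi> \<noteq> H k y \<xi>}" for j k
    proof (rule has_weak_derivative_on_unique)
      show op: "open (V j \<inter> V k)" by (intro open_Int V(1))
      show "has_weak_derivative_on (g \<circ> chart_inv c) (H j) (V j \<inter> V k)"
        by (rule has_weak_derivative_on_subset[OF HV V(1) op Int_lower1])
      show "has_weak_derivative_on (g \<circ> chart_inv c) (H k) (V j \<inter> V k)"
        by (rule has_weak_derivative_on_subset[OF HV V(1) op Int_lower2])
    qed
    have \<omega>H: "\<omega> (chart_inv_deriv M c y \<xi>) = H (\<kappa> (chart_inv c y)) y \<xi>" for y \<xi>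
      using C \<kappa> by (simp add: \<omega>_def H_def chart_inv_deriv_def)
    have \<kappa>V: "y \<in> V (\<kappa> (chart_inv c y))" if "y \<in> chart_ran c" for y
    proof -
      have "chart_inv c y \<in> W (\<kappa> (chart_inv c y))" using that \<kappa> chart_simps(3)[OF dm c] by (simp add: W_def)
      then show ?thesis unfolding V_def using chart_simps(2)[OF dm c that] by (metis imageI)
    qed
    fix y assume y: "y \<in> chart_ran c"
    define k where "k = \<kappa> (chart_inv c y)"
    \<comment> \<open>The selected index varies over \<open>V k\<close>, so \<open>H k\<close> is
      compared with all the \<open>H j\<close> at once.\<close>
    have "negligible (\<Union>j. {y \<in> V k \<inter> V j. \<exists>\<xi>. H k y \<xi> \<noteq> H j y \<xi>})"
      by (rule negligible_countable_Union) (use N in auto)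
    then have "negligible {y \<in> V k. \<exists>\<xi>. H k y \<xi> \<noteq> \<omega> (chart_inv_deriv M c y \<xi>)}"
    proof (rule negligible_subset)
      show "{y \<in> V k. \<exists>\<xi>. H k y \<xi> \<noteq> \<omega> (chart_inv_deriv M c y \<xi>)}
        \<subseteq> (\<Union>j. {y \<in> V k \<inter> V j. \<exists>\<xi>. H k y \<xi> \<noteq> H j y \<xi>})"
        using \<omega>H \<kappa>V V(2) by fastforce
    qed
    then show "\<exists>V q q'. open V \<and> y \<in> V \<and> V \<subseteq> chart_ran c \<and> has_weak_derivative_on q q' V \<and>
        negligible {y \<in> V. q y \<noteq> (g \<circ> chart_inv c) y} \<and>
        negligible {y \<in> V. \<exists>\<xi>. q' y \<xi> \<noteq> \<omega> (chart_inv_deriv M c y \<xi>)}"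
      using V HV \<kappa>V[OF y] by (intro exI[of _ "V k"] exI[of _ "g \<circ> chart_inv c"] exI[of _ "H k"]) (auto simp: k_def)
  qed
  then show ?thesis using lin unfolding is_weak_derivative_def by blast
qed

lemma weak_derivative_is_weak_derivative:
  assumes "differentiable_manifold M" "weakly_differentiable M g"
  shows "is_weak_derivative M g (weak_derivative M g)"
  unfolding weak_derivative_def using someI_ex[OF is_weak_derivative_exists[OF assms]] .

section \<open>Compactly supported coordinates\<close>

text \<open>Collects what a piece \<open>W\<close> of a chart has to offer: coordinates that are
  admissible in the definition of colocal differentiability and, for each \<open>f\<close>, a
  function on the whole Euclidean space with bounded derivative, as the chain rule asks.\<close>

definition cutoff_coordinates ::
    "('b::topological_space, real^'n) chart set \<Rightarrow> ('b, real^'n) chart \<Rightarrow> 'b set \<Rightarrow> ('b \<Rightarrow> real^'n) \<Rightarrow> bool" where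
  "cutoff_coordinates N d W \<phi> \<longleftrightarrow> d \<in> N \<and> open W \<and> W \<subseteq> chart_dom d \<and>
     (\<forall>i. C1_compact_support N (\<lambda>z. \<phi> z $ i)) \<and> (\<forall>z\<in>W. \<phi> z = chart_map d z) \<and>
     (\<forall>f. C1 N f \<longrightarrow> (\<exists>h h' C. has_C1_derivative_on h h' UNIV \<and> (\<forall>z \<zeta>. \<bar>h' z \<zeta>\<bar> \<le> C * norm \<zeta>) \<and>
        (\<forall>z\<in>W. h (chart_map d z) = f z)))"

lemma Ck_on_1_Un:
  "Ck_on 1 f S \<Longrightarrow> Ck_on 1 f T \<Longrightarrow> open S \<Longrightarrow> open T \<Longrightarrow> Ck_on 1 f (S \<union> T)"
  unfolding Ck_on_1_iff by (rule has_C1_derivative_on_Un)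

lemma C1_compact_support_extend:
  fixes N :: "('b::{t2_space,second_countable_topology}, 'f::euclidean_space) chart set"
  assumes dm: "differentiable_manifold N" and d: "d \<in> N"
    and F: "has_C1_derivative_on (F \<circ> chart_inv d) F' (chart_ran d)"
    and \<beta>: "has_C1_derivative_on \<beta> \<beta>' UNIV" and K: "compact K" "K \<subseteq> chart_ran d" "\<And>w. w \<notin> K \<Longrightarrow> \<beta> w = 0"
  shows "C1_compact_support N (\<lambda>z. if z \<in> chart_dom d then F z * \<beta> (chart_map d z) else 0)" (is "C1_compact_support N ?G")
proof -
  let ?K = "chart_inv d ` K"
  have cK: "compact ?K"
    by (rule compact_continuous_image[OF continuous_on_subset[OF chart_continuous(2)[OF dm d] K(2)] K(1)])
  \<comment> \<open>The Hausdorff property enters here: the compact set is closed in the manifold,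
    so the extension by 0 is C1 on the open complement, in particular across the boundary of the
    chart domain.\<close>
  have clK: "closed ?K" using cK by (rule compact_imp_closed)
  have Kd: "?K \<subseteq> chart_dom d" using K(2) chart_simps(3)[OF dm d] by blast
  have G0: "?G z = 0" if "z \<notin> ?K" for z
  proof (cases "z \<in> chart_dom d")
    case True
    then have "chart_map d z \<notin> K" using that chart_simps(1)[OF dm d] by (metis imageI)
    then show ?thesis using K(3) by simp
  qed simp
  have "Ck_on 1 (?G \<circ> chart_inv e) (chart_ran e)" if e: "e \<in> N" for e
  proof -
    let ?S = "chart_map e ` (chart_dom e \<inter> chart_dom d)" and ?T = "chart_map e ` (chart_dom e - ?K)"
    have op: "open ?S" "open ?T"
      by (intro chart_image_open[OF dm e] open_Int open_Diff chart_topology(1)[OF dm] d e clK; blast)+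
    have "has_C1_derivative_on (\<lambda>w. (F \<circ> chart_inv d) w * \<beta> w) (\<lambda>x \<xi>. (F \<circ> chart_inv d) x * \<beta>' x \<xi> + F' x \<xi> * \<beta> x) (chart_ran d)"
      by (rule has_C1_derivative_on_mult[OF F has_C1_derivative_on_subset[OF \<beta>]]) simp
    moreover have "(chart_map d \<circ> chart_inv e) ` ?S \<subseteq> chart_ran d" using chart_simps(1)[OF dm e] by auto
    ultimately have "Ck_on 1 (\<lambda>y. (F \<circ> chart_inv d) ((chart_map d \<circ> chart_inv e) y) * \<beta> ((chart_map d \<circ> chart_inv e) y)) ?S"
      using has_C1_derivative_on_imp_Ck_on_1[OF has_C1_derivative_on_compose[OF transition_C1[OF dm e d]]] by blast
    then have "has_C1_derivative_on (\<lambda>y. (F \<circ> chart_inv d) ((chart_map d \<circ> chart_inv e) y) * \<beta> ((chart_map d \<circ> chart_inv e) y))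
      (\<lambda>x. frechet_derivative (\<lambda>y. (F \<circ> chart_inv d) ((chart_map d \<circ> chart_inv e) y) * \<beta> ((chart_map d \<circ> chart_inv e) y)) (at x)) ?S"
      unfolding Ck_on_1_iff .
    then have "Ck_on 1 (?G \<circ> chart_inv e) ?S"
      by (rule has_C1_derivative_on_imp_Ck_on_1[OF has_C1_derivative_on_cong[OF _ op(1)]])
        (use chart_simps(1)[OF dm e] chart_simps(1)[OF dm d] in auto)
    moreover have "has_C1_derivative_on (?G \<circ> chart_inv e) (\<lambda>_ _. 0) ?T"
    proof (rule has_C1_derivative_on_vanishing[OF op(2)])
      fix y assume "y \<in> ?T"
      then have "chart_inv e y \<notin> ?K" using chart_simps(1)[OF dm e] by auto
      from G0[OF this] show "(?G \<circ> chart_inv e) y = 0" by simp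
    qed simp
    then have "Ck_on 1 (?G \<circ> chart_inv e) ?T" by (rule has_C1_derivative_on_imp_Ck_on_1)
    ultimately have "Ck_on 1 (?G \<circ> chart_inv e) (?S \<union> ?T)" using Ck_on_1_Un op by blast
    moreover have "?S \<union> ?T = chart_ran e"
    proof -
      have "(chart_dom e \<inter> chart_dom d) \<union> (chart_dom e - ?K) = chart_dom e" using Kd by blast
      then show ?thesis by (simp only: image_Un[symmetric])
    qed
    ultimately show ?thesis by simp
  qed
  moreover have "compact (closure {z. ?G z \<noteq> 0})"
  proof -
    have "closure {z. ?G z \<noteq> 0} \<subseteq> ?K" by (rule closure_minimal[OF _ clK]) (use G0 in blast)
    then have "?K \<inter> closure {z. ?G z \<noteq> 0} = closure {z. ?G z \<noteq> 0}" by blast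
    with compact_Int_closed[OF cK closed_closure, of "{z. ?G z \<noteq> 0}"] show ?thesis by (simp only:)
  qed
  ultimately show ?thesis unfolding C1_compact_support_def C1_def by blast
qed

lemma cutoff_coordinates_exist:
  fixes N :: "('b::{t2_space,second_countable_topology}, real^'n) chart set"
  assumes dm: "differentiable_manifold N" and d: "d \<in> N" "y \<in> chart_dom d"
  obtains W \<phi> where "y \<in> W" "cutoff_coordinates N d W \<phi>"
proof -
  have "chart_map d y \<in> chart_ran d" using d by blast
  then obtain r where r: "r > 0" "cball (chart_map d y) r \<subseteq> chart_ran d"
    using chart_topology(2)[OF dm d(1)] open_contains_cball_eq by blast
  define K where "K = cball (chart_map d y) (3 / 4 * r)"
  have K: "compact K" "K \<subseteq> chart_ran d" using r by (auto simp: K_def subset_iff)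
  obtain \<beta> \<beta>' where \<beta>: "has_C1_derivative_on \<beta> \<beta>' UNIV"
    "\<And>x. x \<in> ball (chart_map d y) (r / 2) \<Longrightarrow> \<beta> x = 1" "\<And>x. x \<notin> K \<Longrightarrow> \<beta> x = (0::real)"
    unfolding K_def by (rule C1_bump_exists[OF r(1), of "chart_map d y"]) blast
  \<comment> \<open>On this set the bump equals 1, so the cut off coordinates are the chart and the
    cut off function is \<open>f\<close>.\<close>
  define W where "W = chart_dom d \<inter> chart_map d -` ball (chart_map d y) (r / 2)"
  define \<phi> where "\<phi> z = (\<chi> i. if z \<in> chart_dom d then (chart_map d z $ i) * \<beta> (chart_map d z) else 0)" for z
  have W: "open W" "W \<subseteq> chart_dom d" "\<And>z. z \<in> W \<Longrightarrow> \<beta> (chart_map d z) = 1"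
    using chart_preimage_open[OF dm d(1)] \<beta>(2) by (auto simp: W_def)
  have "C1_compact_support N (\<lambda>z. \<phi> z $ i)" for i
  proof -
    have "has_C1_derivative_on (\<lambda>w::real^'n. w $ i) (\<lambda>_ \<xi>. \<xi> $ i) (chart_ran d)"
      by (rule has_C1_derivative_onI)
        (auto intro!: bounded_linear_imp_has_derivative bounded_linear_vec_nth)
    then have "has_C1_derivative_on ((\<lambda>z. chart_map d z $ i) \<circ> chart_inv d) (\<lambda>_ \<xi>. \<xi> $ i) (chart_ran d)"
      by (rule has_C1_derivative_on_cong[OF _ chart_topology(2)[OF dm d(1)]])
        (use chart_simps(2)[OF dm d(1)] in auto)
    from C1_compact_support_extend[OF dm d(1) this \<beta>(1) K \<beta>(3)]
    show ?thesis by (simp add: \<phi>_def)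
  qed
  moreover have "\<phi> z = chart_map d z" if "z \<in> W" for z
    using W(2,3) that by (auto simp: \<phi>_def vec_eq_iff)
  moreover have "\<exists>h h' C. has_C1_derivative_on h h' UNIV \<and> (\<forall>z \<zeta>. \<bar>h' z \<zeta>\<bar> \<le> C * norm \<zeta>) \<and>
        (\<forall>z\<in>W. h (chart_map d z) = f z)" if f: "C1 N f" for f
  proof -
    have "has_C1_derivative_on (f \<circ> chart_inv d) (\<lambda>x. frechet_derivative (f \<circ> chart_inv d) (at x)) (chart_ran d)"
      using f d(1) unfolding C1_def Ck_on_1_iff by blast
    from has_C1_derivative_on_cutoff[OF this chart_topology(2)[OF dm d(1)] \<beta>(1) compact_imp_closed[OF K(1)] K(2) \<beta>(3)]
    obtain h' where h': "has_C1_derivative_on (\<lambda>x. if x \<in> chart_ran d then (f \<circ> chart_inv d) x * \<beta> x else 0) h' UNIV"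
      (is "has_C1_derivative_on ?h _ _") by blast
    obtain C where "\<And>x \<xi>. norm (h' x \<xi>) \<le> C * norm \<xi>"
      by (rule has_C1_derivative_on_compact_support_bounded[OF h' K(1)]) (use \<beta>(3) in auto)
    moreover have "?h (chart_map d z) = f z" if "z \<in> W" for z
    proof -
      have "z \<in> chart_dom d" using that W(2) by blast
      moreover from this have "chart_map d z \<in> chart_ran d" by (rule imageI)
      ultimately show ?thesis using W(3)[OF that] chart_simps(1)[OF dm d(1)] by simp
    qed
    ultimately show ?thesis using h' unfolding real_norm_def by blast
  qed
  ultimately have "cutoff_coordinates N d W \<phi>"
    unfolding cutoff_coordinates_def using W d(1) by blast
  moreover have "y \<in> W" using d r by (simp add: W_def)
  ultimately show ?thesis using that by blast
qed

section \<open>The colocal weak derivative\<close>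

lemma cutoff_coordinatesD:
  assumes "cutoff_coordinates N d W \<phi>"
  shows "d \<in> N" "open W" "W \<subseteq> chart_dom d" "C1_compact_support N (\<lambda>z. \<phi> z $ i)"
    "z \<in> W \<Longrightarrow> \<phi> z = chart_map d z"
  using assms unfolding cutoff_coordinates_def by blast+

lemma measurable_map_preimage:
  assumes "measurable_map M u" "c \<in> M" "open (chart_ran c)" "U \<in> sets borel"
  shows "{y \<in> chart_ran c. u (chart_inv c y) \<in> U} \<in> sets lebesgue"
proof -
  have "(u \<circ> chart_inv c) -` U \<inter> space (lebesgue_on (chart_ran c)) \<in> sets (lebesgue_on (chart_ran c))"
    using assms(1,2,4) unfolding measurable_map_def by (blast intro: measurable_sets)
  moreover have "(u \<circ> chart_inv c) -` U \<inter> space (lebesgue_on (chart_ran c)) = {y \<in> chart_ran c. u (chart_inv c y) \<in> U}"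
    by auto
  ultimately show ?thesis using assms(3) by (simp add: sets_restrict_space_iff borel_open)
qed

lemma Basis_vec_real_cases:
  assumes "b \<in> (Basis :: (real^'n) set)"
  obtains i where "b = axis i 1"
  using assms by (auto simp: Basis_vec_def)

lemma frechet_derivative_eq_on_open:
  assumes "(g has_derivative g') (at x)" "open S" "x \<in> S" "\<And>y. y \<in> S \<Longrightarrow> g y = f y"
  shows "frechet_derivative f (at x) = g'"
  using frechet_derivative_at[OF has_derivative_transform_within_open[OF assms]] by simp

text \<open>Near \<open>p\<close> the cut off coordinate is the coordinate itself, so its
  differential reads off a component. Functions with compact support can thus detect every component
  of a tangent vector over \<open>W\<close>.\<close>

lemma differential_cutoff_coordinate:
  fixes N :: "('b::{t2_space,second_countable_topology}, real^'n) chart set"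
  assumes dm: "differentiable_manifold N" and cut: "cutoff_coordinates N d W \<phi>"
    and p: "p \<in> W" and w: "(p, w) \<in> tangent_bundle N"
  shows "differential N (\<lambda>z. \<phi> z $ i) (p, w) = w d $ i"
proof -
  note D = cutoff_coordinatesD[OF cut]
  have pd: "p \<in> chart_dom d" using D(3) p by blast
  have C1: "C1 N (\<lambda>z. \<phi> z $ i)" using D(4) by (simp add: C1_compact_support_def)
  have "frechet_derivative ((\<lambda>z. \<phi> z $ i) \<circ> chart_inv d) (at (chart_map d p)) = (\<lambda>\<xi>. \<xi> $ i)"
  proof (rule frechet_derivative_eq_on_open)
    show "((\<lambda>y. y $ i) has_derivative (\<lambda>\<xi>. \<xi> $ i)) (at (chart_map d p))"
      by (intro bounded_linear_imp_has_derivative bounded_linear_vec_nth)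
    show "open (chart_map d ` W)" by (rule chart_image_open[OF dm D(1,2,3)])
    show "chart_map d p \<in> chart_map d ` W" using p by (rule imageI)
    fix y assume "y \<in> chart_map d ` W"
    then obtain z where z: "z \<in> W" "y = chart_map d z" by blast
    then have "z \<in> chart_dom d" using D(3) by blast
    then show "y $ i = ((\<lambda>z. \<phi> z $ i) \<circ> chart_inv d) y"
      using z D(5) chart_simps(1)[OF dm D(1)] by simp
  qed
  then show ?thesis using differential_eq[OF dm C1 w D(1) pd] by simp
qed

text \<open>On \<open>u\<^sup>-\<^sup>1(W)\<close> the function \<open>f \<circ> u\<close> is a \<open>C\<^sup>1\<close> function of the weakly differentiable \<open>\<phi> \<circ> u\<close>,
  so that the chain rule and the locality of the weak derivative apply.\<close>

lemma weak_derivative_in_cutoff_coordinates: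
  fixes M :: "('a::{t2_space,second_countable_topology}, real^'m) chart set"
    and N :: "('b::{t2_space,second_countable_topology}, real^'n) chart set"
  assumes dM: "differentiable_manifold M" and dN: "differentiable_manifold N"
    and u: "colocally_weakly_differentiable M N u" and cut: "cutoff_coordinates N d W \<phi>"
    and f: "C1 N f" "weakly_differentiable M (f \<circ> u)" and c: "c \<in> M"
  shows "negligible {y \<in> chart_ran c. u (chart_inv c y) \<in> W \<and>
    (\<exists>\<xi>. weak_derivative M (f \<circ> u) (chart_inv_deriv M c y \<xi>) \<noteq>
      frechet_derivative (f \<circ> chart_inv d) (at (chart_map d (u (chart_inv c y))))
        (\<chi> i. weak_derivative M ((\<lambda>z. \<phi> z $ i) \<circ> u) (chart_inv_deriv M c y \<xi>)))}" (is "negligible ?Z")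
proof -
  note D = cutoff_coordinatesD[OF cut]
  define v where "v y = \<phi> (u (chart_inv c y))" for y
  define v' where "v' y \<xi> = (\<chi> i. weak_derivative M ((\<lambda>z. \<phi> z $ i) \<circ> u) (chart_inv_deriv M c y \<xi>))" for y \<xi>
  obtain h h' C where h: "has_C1_derivative_on h h' UNIV" "\<And>z \<zeta>. \<bar>h' z \<zeta>\<bar> \<le> C * norm \<zeta>"
    "\<And>z. z \<in> W \<Longrightarrow> h (chart_map d z) = f z"
    using cut f(1) unfolding cutoff_coordinates_def by blast
  have ran: "open (chart_ran c)" by (rule chart_topology(2)[OF dM c])
  \<comment> \<open>\<open>h\<close> and the cut off coordinates are defined everywhere, so the
    chain rule holds on the whole range of the chart, also where \<open>u\<close> leaves
    \<open>W\<close>.\<close>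
  have w1: "has_weak_derivative_on (\<lambda>y. h (v y)) (\<lambda>y \<xi>. h' (v y) (v' y \<xi>)) (chart_ran c)"
  proof (rule has_weak_derivative_on_compose[OF ran _ h(1,2)])
    fix b :: "real^'n" assume "b \<in> Basis"
    then obtain i where b: "b = axis i 1" by (rule Basis_vec_real_cases)
    have "weakly_differentiable M ((\<lambda>z. \<phi> z $ i) \<circ> u)"
      using u D(4) unfolding colocally_weakly_differentiable_def by blast
    then have "has_weak_derivative_on ((\<lambda>z. \<phi> z $ i) \<circ> u \<circ> chart_inv c)
      (\<lambda>y \<xi>. weak_derivative M ((\<lambda>z. \<phi> z $ i) \<circ> u) (chart_inv_deriv M c y \<xi>)) (chart_ran c)"
      using weak_derivative_is_weak_derivative[OF dM] c unfolding is_weak_derivative_def by blast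
    moreover have "(\<lambda>z. \<phi> z $ i) \<circ> u \<circ> chart_inv c = (\<lambda>y. v y \<bullet> b)"
      by (auto simp: v_def b inner_axis fun_eq_iff)
    moreover have "(\<lambda>y \<xi>. weak_derivative M ((\<lambda>z. \<phi> z $ i) \<circ> u) (chart_inv_deriv M c y \<xi>)) = (\<lambda>y \<xi>. v' y \<xi> \<bullet> b)"
      by (auto simp: v'_def b inner_axis fun_eq_iff)
    ultimately show "has_weak_derivative_on (\<lambda>y. v y \<bullet> b) (\<lambda>y \<xi>. v' y \<xi> \<bullet> b) (chart_ran c)" by simp
  qed
  have w2: "has_weak_derivative_on (f \<circ> u \<circ> chart_inv c)
    (\<lambda>y \<xi>. weak_derivative M (f \<circ> u) (chart_inv_deriv M c y \<xi>)) (chart_ran c)"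
    using weak_derivative_is_weak_derivative[OF dM f(2)] c unfolding is_weak_derivative_def by blast
  show ?thesis
  proof (rule negligible_subset[OF has_weak_derivative_on_locality[OF ran w1 w2]], rule subsetI)
    fix y assume "y \<in> ?Z"
    then obtain \<xi> where y: "y \<in> chart_ran c" "u (chart_inv c y) \<in> W"
      "weak_derivative M (f \<circ> u) (chart_inv_deriv M c y \<xi>) \<noteq>
        frechet_derivative (f \<circ> chart_inv d) (at (chart_map d (u (chart_inv c y)))) (v' y \<xi>)"
      unfolding v'_def by blast
    have v: "v y = chart_map d (u (chart_inv c y))" unfolding v_def by (rule D(5)[OF y(2)])
    \<comment> \<open>Equality of values on the open image of \<open>W\<close> gives equality of
      derivatives at the point.\<close>
    have "frechet_derivative (f \<circ> chart_inv d) (at (v y)) = h' (v y)"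
    proof (rule frechet_derivative_eq_on_open)
      show "(h has_derivative h' (v y)) (at (v y))" using has_C1_derivative_onD(1)[OF h(1)] by simp
      show "open (chart_map d ` W)" by (rule chart_image_open[OF dN D(1,2,3)])
      show "v y \<in> chart_map d ` W" unfolding v using y(2) by (rule imageI)
      fix w assume "w \<in> chart_map d ` W"
      then obtain z where z: "z \<in> W" "w = chart_map d z" by blast
      then have "z \<in> chart_dom d" using D(3) by blast
      then show "h w = (f \<circ> chart_inv d) w" using z h(3) chart_simps(1)[OF dN D(1)] by simp
    qed
    then have "h' (v y) (v' y \<xi>) \<noteq> weak_derivative M (f \<circ> u) (chart_inv_deriv M c y \<xi>)" using y(3) v by simp
    moreover have "h (v y) = (f \<circ> u \<circ> chart_inv c) y" using h(3)[OF y(2)] v by simp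
    ultimately show "y \<in> {y \<in> chart_ran c. h (v y) = (f \<circ> u \<circ> chart_inv c) y \<and>
      (\<exists>\<xi>. h' (v y) (v' y \<xi>) \<noteq> weak_derivative M (f \<circ> u) (chart_inv_deriv M c y \<xi>))}"
      using y(1) by blast
  qed
qed

lemma cutoff_coordinates_sequence:
  fixes N :: "('b::{t2_space,second_countable_topology}, real^'n) chart set"
  assumes "differentiable_manifold N"
  obtains d W \<phi> where "\<And>k::nat. cutoff_coordinates N (d k) (W k) (\<phi> k)" "\<And>z. \<exists>k. z \<in> W k"
proof -
  obtain s where s: "\<And>k. cutoff_coordinates N (fst (s k)) (fst (snd (s k))) (snd (snd (s k)))"
    "\<And>z. \<exists>k::nat. z \<in> fst (snd (s k))"
  proof (rule countable_subcover_sequence[of "\<lambda>p. cutoff_coordinates N (fst p) (fst (snd p)) (snd (snd p))" "\<lambda>p. fst (snd p)"])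
    show "\<exists>p. cutoff_coordinates N (fst p) (fst (snd p)) (snd (snd p)) \<and> z \<in> fst (snd p)" for z
    proof -
      obtain d where d: "d \<in> N" "z \<in> chart_dom d" using chart_covers[OF assms] by blast
      obtain W \<phi> where "z \<in> W" "cutoff_coordinates N d W \<phi>" by (rule cutoff_coordinates_exist[OF assms d])
      then show ?thesis by (intro exI[of _ "(d, W, \<phi>)"]) simp
    qed
    show "open (fst (snd p))" if "cutoff_coordinates N (fst p) (fst (snd p)) (snd (snd p))" for p
      by (rule cutoff_coordinatesD(2)[OF that])
  qed blast
  show ?thesis by (rule that[OF s])
qed

text \<open>Countably many of the sets \<open>W\<close> cover \<open>N\<close>, so their preimages
  split the exceptional set into countably many pieces.\<close>

lemma negligible_by_cutoff_coordinates:
  fixes N :: "('b::{t2_space,second_countable_topology}, real^'n) chart set"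
  assumes dN: "differentiable_manifold N"
    and "\<And>d W \<phi>. cutoff_coordinates N d W \<phi> \<Longrightarrow> negligible {y \<in> S. u y \<in> W \<and> Q y}"
  shows "negligible {y \<in> S. Q y}"
proof -
  obtain d W \<phi> where s: "\<And>k::nat. cutoff_coordinates N (d k) (W k) (\<phi> k)" "\<And>z. \<exists>k. z \<in> W k"
    using cutoff_coordinates_sequence[OF dN] by blast
  have "negligible (\<Union>k. {y \<in> S. u y \<in> W k \<and> Q y})"
    by (rule negligible_countable_Union) (use assms(2)[OF s(1)] in auto)
  then show ?thesis by (rule negligible_subset) (use s(2) in auto)
qed

text \<open>The defining identity, applied to the coordinates
  \<open>\<lambda>z. \<phi> z $ i\<close> alone, forces the components of \<open>Du\<close> wherever
  \<open>u\<close> lies in \<open>W\<close>. Uniqueness, integrability and the identity for general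
  C1 functions all start from here.\<close>

lemma colocal_weak_derivative_components:
  fixes M :: "('a::{t2_space,second_countable_topology}, real^'m) chart set"
    and N :: "('b::{t2_space,second_countable_topology}, real^'n) chart set"
  assumes dM: "differentiable_manifold M" and dN: "differentiable_manifold N"
    and Du: "is_colocal_weak_derivative M N u Du" and cut: "cutoff_coordinates N d W \<phi>" and c: "c \<in> M"
  shows "negligible {y \<in> chart_ran c. u (chart_inv c y) \<in> W \<and> (\<exists>\<xi>. snd (Du (chart_inv_deriv M c y \<xi>)) d \<noteq>
      (\<chi> i. weak_derivative M ((\<lambda>z. \<phi> z $ i) \<circ> u) (chart_inv_deriv M c y \<xi>)))}" (is "negligible ?Z")
proof -
  define N0 where "N0 i = {y \<in> chart_ran c. \<exists>\<xi>. weak_derivative M ((\<lambda>z. \<phi> z $ i) \<circ> u) (chart_inv_deriv M c y \<xi>)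
    \<noteq> (differential N (\<lambda>z. \<phi> z $ i) \<circ> Du) (chart_inv_deriv M c y \<xi>)}" for i
  have "negligible (N0 i)" for i
  proof -
    have "ae_equal_on_fibres M (weak_derivative M ((\<lambda>z. \<phi> z $ i) \<circ> u)) (differential N (\<lambda>z. \<phi> z $ i) \<circ> Du)"
      using Du cutoff_coordinatesD(4)[OF cut] unfolding is_colocal_weak_derivative_def by blast
    then show ?thesis using c unfolding ae_equal_on_fibres_iff[OF dM] N0_def by blast
  qed
  then have "negligible (\<Union>i. N0 i)" by (intro negligible_Union) auto
  then show ?thesis
  proof (rule negligible_subset, intro subsetI)
    fix y assume "y \<in> ?Z"
    then obtain \<xi> i where y: "y \<in> chart_ran c" "u (chart_inv c y) \<in> W"
      "snd (Du (chart_inv_deriv M c y \<xi>)) d $ i \<noteq> weak_derivative M ((\<lambda>z. \<phi> z $ i) \<circ> u) (chart_inv_deriv M c y \<xi>)"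
      by (auto simp: vec_eq_iff)
    define X where "X = chart_inv_deriv M c y \<xi>"
    have X: "X \<in> tangent_bundle M" "fst X = chart_inv c y"
      using chart_inv_deriv_tangent[OF dM c y(1)] by (simp_all add: X_def)
    then have DX: "Du X \<in> tangent_bundle N" "fst (Du X) = u (chart_inv c y)"
      using Du unfolding is_colocal_weak_derivative_def bundle_morphism_covering_def by auto
    then have "(u (chart_inv c y), snd (Du X)) \<in> tangent_bundle N" by (metis prod.collapse)
    from differential_cutoff_coordinate[OF dN cut y(2) this, of i]
    have "differential N (\<lambda>z. \<phi> z $ i) (Du X) = snd (Du X) d $ i" using DX(2) by (metis prod.collapse)
    then have "weak_derivative M ((\<lambda>z. \<phi> z $ i) \<circ> u) (chart_inv_deriv M c y \<xi>)
      \<noteq> (differential N (\<lambda>z. \<phi> z $ i) \<circ> Du) (chart_inv_deriv M c y \<xi>)"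
      using y(3) unfolding X_def by simp
    then have "y \<in> N0 i" using y(1) unfolding N0_def by blast
    then show "y \<in> (\<Union>i. N0 i)" by blast
  qed
qed

section \<open>Uniqueness and the identity for general C1 functions\<close>

lemma tangent_vector_eqI:
  assumes "differentiable_manifold N" "v \<in> tangent_space N p" "w \<in> tangent_space N p" "d \<in> N" "p \<in> chart_dom d" "v d = w d"
  shows "v = w"
proof -
  have "(p, v) = chart_inv_deriv N d (chart_map d p) (w d)"
    using tangent_vector_eq_chart_inv_deriv[OF assms(1,2,4,5)] unfolding assms(6) .
  then have "(p, v) = (p, w)"
    by (rule trans[OF _ tangent_vector_eq_chart_inv_deriv[OF assms(1,3,4,5), symmetric]])
  then show ?thesis by simp
qed

theorem colocal_weak_derivative_unique:
  fixes M :: "('a::{t2_space,second_countable_topology}, real^'m) chart set"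
    and N :: "('b::{t2_space,second_countable_topology}, real^'n) chart set"
  assumes dM: "differentiable_manifold M" and dN: "differentiable_manifold N"
    and Du: "is_colocal_weak_derivative M N u Du" and Du': "is_colocal_weak_derivative M N u Du'"
  shows "ae_equal_on_fibres M Du Du'"
  unfolding ae_equal_on_fibres_iff[OF dM]
proof
  fix c assume c: "c \<in> M"
  show "negligible {y \<in> chart_ran c. \<exists>\<xi>. Du (chart_inv_deriv M c y \<xi>) \<noteq> Du' (chart_inv_deriv M c y \<xi>)}"
  proof (rule negligible_by_cutoff_coordinates[OF dN, where u="\<lambda>y. u (chart_inv c y)"])
    fix d W \<phi> assume cut: "cutoff_coordinates N d W \<phi>"
    note n = colocal_weak_derivative_components[OF dM dN Du cut c] colocal_weak_derivative_components[OF dM dN Du' cut c]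
    show "negligible {y \<in> chart_ran c. u (chart_inv c y) \<in> W \<and> (\<exists>\<xi>. Du (chart_inv_deriv M c y \<xi>) \<noteq> Du' (chart_inv_deriv M c y \<xi>))}" (is "negligible ?Z")
    proof (rule negligible_subset[OF negligible_Un[OF n]], rule subsetI)
      fix y assume "y \<in> ?Z"
      then obtain \<xi> where y: "y \<in> chart_ran c" "u (chart_inv c y) \<in> W" "Du (chart_inv_deriv M c y \<xi>) \<noteq> Du' (chart_inv_deriv M c y \<xi>)"
        by blast
      define X where "X = chart_inv_deriv M c y \<xi>"
      have X: "X \<in> tangent_bundle M" "fst X = chart_inv c y"
        using chart_inv_deriv_tangent[OF dM c y(1)] by (simp_all add: X_def)
      then have DX: "Du X \<in> tangent_bundle N" "fst (Du X) = u (chart_inv c y)" "Du' X \<in> tangent_bundle N" "fst (Du' X) = u (chart_inv c y)"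
        using Du Du' unfolding is_colocal_weak_derivative_def bundle_morphism_covering_def by auto
      have "snd (Du X) \<in> tangent_space N (u (chart_inv c y))" "snd (Du' X) \<in> tangent_space N (u (chart_inv c y))"
        using DX by (auto simp: tangent_bundle_def)
      moreover have "snd (Du X) \<noteq> snd (Du' X)" using y(3) DX unfolding X_def by (metis prod.expand)
      ultimately have "snd (Du X) d \<noteq> snd (Du' X) d"
        using tangent_vector_eqI[OF dN] cutoff_coordinatesD(1,3)[OF cut] y(2) by blast
      then have "snd (Du X) d \<noteq> (\<chi> i. weak_derivative M ((\<lambda>z. \<phi> z $ i) \<circ> u) X) \<or>
        snd (Du' X) d \<noteq> (\<chi> i. weak_derivative M ((\<lambda>z. \<phi> z $ i) \<circ> u) X)" by auto
      then show "y \<in> {y \<in> chart_ran c. u (chart_inv c y) \<in> W \<and> (\<exists>\<xi>. snd (Du (chart_inv_deriv M c y \<xi>)) d \<noteq>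
          (\<chi> i. weak_derivative M ((\<lambda>z. \<phi> z $ i) \<circ> u) (chart_inv_deriv M c y \<xi>)))} \<union>
        {y \<in> chart_ran c. u (chart_inv c y) \<in> W \<and> (\<exists>\<xi>. snd (Du' (chart_inv_deriv M c y \<xi>)) d \<noteq>
          (\<chi> i. weak_derivative M ((\<lambda>z. \<phi> z $ i) \<circ> u) (chart_inv_deriv M c y \<xi>)))}"
        using y(1,2) unfolding X_def by blast
    qed
  qed
qed

text \<open>Where \<open>u\<close> lies in \<open>W\<close>, both sides are functions of the same
  components: \<open>Du\<close> by \<open>colocal_weak_derivative_components\<close>, the derivative
  of \<open>f \<circ> u\<close> by the chain rule in cutoff coordinates. The definition of
  \<open>Du\<close> is thus never applied to \<open>f\<close> itself.\<close>

theorem colocal_weak_derivative_C1: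
  fixes M :: "('a::{t2_space,second_countable_topology}, real^'m) chart set"
    and N :: "('b::{t2_space,second_countable_topology}, real^'n) chart set"
  assumes dM: "differentiable_manifold M" and dN: "differentiable_manifold N"
    and u: "colocally_weakly_differentiable M N u"
    and Du: "is_colocal_weak_derivative M N u Du" and f: "C1 N f" "weakly_differentiable M (f \<circ> u)"
  shows "ae_equal_on_fibres M (weak_derivative M (f \<circ> u)) (differential N f \<circ> Du)"
  unfolding ae_equal_on_fibres_iff[OF dM]
proof
  fix c assume c: "c \<in> M"
  show "negligible {y \<in> chart_ran c. \<exists>\<xi>. weak_derivative M (f \<circ> u) (chart_inv_deriv M c y \<xi>) \<noteq> (differential N f \<circ> Du) (chart_inv_deriv M c y \<xi>)}"
  proof (rule negligible_by_cutoff_coordinates[OF dN, where u="\<lambda>y. u (chart_inv c y)"])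
    fix d W \<phi> assume cut: "cutoff_coordinates N d W \<phi>"
    note n = colocal_weak_derivative_components[OF dM dN Du cut c] weak_derivative_in_cutoff_coordinates[OF dM dN u cut f c]
    show "negligible {y \<in> chart_ran c. u (chart_inv c y) \<in> W \<and>
      (\<exists>\<xi>. weak_derivative M (f \<circ> u) (chart_inv_deriv M c y \<xi>) \<noteq> (differential N f \<circ> Du) (chart_inv_deriv M c y \<xi>))}" (is "negligible ?Z")
    proof (rule negligible_subset[OF negligible_Un[OF n]], rule subsetI)
      fix y assume "y \<in> ?Z"
      then obtain \<xi> where y: "y \<in> chart_ran c" "u (chart_inv c y) \<in> W"
        "weak_derivative M (f \<circ> u) (chart_inv_deriv M c y \<xi>) \<noteq> differential N f (Du (chart_inv_deriv M c y \<xi>))"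
        by auto
      define X where "X = chart_inv_deriv M c y \<xi>"
      have X: "X \<in> tangent_bundle M" "fst X = chart_inv c y"
        using chart_inv_deriv_tangent[OF dM c y(1)] by (simp_all add: X_def)
      then have DX: "Du X \<in> tangent_bundle N" "fst (Du X) = u (chart_inv c y)"
        using Du unfolding is_colocal_weak_derivative_def bundle_morphism_covering_def by auto
      then have eq: "Du X = (u (chart_inv c y), snd (Du X))" by (simp add: prod_eq_iff)
      have "u (chart_inv c y) \<in> chart_dom d" using y(2) cutoff_coordinatesD(3)[OF cut] by blast
      from differential_eq[OF dN f(1) _ cutoff_coordinatesD(1)[OF cut] this, of "snd (Du X)"]
      have "differential N f (Du X) = frechet_derivative (f \<circ> chart_inv d) (at (chart_map d (u (chart_inv c y)))) (snd (Du X) d)"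
        using DX(1) eq by simp
      \<comment> \<open>If both component formulas held at this point, the two sides would agree; so
        one of the two negligible sets contains it.\<close>
      then have "snd (Du X) d \<noteq> (\<chi> i. weak_derivative M ((\<lambda>z. \<phi> z $ i) \<circ> u) X) \<or>
        weak_derivative M (f \<circ> u) X \<noteq> frechet_derivative (f \<circ> chart_inv d) (at (chart_map d (u (chart_inv c y))))
          (\<chi> i. weak_derivative M ((\<lambda>z. \<phi> z $ i) \<circ> u) X)"
        using y(3) unfolding X_def by auto
      then show "y \<in> {y \<in> chart_ran c. u (chart_inv c y) \<in> W \<and> (\<exists>\<xi>. snd (Du (chart_inv_deriv M c y \<xi>)) d \<noteq>
          (\<chi> i. weak_derivative M ((\<lambda>z. \<phi> z $ i) \<circ> u) (chart_inv_deriv M c y \<xi>)))} \<union>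
        {y \<in> chart_ran c. u (chart_inv c y) \<in> W \<and>
          (\<exists>\<xi>. weak_derivative M (f \<circ> u) (chart_inv_deriv M c y \<xi>) \<noteq>
          frechet_derivative (f \<circ> chart_inv d) (at (chart_map d (u (chart_inv c y))))
          (\<chi> i. weak_derivative M ((\<lambda>z. \<phi> z $ i) \<circ> u) (chart_inv_deriv M c y \<xi>)))}"
        using y(1,2) unfolding X_def by blast
    qed
  qed
qed

section \<open>Measurability and bilocal integrability\<close>

lemma weak_derivative_component_measurable:
  assumes dM: "differentiable_manifold M" and g: "weakly_differentiable M g" and c: "c \<in> M"
  shows "(\<lambda>y. weak_derivative M g (chart_inv_deriv M c y \<xi>)) \<in> borel_measurable (lebesgue_on (chart_ran c))"
    and "locally_integrable_on (\<lambda>y. weak_derivative M g (chart_inv_deriv M c y \<xi>)) (chart_ran c)"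
proof -
  have "has_weak_derivative_on (g \<circ> chart_inv c) (\<lambda>y \<xi>. weak_derivative M g (chart_inv_deriv M c y \<xi>)) (chart_ran c)"
    using weak_derivative_is_weak_derivative[OF dM g] c unfolding is_weak_derivative_def by blast
  then show 1: "locally_integrable_on (\<lambda>y. weak_derivative M g (chart_inv_deriv M c y \<xi>)) (chart_ran c)"
    by (rule has_weak_derivative_onD(3))
  show "(\<lambda>y. weak_derivative M g (chart_inv_deriv M c y \<xi>)) \<in> borel_measurable (lebesgue_on (chart_ran c))"
    by (rule borel_measurable_locally_integrable[OF 1 chart_topology(2)[OF dM c]])
qed

lemma local_representative_component:
  "local_representative M c d \<upsilon> y $ i $ j = chart_deriv d (\<upsilon> (chart_inv_deriv M c y (axis j 1))) $ i"
  by (simp add: local_representative_def matrix_def)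

lemma Basis_matrix_cases:
  assumes "b \<in> (Basis :: (real^'m^'n) set)"
  shows "\<exists>i j. \<forall>A :: real^'m^'n. A \<bullet> b = A $ i $ j"
proof -
  obtain i b' where "b = axis i b'" "b' \<in> (Basis :: (real^'m) set)" using assms by (auto simp: Basis_vec_def)
  moreover from this(2) obtain j where "b' = axis j 1" by (rule Basis_vec_real_cases)
  ultimately have "A \<bullet> b = A $ i $ j" for A :: "real^'m^'n" by (simp add: inner_axis)
  then show ?thesis by blast
qed

text \<open>Any charts around the two points will do. Finitely many sets \<open>W\<close> cover
  \<open>K\<close>, and where \<open>u\<close> lies in one of them the entries of the representative
  are almost everywhere weak derivatives, which are integrable over the compact image of
  \<open>L\<close>.\<close>

theorem colocal_weak_derivative_bilocally_integrable:
  fixes M :: "('a::{t2_space,second_countable_topology}, real^'m) chart set"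
    and N :: "('b::{t2_space,second_countable_topology}, real^'n) chart set"
  assumes dM: "differentiable_manifold M" and dN: "differentiable_manifold N"
    and u: "colocally_weakly_differentiable M N u"
    and Du: "is_colocal_weak_derivative M N u Du"
  shows "bilocally_integrable_on M N u Du UNIV"
  unfolding bilocally_integrable_on_def
proof (intro allI)
  fix x y
  obtain c where c: "c \<in> M" "x \<in> chart_dom c" using chart_covers[OF dM] by blast
  obtain d where d: "d \<in> N" "y \<in> chart_dom d" using chart_covers[OF dN] by blast
  have um: "measurable_map M u" using u by (simp add: colocally_weakly_differentiable_def)
  note pre = measurable_map_preimage[OF um c(1) chart_topology(2)[OF dM c(1)]]
  have int: "local_representative M c d Du absolutely_integrable_on chart_map c ` (UNIV \<inter> L \<inter> u -` K)"
    if LK: "compact L" "L \<subseteq> chart_dom c" "compact K" "K \<subseteq> chart_dom d" for L K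
  proof -
    define E where "E = chart_map c ` (UNIV \<inter> L \<inter> u -` K)"
    have cL: "compact (chart_map c ` L)" "chart_map c ` L \<subseteq> chart_ran c"
      using compact_continuous_image[OF continuous_on_subset[OF chart_continuous(1)[OF dM c(1)] LK(2)] LK(1)] LK(2) by auto
    have cLs: "chart_map c ` L \<in> sets lebesgue" using cL(1) by (simp add: fmeasurableD lmeasurable_compact)
    have E: "E = chart_map c ` L \<inter> {w \<in> chart_ran c. u (chart_inv c w) \<in> K}"
    proof
      show "E \<subseteq> chart_map c ` L \<inter> {w \<in> chart_ran c. u (chart_inv c w) \<in> K}"
        using LK(2) chart_simps(1)[OF dM c(1)] unfolding E_def by (auto simp: subset_iff)
      show "chart_map c ` L \<inter> {w \<in> chart_ran c. u (chart_inv c w) \<in> K} \<subseteq> E"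
      proof
        fix w assume w: "w \<in> chart_map c ` L \<inter> {w \<in> chart_ran c. u (chart_inv c w) \<in> K}"
        then obtain z where z: "z \<in> L" "w = chart_map c z" by blast
        then have "chart_inv c w = z" using LK(2) chart_simps(1)[OF dM c(1)] by blast
        then show "w \<in> E" using w z unfolding E_def by auto
      qed
    qed
    have Es: "E \<in> sets lebesgue"
      unfolding E by (intro sets.Int cLs pre borel_closed compact_imp_closed LK(3))
    \<comment> \<open>All cutoffs are taken in the one chart \<open>d\<close> of the representative;
      only \<open>W\<close> and \<open>\<phi>\<close> depend on the point.\<close>
    have "\<forall>z\<in>K. \<exists>W \<phi>. z \<in> W \<and> cutoff_coordinates N d W \<phi>"
      using cutoff_coordinates_exist[OF dN d(1)] LK(4) by (metis subsetD)
    from bchoice[OF this] obtain W where W: "\<And>z. z \<in> K \<Longrightarrow> \<exists>\<phi>. z \<in> W z \<and> cutoff_coordinates N d (W z) \<phi>" by blast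
    obtain F where F: "F \<subseteq> K" "finite F" "K \<subseteq> (\<Union>z\<in>F. W z)"
    proof (rule compactE_image[OF LK(3), of K W])
      show "open (W z)" if "z \<in> K" for z using W[OF that] cutoff_coordinatesD(2) by blast
      show "K \<subseteq> (\<Union>z\<in>K. W z)" using W by blast
    qed blast
    define A where "A z = chart_map c ` L \<inter> {w \<in> chart_ran c. u (chart_inv c w) \<in> W z}" for z
    have As: "A z \<in> sets lebesgue" if "z \<in> K" for z
      unfolding A_def using W[OF that] cutoff_coordinatesD(2) by (intro sets.Int cLs pre borel_open) blast
    have comp: "(\<lambda>w. local_representative M c d Du w $ i $ j) absolutely_integrable_on A z" if z: "z \<in> K" for z i j
    proof -
      obtain \<phi> where cut: "cutoff_coordinates N d (W z) \<phi>" using W[OF z] by blast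
      have "weakly_differentiable M ((\<lambda>p. \<phi> p $ i) \<circ> u)"
        using u cutoff_coordinatesD(4)[OF cut] unfolding colocally_weakly_differentiable_def by blast
      from weak_derivative_component_measurable(2)[OF dM this c(1), of "axis j 1"]
      have "(\<lambda>w. weak_derivative M ((\<lambda>p. \<phi> p $ i) \<circ> u) (chart_inv_deriv M c w (axis j 1))) absolutely_integrable_on chart_map c ` L"
        using cL unfolding locally_integrable_on_def by blast
      then have "(\<lambda>w. weak_derivative M ((\<lambda>p. \<phi> p $ i) \<circ> u) (chart_inv_deriv M c w (axis j 1))) absolutely_integrable_on A z"
        by (rule set_integrable_subset[OF _ As[OF z]]) (simp add: A_def)
      then show ?thesis
      proof (rule absolutely_integrable_spike[OF _ colocal_weak_derivative_components[OF dM dN Du cut c(1)]])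
        fix w assume "w \<in> A z - {y \<in> chart_ran c. u (chart_inv c y) \<in> W z \<and> (\<exists>\<xi>. snd (Du (chart_inv_deriv M c y \<xi>)) d \<noteq>
          (\<chi> i. weak_derivative M ((\<lambda>z. \<phi> z $ i) \<circ> u) (chart_inv_deriv M c y \<xi>)))}"
        then have "snd (Du (chart_inv_deriv M c w (axis j 1))) d =
          (\<chi> i. weak_derivative M ((\<lambda>z. \<phi> z $ i) \<circ> u) (chart_inv_deriv M c w (axis j 1)))"
          unfolding A_def by blast
        then show "local_representative M c d Du w $ i $ j
          = weak_derivative M ((\<lambda>p. \<phi> p $ i) \<circ> u) (chart_inv_deriv M c w (axis j 1))"
          by (simp add: local_representative_component chart_deriv_def)
      qed
    qed
    have comp_E: "(\<lambda>w. local_representative M c d Du w $ i $ j) absolutely_integrable_on E" for i j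
    proof (rule set_integrable_subset[OF set_integrable_UN[OF F(2)] Es])
      show "(\<lambda>w. local_representative M c d Du w $ i $ j) absolutely_integrable_on A z" "A z \<in> sets lebesgue" if "z \<in> F" for z
        using comp As F(1) that by auto
      show "E \<subseteq> (\<Union>z\<in>F. A z)" unfolding E A_def using F(3) by blast
    qed
    have "local_representative M c d Du absolutely_integrable_on E"
    proof (rule absolutely_integrable_componentwise)
      fix b :: "real^'m^'n" assume "b \<in> Basis"
      from Basis_matrix_cases[OF this] obtain i j where ij: "\<forall>A :: real^'m^'n. A \<bullet> b = A $ i $ j" by blast
      show "(\<lambda>w. local_representative M c d Du w \<bullet> b) absolutely_integrable_on E" unfolding ij[rule_format] by (rule comp_E)
    qed
    then show ?thesis by (simp add: E_def)
  qed
  show "\<exists>c\<in>M. \<exists>d\<in>N. x \<in> chart_dom c \<and> y \<in> chart_dom d \<and>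
      (\<forall>L K. compact L \<and> L \<subseteq> chart_dom c \<and> compact K \<and> K \<subseteq> chart_dom d \<longrightarrow>
         local_representative M c d Du absolutely_integrable_on chart_map c ` (UNIV \<inter> L \<inter> u -` K))"
  proof (intro bexI[of _ c] bexI[of _ d] conjI allI impI c d)
    fix L K assume "compact L \<and> L \<subseteq> chart_dom c \<and> compact K \<and> K \<subseteq> chart_dom d"
    then show "local_representative M c d Du absolutely_integrable_on chart_map c ` (UNIV \<inter> L \<inter> u -` K)"
      by (elim conjE) (rule int)
  qed
qed

text \<open>Cutoff coordinates prescribe the components almost everywhere, but a bundle morphism is
  defined everywhere, so one piece of \<open>N\<close> is selected at each point. The identity for
  \<open>f\<close> is then the chain rule in the selected piece.\<close>

theorem colocal_weak_derivative_exists: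
  fixes M :: "('a::{t2_space,second_countable_topology}, real^'m) chart set"
    and N :: "('b::{t2_space,second_countable_topology}, real^'n) chart set"
  assumes dM: "differentiable_manifold M" and dN: "differentiable_manifold N"
    and u: "colocally_weakly_differentiable M N u"
  shows "\<exists>Du. is_colocal_weak_derivative M N u Du"
proof -
  obtain d W \<phi> where cut: "\<And>k::nat. cutoff_coordinates N (d k) (W k) (\<phi> k)" and cov: "\<And>z. \<exists>k. z \<in> W k"
    using cutoff_coordinates_sequence[OF dN] by blast
  note D = cutoff_coordinatesD[OF cut]
  \<comment> \<open>With the least index, the sets on which one formula holds are differences of
    preimages of open sets, hence measurable.\<close>
  define \<kappa> where "\<kappa> z = (LEAST k. z \<in> W k)" for z
  have \<kappa>: "z \<in> W (\<kappa> z)" for z unfolding \<kappa>_def by (rule LeastI_ex[of "\<lambda>k. z \<in> W k", OF cov])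
  have \<kappa>d: "z \<in> chart_dom (d (\<kappa> z))" for z by (rule subsetD[OF D(3) \<kappa>])
  define \<omega> where "\<omega> k i = weak_derivative M ((\<lambda>z. \<phi> k z $ i) \<circ> u)" for k i
  have wd: "weakly_differentiable M ((\<lambda>z. \<phi> k z $ i) \<circ> u)" for k i
    using u D(4) unfolding colocally_weakly_differentiable_def by blast
  \<comment> \<open>Built as a coordinate vector at \<open>u (fst X)\<close>, the image is a tangent
    vector by construction, with the right components in all charts.\<close>
  define Du where "Du X = chart_inv_deriv N (d (\<kappa> (u (fst X)))) (chart_map (d (\<kappa> (u (fst X)))) (u (fst X)))
    (\<chi> i. \<omega> (\<kappa> (u (fst X))) i X)" for X
  have Du_fst: "fst (Du X) = u (fst X)" for X
    unfolding Du_def chart_inv_deriv_def fst_conv by (rule chart_simps(1)[OF dN D(1) \<kappa>d])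
  have ran: "chart_map (d (\<kappa> z)) z \<in> chart_ran (d (\<kappa> z))" for z by (rule imageI[OF \<kappa>d])
  have Du_T: "Du X \<in> tangent_bundle N" for X
    unfolding Du_def by (rule chart_inv_deriv_tangent(3)[OF dN D(1) ran])
  have Du_snd: "snd (Du X) e = frechet_derivative (chart_map e \<circ> chart_inv (d (\<kappa> (u (fst X))))) (at (chart_map (d (\<kappa> (u (fst X)))) (u (fst X))))
    (\<chi> i. \<omega> (\<kappa> (u (fst X))) i X)" if "e \<in> N" "u (fst X) \<in> chart_dom e" for X e
    unfolding Du_def chart_inv_deriv_def using chart_simps(1)[OF dN D(1) \<kappa>d] that by simp
  have lin: "linear_on_fibre (tangent_space M x) (\<lambda>v. \<omega> k i (x, v))" for x k i
    using weak_derivative_is_weak_derivative[OF dM wd] unfolding is_weak_derivative_def \<omega>_def by blast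
  have bm: "bundle_morphism_covering M N u Du"
    unfolding bundle_morphism_covering_def
  proof (intro conjI ballI allI Du_T Du_fst)
    fix x e
    show "linear_on_fibre (tangent_space M x) (\<lambda>v. snd (Du (x, v)) e)"
    proof (cases "e \<in> N \<and> u x \<in> chart_dom e")
      case True
      define L where "L = frechet_derivative (chart_map e \<circ> chart_inv (d (\<kappa> (u x)))) (at (chart_map (d (\<kappa> (u x))) (u x)))"
      have "linear L" unfolding L_def
        using transition_has_derivative[OF dN D(1) _ \<kappa>d] True has_derivative_linear by blast
      moreover have "snd (Du (x, v)) e = L (\<chi> i. \<omega> (\<kappa> (u x)) i (x, v))" for v
        unfolding L_def using Du_snd[of e "(x, v)"] True by simp
      moreover have "(\<chi> i. \<omega> (\<kappa> (u x)) i (x, \<lambda>c. a *\<^sub>R v c + b *\<^sub>R w c))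
        = a *\<^sub>R (\<chi> i. \<omega> (\<kappa> (u x)) i (x, v)) + b *\<^sub>R (\<chi> i. \<omega> (\<kappa> (u x)) i (x, w))"
        if "v \<in> tangent_space M x" "w \<in> tangent_space M x" for a b v w
        using lin[of x "\<kappa> (u x)"] that unfolding linear_on_fibre_def by (simp add: vec_eq_iff)
      ultimately show ?thesis unfolding linear_on_fibre_def by (simp add: linear_add linear_scale)
    next
      case False
      then have "snd (Du (x, v)) e = 0" for v
        using chart_simps(1)[OF dN D(1) \<kappa>d, of "u x"] unfolding Du_def chart_inv_deriv_def by auto
      then show ?thesis unfolding linear_on_fibre_def by simp
    qed
  qed
  have ae: "ae_equal_on_fibres M (weak_derivative M (f \<circ> u)) (differential N f \<circ> Du)" if f: "C1_compact_support N f" for f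
    unfolding ae_equal_on_fibres_iff[OF dM]
  proof
    fix c assume c: "c \<in> M"
    have f1: "C1 N f" using f by (simp add: C1_compact_support_def)
    have fw: "weakly_differentiable M (f \<circ> u)" using u f unfolding colocally_weakly_differentiable_def by blast
    define Z where "Z k = {y \<in> chart_ran c. u (chart_inv c y) \<in> W k \<and>
      (\<exists>\<xi>. weak_derivative M (f \<circ> u) (chart_inv_deriv M c y \<xi>) \<noteq>
        frechet_derivative (f \<circ> chart_inv (d k)) (at (chart_map (d k) (u (chart_inv c y))))
        (\<chi> i. \<omega> k i (chart_inv_deriv M c y \<xi>)))}" for k
    have "negligible (Z k)" for k
      unfolding Z_def \<omega>_def by (rule weak_derivative_in_cutoff_coordinates[OF dM dN u cut f1 fw c])
    then have "negligible (\<Union>k. Z k)" by (intro negligible_countable_Union) auto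
    then show "negligible {y \<in> chart_ran c. \<exists>\<xi>. weak_derivative M (f \<circ> u) (chart_inv_deriv M c y \<xi>) \<noteq> (differential N f \<circ> Du) (chart_inv_deriv M c y \<xi>)}" (is "negligible ?Z")
    proof (rule negligible_subset, intro subsetI)
      fix y assume "y \<in> ?Z"
      then obtain \<xi> where y: "y \<in> chart_ran c"
        "weak_derivative M (f \<circ> u) (chart_inv_deriv M c y \<xi>) \<noteq> differential N f (Du (chart_inv_deriv M c y \<xi>))"
        by auto
      define X where "X = chart_inv_deriv M c y \<xi>"
      define z where "z = u (chart_inv c y)"
      have X: "fst X = chart_inv c y" by (simp add: X_def chart_inv_deriv_def)
      have eq: "Du X = (z, snd (Du X))" using Du_fst[of X] X by (simp add: prod_eq_iff z_def)
      have "differential N f (Du X) = frechet_derivative (f \<circ> chart_inv (d (\<kappa> z))) (at (chart_map (d (\<kappa> z)) z)) (snd (Du X) (d (\<kappa> z)))"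
        using differential_eq[OF dN f1 _ D(1) \<kappa>d, of z "snd (Du X)"] Du_T[of X] eq by simp
      \<comment> \<open>In the selected chart itself the transition derivative is the
        identity.\<close>
      also have "snd (Du X) (d (\<kappa> z)) = (\<chi> i. \<omega> (\<kappa> z) i X)"
        using Du_snd[of "d (\<kappa> z)" X] X D(1) \<kappa>d[of z] transition_self[OF dN D(1) \<kappa>d] by (simp add: z_def)
      finally have eq: "differential N f (Du X) = frechet_derivative (f \<circ> chart_inv (d (\<kappa> z)))
        (at (chart_map (d (\<kappa> z)) z)) (\<chi> i. \<omega> (\<kappa> z) i X)" .
      have "weak_derivative M (f \<circ> u) (chart_inv_deriv M c y \<xi>) \<noteq>
        frechet_derivative (f \<circ> chart_inv (d (\<kappa> z))) (at (chart_map (d (\<kappa> z)) z)) (\<chi> i. \<omega> (\<kappa> z) i (chart_inv_deriv M c y \<xi>))"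
        using y(2) unfolding eq[unfolded X_def] .
      then have "y \<in> Z (\<kappa> z)"
        unfolding Z_def using y(1) \<kappa>[of z] unfolding z_def by blast
      then show "y \<in> (\<Union>k. Z k)" by blast
    qed
  qed
  have um: "measurable_map M u" using u by (simp add: colocally_weakly_differentiable_def)
  have mb: "measurable_bundle_morphism M N u Du"
    unfolding measurable_bundle_morphism_def
  proof (intro ballI)
    fix c e assume c: "c \<in> M" and e: "e \<in> N"
    note pre = measurable_map_preimage[OF um c chart_topology(2)[OF dM c]]
    define A where "A = {y \<in> chart_ran c. u (chart_inv c y) \<in> chart_dom e}"
    have Aeq: "chart_map c ` (chart_dom c \<inter> u -` chart_dom e) = A"
    proof
      show "chart_map c ` (chart_dom c \<inter> u -` chart_dom e) \<subseteq> A"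
        using chart_simps(1)[OF dM c] unfolding A_def by auto
      show "A \<subseteq> chart_map c ` (chart_dom c \<inter> u -` chart_dom e)"
      proof
        fix y assume y: "y \<in> A"
        show "y \<in> chart_map c ` (chart_dom c \<inter> u -` chart_dom e)"
          by (rule image_eqI[of _ _ "chart_inv c y"]) (use y chart_simps(2,3)[OF dM c, of y] in \<open>auto simp: A_def\<close>)
      qed
    qed
    have As: "A \<in> sets lebesgue"
      unfolding A_def by (intro pre borel_open chart_topology(1)[OF dN e])
    \<comment> \<open>On \<open>B k\<close> the morphism is given by the single chart
      \<open>d k\<close>, and these countably many pieces exhaust \<open>A\<close>.\<close>
    define B where "B k = {y \<in> A. \<kappa> (u (chart_inv c y)) = k}" for k
    have Bs: "B k \<in> sets lebesgue" for k
    proof -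
      have P: "A \<inter> {y \<in> chart_ran c. u (chart_inv c y) \<in> W j} \<in> sets lebesgue" for j
        by (intro sets.Int As pre borel_open D(2))
      have "B k = (A \<inter> {y \<in> chart_ran c. u (chart_inv c y) \<in> W k}) - (\<Union>j\<in>{..<k}. A \<inter> {y \<in> chart_ran c. u (chart_inv c y) \<in> W j})"
      proof (intro set_eqI iffI)
        fix y assume "y \<in> B k"
        then have y: "y \<in> A" "y \<in> chart_ran c" "\<kappa> (u (chart_inv c y)) = k" by (auto simp: B_def A_def)
        then show "y \<in> (A \<inter> {y \<in> chart_ran c. u (chart_inv c y) \<in> W k}) - (\<Union>j\<in>{..<k}. A \<inter> {y \<in> chart_ran c. u (chart_inv c y) \<in> W j})"
          using \<kappa>[of "u (chart_inv c y)"] not_less_Least[of _ "\<lambda>k. u (chart_inv c y) \<in> W k"] unfolding \<kappa>_def[symmetric] by auto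
      next
        fix y assume y: "y \<in> (A \<inter> {y \<in> chart_ran c. u (chart_inv c y) \<in> W k}) - (\<Union>j\<in>{..<k}. A \<inter> {y \<in> chart_ran c. u (chart_inv c y) \<in> W j})"
        then have "\<kappa> (u (chart_inv c y)) = k"
          unfolding \<kappa>_def by (intro Least_equality) (auto simp: not_less[symmetric])
        then show "y \<in> B k" using y by (simp add: B_def)
      qed
      then show ?thesis using P by (simp only:) (intro sets.Diff sets.finite_UN P finite_lessThan)
    qed
    have comp: "(\<lambda>y. local_representative M c e Du y $ i $ j) \<in> borel_measurable (lebesgue_on A)" for i j
    proof (rule measurable_piecewise_restrict[of "range B"])
      show "space (lebesgue_on A) \<subseteq> \<Union> (range B)" by (auto simp: B_def)
      show "Y \<inter> space (lebesgue_on A) \<in> sets (lebesgue_on A)" if "Y \<in> range B" for Y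
        using that As Bs by (auto simp: sets_restrict_space_iff)
      fix Y assume "Y \<in> range B"
      then obtain k where Y: "Y = B k" by blast
      have BA: "B k \<subseteq> A" "B k \<subseteq> chart_ran c" by (auto simp: B_def A_def)
      define O' where "O' = W k \<inter> chart_dom e"
      have O': "open O'" "O' \<subseteq> chart_dom (d k)" "O' \<subseteq> chart_dom e"
        using D(2,3)[of k] chart_topology(1)[OF dN e] unfolding O'_def by (auto simp: open_Int)
      \<comment> \<open>Entries in row \<open>i\<close> of the Jacobian matrix of the change of
        charts from \<open>d k\<close> to \<open>e\<close>, extended by 0 to a Borel function on all
        of \<open>N\<close>, so that composition with the measurable \<open>u\<close> is
        measurable.\<close>
      define q where "q l z = indicator O' z *\<^sub>R (frechet_derivative (chart_map e \<circ> chart_inv (d k)) (at (chart_map (d k) z)) (axis l 1) $ i)" for l z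
      have qm: "q l \<in> borel_measurable borel" for l
        unfolding q_def
      proof (rule borel_measurable_continuous_on_indicator)
        show "O' \<in> sets borel" using O'(1) by (rule borel_open)
        show "continuous_on O' (\<lambda>z. frechet_derivative (chart_map e \<circ> chart_inv (d k)) (at (chart_map (d k) z)) (axis l 1) $ i)"
        proof (intro continuous_intros, rule continuous_on_compose2[OF has_C1_derivative_onD(2)[OF transition_C1[OF dN D(1) e]]])
          show "continuous_on O' (chart_map (d k))" by (rule continuous_on_subset[OF chart_continuous(1)[OF dN D(1)] O'(2)])
          show "chart_map (d k) ` O' \<subseteq> chart_map (d k) ` (chart_dom (d k) \<inter> chart_dom e)" using O' by blast
        qed
      qed
      have "(\<lambda>y. \<Sum>l\<in>UNIV. \<omega> k l (chart_inv_deriv M c y (axis j 1)) * q l (u (chart_inv c y))) \<in> borel_measurable (lebesgue_on (B k))"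
      proof (intro borel_measurable_sum borel_measurable_times)
        fix l
        show "(\<lambda>y. \<omega> k l (chart_inv_deriv M c y (axis j 1))) \<in> borel_measurable (lebesgue_on (B k))"
          unfolding \<omega>_def by (rule measurable_restrict_mono[OF weak_derivative_component_measurable(1)[OF dM wd c] BA(2)])
        have "(u \<circ> chart_inv c) \<in> borel_measurable (lebesgue_on (chart_ran c))" using um c unfolding measurable_map_def by blast
        from measurable_compose[OF measurable_restrict_mono[OF this BA(2)] qm[of l]]
        show "(\<lambda>y. q l (u (chart_inv c y))) \<in> borel_measurable (lebesgue_on (B k))" by simp
      qed
      moreover have "local_representative M c e Du y $ i $ j = (\<Sum>l\<in>UNIV. \<omega> k l (chart_inv_deriv M c y (axis j 1)) * q l (u (chart_inv c y)))"
        if y: "y \<in> B k" for y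
      proof -
        define z where "z = u (chart_inv c y)"
        have z: "\<kappa> z = k" "z \<in> chart_dom e" using y by (auto simp: B_def A_def z_def)
        then have zO: "z \<in> O'" "z \<in> chart_dom (d k)" using \<kappa>[of z] D(3)[of k] by (auto simp: O'_def)
        define X where "X = chart_inv_deriv M c y (axis j 1)"
        have X: "fst X = chart_inv c y" by (simp add: X_def chart_inv_deriv_def)
        define L where "L = frechet_derivative (chart_map e \<circ> chart_inv (d k)) (at (chart_map (d k) z))"
        have L: "linear L" unfolding L_def
          using transition_has_derivative[OF dN D(1) e zO(2) z(2)] has_derivative_linear by blast
        have "local_representative M c e Du y $ i $ j = L (\<chi> l. \<omega> k l X) $ i"
          using Du_snd[OF e, of X] z X by (simp add: local_representative_component chart_deriv_def X_def[symmetric] z_def[symmetric] L_def)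
        \<comment> \<open>The expansion separates the weak derivatives, which depend on
          \<open>y\<close>, from the transition entries, which depend on \<open>y\<close> only
          through \<open>u\<close>.\<close>
        also have "(\<chi> l. \<omega> k l X) = (\<Sum>l\<in>UNIV. \<omega> k l X *\<^sub>R axis l 1)"
          by (simp add: vec_eq_iff axis_def if_distrib cong: if_cong)
        also have "L \<dots> $ i = (\<Sum>l\<in>UNIV. \<omega> k l X * L (axis l 1) $ i)"
          by (simp add: linear_sum[OF L] linear_scale[OF L])
        also have "\<dots> = (\<Sum>l\<in>UNIV. \<omega> k l X * q l z)" using zO(1) by (simp add: q_def L_def)
        finally show ?thesis by (simp add: X_def z_def)
      qed
      ultimately have "(\<lambda>y. local_representative M c e Du y $ i $ j) \<in> borel_measurable (lebesgue_on (B k))"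
        by (subst measurable_cong) auto
      moreover have "restrict_space (lebesgue_on A) Y = lebesgue_on (B k)"
        using BA(1) As Bs Y by (subst restrict_restrict_space) (auto simp: Int_absorb1)
      ultimately show "(\<lambda>y. local_representative M c e Du y $ i $ j) \<in> borel_measurable (restrict_space (lebesgue_on A) Y)" by simp
    qed auto
    show "local_representative M c e Du \<in> borel_measurable (lebesgue_on (chart_map c ` (chart_dom c \<inter> u -` chart_dom e)))"
      unfolding Aeq borel_measurable_euclidean_space[of "local_representative M c e Du"]
    proof
      fix b :: "real^'m^'n" assume "b \<in> Basis"
      from Basis_matrix_cases[OF this] obtain i j where ij: "\<forall>A :: real^'m^'n. A \<bullet> b = A $ i $ j" by blast
      show "(\<lambda>y. local_representative M c e Du y \<bullet> b) \<in> borel_measurable (lebesgue_on A)" unfolding ij[rule_format] by (rule comp)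
    qed
  qed
  show ?thesis
    unfolding is_colocal_weak_derivative_def using bm mb ae by blast
qed

theorem proposition1p2:
  fixes M :: "('a::{t2_space, second_countable_topology}, real^'m) chart set"
    and N :: "('b::{t2_space, second_countable_topology}, real^'n) chart set"
    and u :: "'a \<Rightarrow> 'b"
  assumes "differentiable_manifold M"
    and "differentiable_manifold N"
    and "colocally_weakly_differentiable M N u"
  shows "(\<exists>Du. is_colocal_weak_derivative M N u Du) \<and>
    (\<forall>Du Du'. is_colocal_weak_derivative M N u Du \<and> is_colocal_weak_derivative M N u Du' \<longrightarrow>
       ae_equal_on_fibres M Du Du') \<and>
    (\<forall>Du. is_colocal_weak_derivative M N u Du \<longrightarrow>
       bilocally_integrable_on M N u Du UNIV \<and>
       (\<forall>f. C1 N f \<and> weakly_differentiable M (f \<circ> u) \<longrightarrow>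
          ae_equal_on_fibres M (weak_derivative M (f \<circ> u)) (differential N f \<circ> Du)))"
  using colocal_weak_derivative_exists[OF assms] colocal_weak_derivative_unique[OF assms(1,2)]
    colocal_weak_derivative_bilocally_integrable[OF assms] colocal_weak_derivative_C1[OF assms]
  by blast

end
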